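(* Let $V\in\mathbf{Rep}_{Sp_{2n}}Y(\mathfrak{sp}_{2n})$ be simple, and suppose that as an $Sp_{2n}$-module $V\cong V(\lambda^{(1)},p)\oplus\cdots\oplus V(\lambda^{(k)},p)$ with $\lambda^{(j)}\in X(H)^+\cap C_{\mathbb Z}$ and $(\lambda^{(j)})_1=0$ for all $j$. Then $V$ is a highest weight representation $V=V(\mu(u))$ whose highest weight $\mu(u)=(\mu_1(u),\ldots,\mu_n(u))$ satisfies $$\mu_1(-u)\Longrightarrow\mu_1(u)\longrightarrow\mu_2(u)\longrightarrow\cdots\longrightarrow\mu_n(u).$$
   Context: $\mathbb K$ is an algebraically closed field of characteristic $p\ne2$ ($p=0$ allowed), $N=2n$; rows and columns of $N\times N$ matrices are indexed by $I_N=\{-n,\ldots,-1,1,\ldots,n\}$. $\theta_{ij}=\mathrm{sgn}(i)\,\mathrm{sgn}(j)$, $G=[\delta_{i,-j}\,\mathrm{sgn}(i)]$, $A'=G^{-1}A^tG$, i.e. $(A')_{ij}=\theta_{ij}a_{-j,-i}$. $Sp_{2n}$ is the group preserving $G$; $\mathfrak{sp}_{2n}$ is spanned by $F_{ij}=E_{ij}-\theta_{ij}E_{-j,-i}$. $P=\sum E_{ij}\otimes E_{ji}$, $R(u)=1-P/u$, $R'(u)=1-P'/u$ where $P'$ is $P$ with $A\mapsto A'$ applied in the first tensor factor. $Y(\mathfrak{sp}_{2n})$ is the unital associative algebra generated by $s_{ij}^{(r)}$ ($r\ge1$, $i,j\in I_N$) with $\mathcal S(u)=[s_{ij}(u)]$,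 $s_{ij}(u)=\delta_{ij}+\sum_{r\ge1}s_{ij}^{(r)}u^{-r}$, and relations $R(u-v)\mathcal S_1(u)R'(-u-v)\mathcal S_2(v)=\mathcal S_2(v)R'(-u-v)\mathcal S_1(u)R(u-v)$ and $\mathcal S'(-u)=\mathcal S(u)-\frac{\mathcal S(u)-\mathcal S(-u)}{2u}$. $U(\mathfrak{sp}_{2n})\hookrightarrow Y(\mathfrak{sp}_{2n})$ by $F_{ij}\mapsto s_{ij}^{(1)}$. $H\subset Sp_{2n}$ is the torus of matrices $\mathrm{diag}(t_n^{-1},\ldots,t_1^{-1},t_1,\ldots,t_n)$, with characters $\varepsilon_i\mapsto t_i$; weights are $\lambda=\sum_{i=1}^n\lambda_i\varepsilon_i$. Positive roots: $\pm\varepsilon_i-\varepsilon_j$ ($i<j$), $-2\varepsilon_i$. $X(H)^+=\{0\ge\lambda_1\ge\cdots\ge\lambda_n,\ \lambda_i\in\mathbb Z\}$. $C_{\mathbb Z}=\{\lambda:0\le\langle\lambda+\rho,\alpha^\vee\rangle<p'\ \text{for all positive roots }\alpha\}$, with $\rho$ the half-sum of positive roots, $p'=p$ if $p>0$ and $p'=\infty$ if $p=0$. $V(\lambda,p)$ is the simple $Sp_{2n}$-module of highest weight $\lambda$. $\mathbf{Rep}_{Sp_{2n}}Y(\mathfrak{sp}_{2n})$: finite-dimensional $Sp_{2n}$-modules with a $Y(\mathfrak{sp}_{2n})$-module structure such that the $\mathfrak{sp}_{2n}$-actions coming from $Sp_{2n}$ and from $Y(\mathfrak{sp}_{2n})$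 coincide (simple: irreducible as a $Y(\mathfrak{sp}_{2n})$-module). A highest weight representation of $Y(\mathfrak{sp}_{2n})$ with highest weight $\mu(u)=(\mu_1(u),\ldots,\mu_n(u))$, $\mu_i(u)\in1+u^{-1}\mathbb K[[u^{-1}]]$, is one generated by a nonzero $\xi$ with $s_{ij}(u)\xi=0$ for $i<j$ and $s_{ii}(u)\xi=\mu_i(u)\xi$ for $1\le i\le n$; $V(\mu(u))$ denotes the irreducible one. $\nu(u)\longrightarrow\mu(u)$ means there is a monic polynomial $P(u)$ with $\nu(u)/\mu(u)=P(u+1)/P(u)$. $\mu(-u)\Longrightarrow\mu(u)$ means there is a monic polynomial $P(u)$ with $P(u)=P(-u+1)$ and $\mu(-u)/\mu(u)=P(u+1)/P(u)$. *)

theory Defs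
  imports
    "HOL-Algebra.QuotRing"
    "HOL-Library.Poly_Mapping"
    "HOL-Library.FuncSet"
    "HOL-Computational_Algebra.Formal_Laurent_Series"
begin

section \<open>Matrices over the index set\<close>

definition index_set :: "nat \<Rightarrow> int set" where
  "index_set n = {- int n..int n} - {0}"

text \<open>Matrices are functions of two indices; only the entries with both indices in the
  given index set matter.\<close>

definition mat_one :: "'i set \<Rightarrow> 'i \<Rightarrow> 'i \<Rightarrow> 'a::zero_neq_one" where
  "mat_one I = (\<lambda>i j. if i \<in> I \<and> i = j then 1 else 0)"

definition mat_mult ::
  "'i set \<Rightarrow> ('i \<Rightarrow> 'i \<Rightarrow> 'a) \<Rightarrow> ('i \<Rightarrow> 'i \<Rightarrow> 'a) \<Rightarrow> 'i \<Rightarrow> 'i \<Rightarrow> 'a::semiring_0" where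
  "mat_mult I A B = (\<lambda>i j. \<Sum>k\<in>I. A i k * B k j)"

definition mat_transpose :: "('i \<Rightarrow> 'i \<Rightarrow> 'a) \<Rightarrow> 'i \<Rightarrow> 'i \<Rightarrow> 'a" where
  "mat_transpose A = (\<lambda>i j. A j i)"

definition mat_unit :: "int \<Rightarrow> int \<Rightarrow> int \<Rightarrow> int \<Rightarrow> 'a::zero_neq_one" where
  "mat_unit i j = (\<lambda>k l. if k = i \<and> l = j then 1 else 0)"

definition theta :: "int \<Rightarrow> int \<Rightarrow> 'a::ring_1" where
  "theta i j = of_int (sgn i * sgn j)"

text \<open>The involution \<open>A \<mapsto> A' = G\<^sup>-\<^sup>1 A\<^sup>t G\<close>, written entrywise so that it also applies to
  matrices over noncommutative rings.\<close>

definition mat_prime :: "(int \<Rightarrow> int \<Rightarrow> 'a::ring_1) \<Rightarrow> int \<Rightarrow> int \<Rightarrow> 'a" where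
  "mat_prime A = (\<lambda>i j. theta i j * A (- j) (- i))"

definition form_G :: "nat \<Rightarrow> int \<Rightarrow> int \<Rightarrow> 'a::ring_1" where
  "form_G n = (\<lambda>i j. if i \<in> index_set n \<and> i = - j then of_int (sgn i) else 0)"

definition F_mat :: "int \<Rightarrow> int \<Rightarrow> int \<Rightarrow> int \<Rightarrow> 'a::ring_1" where
  "F_mat i j = (\<lambda>k l. mat_unit i j k l - theta i j * mat_unit (- j) (- i) k l)"


section \<open>The group \<open>Sp\<^sub>2\<^sub>n\<close> and its rational modules\<close>

type_synonym 'k matrix = "int \<Rightarrow> int \<Rightarrow> 'k"

text \<open>Over an algebraically closed field of characteristic not 2 the algebraic group is
  identified with its group of rational points.  Matrices are required to vanish outside the
  index set so that they are determined by their entries.\<close>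

definition Sp :: "nat \<Rightarrow> 'k::field matrix monoid" where
  "Sp n = \<lparr>carrier = {g. (\<forall>i j. i \<notin> index_set n \<or> j \<notin> index_set n \<longrightarrow> g i j = 0) \<and>
                       mat_mult (index_set n)
                         (mat_mult (index_set n) (mat_transpose g) (form_G n)) g = form_G n},
           monoid.mult = mat_mult (index_set n),
           one = mat_one (index_set n)\<rparr>"

text \<open>The coordinate ring \<open>\<bbbK>[Sp\<^sub>2\<^sub>n]\<close>: functions on the group that are polynomial in the
  matrix entries.\<close>

inductive_set regular_functions :: "nat \<Rightarrow> ('k::field matrix \<Rightarrow> 'k) set" for n :: nat where
  const: "(\<lambda>g\<in>carrier (Sp n). c) \<in> regular_functions n"
| coord: "i \<in> index_set n \<Longrightarrow> j \<in> index_set n \<Longrightarrow>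
    (\<lambda>g\<in>carrier (Sp n). g i j) \<in> regular_functions n"
| add: "f \<in> regular_functions n \<Longrightarrow> h \<in> regular_functions n \<Longrightarrow>
    (\<lambda>g\<in>carrier (Sp n). f g + h g) \<in> regular_functions n"
| mult: "f \<in> regular_functions n \<Longrightarrow> h \<in> regular_functions n \<Longrightarrow>
    (\<lambda>g\<in>carrier (Sp n). f g * h g) \<in> regular_functions n"

definition End_ring :: "('k::field \<Rightarrow> 'v::ab_group_add \<Rightarrow> 'v) \<Rightarrow> ('v \<Rightarrow> 'v) ring" where
  "End_ring scale = \<lparr>carrier = {f. Vector_Spaces.linear scale scale f},
     monoid.mult = (\<circ>), one = id, ring.zero = (\<lambda>_. 0), add = (\<lambda>f g v. f v + g v)\<rparr>"

text \<open>Rational representation: a homomorphism to \<open>GL(V)\<close> all of whose matrix coefficients are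
  regular functions.\<close>

definition Sp_module ::
  "nat \<Rightarrow> ('k::field \<Rightarrow> 'v::ab_group_add \<Rightarrow> 'v) \<Rightarrow> ('k matrix \<Rightarrow> 'v \<Rightarrow> 'v) \<Rightarrow> bool" where
  "Sp_module n scale \<rho> \<longleftrightarrow>
     \<rho> \<in> hom (Sp n) (units_of (End_ring scale)) \<and>
     (\<forall>l v. Vector_Spaces.linear scale ((*) :: 'k \<Rightarrow> 'k \<Rightarrow> 'k) l \<longrightarrow>
        (\<lambda>g\<in>carrier (Sp n). l (\<rho> g v)) \<in> regular_functions n)"

text \<open>The Lie algebra as the tangent space at the identity: the point derivations
  \<open>\<bbbK>[Sp\<^sub>2\<^sub>n] \<rightarrow> \<bbbK>\<close> at \<open>1\<close>.  The derivation attached to a matrix \<open>X\<close> is the one that sends the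
  coordinate function \<open>x\<^sub>i\<^sub>j\<close> to \<open>X\<^sub>i\<^sub>j\<close>.\<close>

definition point_derivation :: "nat \<Rightarrow> (('k::field matrix \<Rightarrow> 'k) \<Rightarrow> 'k) \<Rightarrow> bool" where
  "point_derivation n D \<longleftrightarrow>
     (\<forall>f\<in>regular_functions n. \<forall>h\<in>regular_functions n.
        D (\<lambda>g\<in>carrier (Sp n). f g + h g) = D f + D h \<and>
        D (\<lambda>g\<in>carrier (Sp n). f g * h g) = D f * h \<one>\<^bsub>Sp n\<^esub> + f \<one>\<^bsub>Sp n\<^esub> * D h) \<and>
     (\<forall>c. D (\<lambda>g\<in>carrier (Sp n). c) = 0)"

definition tangent_derivation ::
  "nat \<Rightarrow> 'k::field matrix \<Rightarrow> (('k matrix \<Rightarrow> 'k) \<Rightarrow> 'k) \<Rightarrow> bool" where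
  "tangent_derivation n X D \<longleftrightarrow> point_derivation n D \<and>
     (\<forall>i\<in>index_set n. \<forall>j\<in>index_set n. D (\<lambda>g\<in>carrier (Sp n). g i j) = X i j)"

text \<open>\<open>T = d\<rho>(X)\<close>, i.e. \<open>l(T v)\<close> is the derivative at the identity, in the direction \<open>X\<close>,
  of the matrix coefficient \<open>g \<mapsto> l(\<rho>(g) v)\<close>.\<close>

definition is_differential ::
  "nat \<Rightarrow> ('k::field \<Rightarrow> 'v::ab_group_add \<Rightarrow> 'v) \<Rightarrow> ('k matrix \<Rightarrow> 'v \<Rightarrow> 'v) \<Rightarrow>
   'k matrix \<Rightarrow> ('v \<Rightarrow> 'v) \<Rightarrow> bool" where
  "is_differential n scale \<rho> X T \<longleftrightarrow>
     (\<exists>D. tangent_derivation n X D \<and>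
        (\<forall>l v. Vector_Spaces.linear scale ((*) :: 'k \<Rightarrow> 'k \<Rightarrow> 'k) l \<longrightarrow>
           l (T v) = D (\<lambda>g\<in>carrier (Sp n). l (\<rho> g v))))"

definition Sp_submodule ::
  "nat \<Rightarrow> ('k::field \<Rightarrow> 'v::ab_group_add \<Rightarrow> 'v) \<Rightarrow> ('k matrix \<Rightarrow> 'v \<Rightarrow> 'v) \<Rightarrow> 'v set \<Rightarrow> bool" where
  "Sp_submodule n scale \<rho> W \<longleftrightarrow>
     module.subspace scale W \<and> (\<forall>g\<in>carrier (Sp n). \<forall>w\<in>W. \<rho> g w \<in> W)"

definition Sp_simple_submodule ::
  "nat \<Rightarrow> ('k::field \<Rightarrow> 'v::ab_group_add \<Rightarrow> 'v) \<Rightarrow> ('k matrix \<Rightarrow> 'v \<Rightarrow> 'v) \<Rightarrow> 'v set \<Rightarrow> bool" where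
  "Sp_simple_submodule n scale \<rho> W \<longleftrightarrow>
     Sp_submodule n scale \<rho> W \<and> W \<noteq> {0} \<and>
     (\<forall>U. Sp_submodule n scale \<rho> U \<and> U \<subseteq> W \<longrightarrow> U = {0} \<or> U = W)"


section \<open>Weights\<close>

text \<open>A weight \<open>\<kappa> = \<Sum> \<kappa>\<^sub>i \<epsilon>\<^sub>i\<close> is represented by the function \<open>i \<mapsto> \<kappa>\<^sub>i\<close>, of which only the
  values at \<open>1, \<dots>, n\<close> matter.\<close>

definition torus_elem :: "nat \<Rightarrow> (nat \<Rightarrow> 'k::field) \<Rightarrow> 'k matrix" where
  "torus_elem n t = (\<lambda>i j. if i \<in> index_set n \<and> i = j
     then (if i > 0 then t (nat i) else inverse (t (nat (- i)))) else 0)"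

definition weight_vector ::
  "nat \<Rightarrow> ('k::field \<Rightarrow> 'v::ab_group_add \<Rightarrow> 'v) \<Rightarrow> ('k matrix \<Rightarrow> 'v \<Rightarrow> 'v) \<Rightarrow>
   (nat \<Rightarrow> int) \<Rightarrow> 'v \<Rightarrow> bool" where
  "weight_vector n scale \<rho> \<nu> v \<longleftrightarrow>
     (\<forall>t. (\<forall>i\<in>{1..n}. t i \<noteq> 0) \<longrightarrow>
        \<rho> (torus_elem n t) v = scale (\<Prod>i=1..n. t i powi \<nu> i) v)"

definition is_weight ::
  "nat \<Rightarrow> ('k::field \<Rightarrow> 'v::ab_group_add \<Rightarrow> 'v) \<Rightarrow> ('k matrix \<Rightarrow> 'v \<Rightarrow> 'v) \<Rightarrow>
   'v set \<Rightarrow> (nat \<Rightarrow> int) \<Rightarrow> bool" where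
  "is_weight n scale \<rho> W \<nu> \<longleftrightarrow> (\<exists>v\<in>W. v \<noteq> 0 \<and> weight_vector n scale \<rho> \<nu> v)"

definition eps :: "nat \<Rightarrow> nat \<Rightarrow> int" where
  "eps i = (\<lambda>k. if k = i then 1 else 0)"

definition positive_roots :: "nat \<Rightarrow> (nat \<Rightarrow> int) set" where
  "positive_roots n =
     {(\<lambda>k. eps i k - eps j k) | i j. 1 \<le> i \<and> i < j \<and> j \<le> n} \<union>
     {(\<lambda>k. - eps i k - eps j k) | i j. 1 \<le> i \<and> i < j \<and> j \<le> n} \<union>
     {(\<lambda>k. - 2 * eps i k) | i. 1 \<le> i \<and> i \<le> n}"

definition weight_le :: "nat \<Rightarrow> (nat \<Rightarrow> int) \<Rightarrow> (nat \<Rightarrow> int) \<Rightarrow> bool" where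
  "weight_le n \<nu> \<kappa> \<longleftrightarrow> (\<exists>c :: (nat \<Rightarrow> int) \<Rightarrow> nat. \<forall>i\<in>{1..n}.
     \<kappa> i - \<nu> i = (\<Sum>\<alpha>\<in>positive_roots n. int (c \<alpha>) * \<alpha> i))"

text \<open>\<open>W\<close> is a copy of \<open>V(\<kappa>,p)\<close>: it is simple, and \<open>\<kappa>\<close> is its highest weight.\<close>

definition is_simple_hw_module ::
  "nat \<Rightarrow> ('k::field \<Rightarrow> 'v::ab_group_add \<Rightarrow> 'v) \<Rightarrow> ('k matrix \<Rightarrow> 'v \<Rightarrow> 'v) \<Rightarrow>
   (nat \<Rightarrow> int) \<Rightarrow> 'v set \<Rightarrow> bool" where
  "is_simple_hw_module n scale \<rho> \<kappa> W \<longleftrightarrow>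
     Sp_simple_submodule n scale \<rho> W \<and>
     is_weight n scale \<rho> W \<kappa> \<and>
     (\<forall>\<nu>. is_weight n scale \<rho> W \<nu> \<longrightarrow> weight_le n \<nu> \<kappa>)"

definition Sp_decomposition ::
  "nat \<Rightarrow> ('k::field \<Rightarrow> 'v::ab_group_add \<Rightarrow> 'v) \<Rightarrow> ('k matrix \<Rightarrow> 'v \<Rightarrow> 'v) \<Rightarrow>
   nat \<Rightarrow> (nat \<Rightarrow> nat \<Rightarrow> int) \<Rightarrow> bool" where
  "Sp_decomposition n scale \<rho> k \<kappa> \<longleftrightarrow>
     (\<exists>W. (\<forall>j\<in>{1..k}. is_simple_hw_module n scale \<rho> (\<kappa> j) (W j)) \<and>
          (\<forall>v. \<exists>!w. w \<in> (\<Pi>\<^sub>E j\<in>{1..k}. W j) \<and> v = (\<Sum>j=1..k. w j)))"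

definition dominant_weights :: "nat \<Rightarrow> (nat \<Rightarrow> int) set" where
  "dominant_weights n = {\<kappa>. \<kappa> 1 \<le> 0 \<and> (\<forall>i\<in>{1..<n}. \<kappa> (Suc i) \<le> \<kappa> i)}"

definition rho_weight :: "nat \<Rightarrow> nat \<Rightarrow> rat" where
  "rho_weight n = (\<lambda>i. (\<Sum>\<alpha>\<in>positive_roots n. of_int (\<alpha> i)) / 2)"

definition coroot_pairing :: "nat \<Rightarrow> (nat \<Rightarrow> rat) \<Rightarrow> (nat \<Rightarrow> int) \<Rightarrow> rat" where
  "coroot_pairing n x \<alpha> = 2 * (\<Sum>i=1..n. x i * of_int (\<alpha> i)) / (\<Sum>i=1..n. (of_int (\<alpha> i))\<^sup>2)"

text \<open>Characteristic \<open>p = 0\<close> stands for \<open>p' = \<infinity>\<close>, i.e. there is no upper bound.\<close>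

definition closed_alcove :: "nat \<Rightarrow> nat \<Rightarrow> (nat \<Rightarrow> int) set" where
  "closed_alcove n p = {\<kappa>. \<forall>\<alpha>\<in>positive_roots n.
     0 \<le> coroot_pairing n (\<lambda>i. of_int (\<kappa> i) + rho_weight n i) \<alpha> \<and>
     (p > 0 \<longrightarrow> coroot_pairing n (\<lambda>i. of_int (\<kappa> i) + rho_weight n i) \<alpha> < of_nat p)}"


section \<open>The twisted Yangian\<close>

datatype 'g free_monoid = Free_Monoid (letters: "'g list")

instantiation free_monoid :: (type) monoid_add
begin

definition zero_free_monoid :: "'a free_monoid" where
  "zero_free_monoid = Free_Monoid []"

definition plus_free_monoid :: "'a free_monoid \<Rightarrow> 'a free_monoid \<Rightarrow> 'a free_monoid" where
  "plus_free_monoid a b = Free_Monoid (letters a @ letters b)"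

instance
  by standard (auto simp: zero_free_monoid_def plus_free_monoid_def)

end

text \<open>The letter \<open>(i, j, r)\<close> stands for the generator \<open>s\<^sub>i\<^sub>j\<^sup>(\<^sup>r\<^sup>)\<close>; elements of the free algebra
  are finite linear combinations of words, with the convolution product.\<close>

type_synonym 'k free_alg = "(int \<times> int \<times> nat) free_monoid \<Rightarrow>\<^sub>0 'k"

definition free_algebra :: "nat \<Rightarrow> 'k::field free_alg ring" where
  "free_algebra n = \<lparr>carrier = {a. \<forall>w\<in>Poly_Mapping.keys a. set (letters w) \<subseteq> index_set n \<times> index_set n \<times> {1..}},
     monoid.mult = (*), one = 1, ring.zero = 0, add = (+)\<rparr>"

definition scalar :: "'k::field \<Rightarrow> 'k free_alg" where
  "scalar c = Poly_Mapping.single 0 c"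

text \<open>The coefficients of \<open>s\<^sub>i\<^sub>j(u)\<close>, including the constant one.\<close>

definition s_gen :: "int \<Rightarrow> int \<Rightarrow> nat \<Rightarrow> 'k::field free_alg" where
  "s_gen i j r = (if r = 0 then of_bool (i = j)
                  else Poly_Mapping.single (Free_Monoid [(i, j, r)]) 1)"

text \<open>Series in \<open>u\<^sup>-\<^sup>1\<close> are formal power series in \<open>x = u\<^sup>-\<^sup>1\<close>; series in \<open>u\<^sup>-\<^sup>1\<close> and \<open>v\<^sup>-\<^sup>1\<close> are
  power series in \<open>y = v\<^sup>-\<^sup>1\<close> whose coefficients are power series in \<open>x\<close>.\<close>

definition S_mat :: "int \<Rightarrow> int \<Rightarrow> 'k::field free_alg fps" where
  "S_mat = (\<lambda>i j. Abs_fps (s_gen i j))"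

definition S_neg_mat :: "int \<Rightarrow> int \<Rightarrow> 'k::field free_alg fps" where
  "S_neg_mat = (\<lambda>i j. Abs_fps (\<lambda>r. (- 1) ^ r * s_gen i j r))"

definition S_u :: "int \<Rightarrow> int \<Rightarrow> 'k::field free_alg fps fps" where
  "S_u = (\<lambda>i j. fps_const (S_mat i j))"

definition S_v :: "int \<Rightarrow> int \<Rightarrow> 'k::field free_alg fps fps" where
  "S_v = (\<lambda>i j. Abs_fps (\<lambda>r. fps_const (s_gen i j r)))"

definition x_ser :: "'a::ring_1 fps fps" where "x_ser = fps_const fps_X"
definition y_ser :: "'a::ring_1 fps fps" where "y_ser = fps_X"

text \<open>Elements of \<open>End \<bbbK>\<^sup>N \<otimes> End \<bbbK>\<^sup>N \<otimes> A\<close> are matrices indexed by pairs: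
  the entry at \<open>((i,k),(j,l))\<close> is the coefficient of \<open>E\<^sub>i\<^sub>j \<otimes> E\<^sub>k\<^sub>l\<close>.\<close>

definition kron ::
  "(int \<Rightarrow> int \<Rightarrow> 'a::semiring_1) \<Rightarrow> (int \<Rightarrow> int \<Rightarrow> 'a) \<Rightarrow> int \<times> int \<Rightarrow> int \<times> int \<Rightarrow> 'a" where
  "kron A B = (\<lambda>(i, k) (j, l). A i j * B k l)"

definition P_mat :: "nat \<Rightarrow> int \<times> int \<Rightarrow> int \<times> int \<Rightarrow> 'a::ring_1" where
  "P_mat n = (\<lambda>a b. \<Sum>i\<in>index_set n. \<Sum>j\<in>index_set n. kron (mat_unit i j) (mat_unit j i) a b)"

definition P'_mat :: "nat \<Rightarrow> int \<times> int \<Rightarrow> int \<times> int \<Rightarrow> 'a::ring_1" where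
  "P'_mat n = (\<lambda>a b. \<Sum>i\<in>index_set n. \<Sum>j\<in>index_set n.
     kron (mat_prime (mat_unit i j)) (mat_unit j i) a b)"

text \<open>Denominators are cleared: \<open>R(u - v) = 1 - P/(u - v)\<close> is multiplied by \<open>y - x = xy(u - v)\<close>,
  and \<open>R'(- u - v) = 1 + P'/(u + v)\<close> by \<open>x + y = xy(u + v)\<close>.  Both factors are central, not zero
  divisors, and occur once on each side of the quaternary relation.\<close>

definition R_cleared :: "nat \<Rightarrow> int \<times> int \<Rightarrow> int \<times> int \<Rightarrow> 'a::ring_1 fps fps" where
  "R_cleared n = (\<lambda>a b. (y_ser - x_ser) * mat_one (index_set n \<times> index_set n) a b
                        - x_ser * y_ser * P_mat n a b)"

definition R'_cleared :: "nat \<Rightarrow> int \<times> int \<Rightarrow> int \<times> int \<Rightarrow> 'a::ring_1 fps fps" where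
  "R'_cleared n = (\<lambda>a b. (x_ser + y_ser) * mat_one (index_set n \<times> index_set n) a b
                         + x_ser * y_ser * P'_mat n a b)"

definition S1_mat :: "nat \<Rightarrow> int \<times> int \<Rightarrow> int \<times> int \<Rightarrow> 'k::field free_alg fps fps" where
  "S1_mat n = kron S_u (mat_one (index_set n))"

definition S2_mat :: "nat \<Rightarrow> int \<times> int \<Rightarrow> int \<times> int \<Rightarrow> 'k::field free_alg fps fps" where
  "S2_mat n = kron (mat_one (index_set n)) S_v"

definition quaternary_lhs :: "nat \<Rightarrow> int \<times> int \<Rightarrow> int \<times> int \<Rightarrow> 'k::field free_alg fps fps" where
  "quaternary_lhs n = (let M = mat_mult (index_set n \<times> index_set n) in
     M (M (M (R_cleared n) (S1_mat n)) (R'_cleared n)) (S2_mat n))"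

definition quaternary_rhs :: "nat \<Rightarrow> int \<times> int \<Rightarrow> int \<times> int \<Rightarrow> 'k::field free_alg fps fps" where
  "quaternary_rhs n = (let M = mat_mult (index_set n \<times> index_set n) in
     M (M (M (S2_mat n) (R'_cleared n)) (S1_mat n)) (R_cleared n))"

definition quaternary_relators :: "nat \<Rightarrow> 'k::field free_alg set" where
  "quaternary_relators n =
     {fps_nth (fps_nth (quaternary_lhs n a b - quaternary_rhs n a b) q) p | a b p q.
        a \<in> index_set n \<times> index_set n \<and> b \<in> index_set n \<times> index_set n}"

text \<open>The symmetry relation, multiplied by the invertible scalar 2.\<close>

definition symmetry_relators :: "nat \<Rightarrow> 'k::field free_alg set" where
  "symmetry_relators n =
     {fps_nth (2 * mat_prime S_neg_mat i j
               - (2 * S_mat i j - fps_X * (S_mat i j - S_neg_mat i j))) r | i j r.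
        i \<in> index_set n \<and> j \<in> index_set n}"

definition Y_ideal :: "nat \<Rightarrow> 'k::field free_alg set" where
  "Y_ideal n = genideal (free_algebra n) (quaternary_relators n \<union> symmetry_relators n)"

definition Y_sp :: "nat \<Rightarrow> 'k::field free_alg set ring" where
  "Y_sp n = free_algebra n Quot Y_ideal n"

definition Y_class :: "nat \<Rightarrow> 'k::field free_alg \<Rightarrow> 'k free_alg set" where
  "Y_class n a = Y_ideal n +>\<^bsub>free_algebra n\<^esub> a"

definition s_Y :: "nat \<Rightarrow> int \<Rightarrow> int \<Rightarrow> nat \<Rightarrow> 'k::field free_alg set" where
  "s_Y n i j r = Y_class n (s_gen i j r)"


section \<open>Representations of the twisted Yangian\<close>

definition Y_module ::
  "nat \<Rightarrow> ('k::field \<Rightarrow> 'v::ab_group_add \<Rightarrow> 'v) \<Rightarrow> ('k free_alg set \<Rightarrow> 'v \<Rightarrow> 'v) \<Rightarrow> bool" where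
  "Y_module n scale \<pi> \<longleftrightarrow>
     \<pi> \<in> ring_hom (Y_sp n) (End_ring scale) \<and>
     (\<forall>c. \<pi> (Y_class n (scalar c)) = scale c)"

definition Y_simple ::
  "nat \<Rightarrow> ('k::field \<Rightarrow> 'v::ab_group_add \<Rightarrow> 'v) \<Rightarrow> ('k free_alg set \<Rightarrow> 'v \<Rightarrow> 'v) \<Rightarrow> bool" where
  "Y_simple n scale \<pi> \<longleftrightarrow> (\<exists>v::'v. v \<noteq> 0) \<and>
     (\<forall>W. module.subspace scale W \<and> (\<forall>a\<in>carrier (Y_sp n). \<forall>w\<in>W. \<pi> a w \<in> W) \<longrightarrow>
        W = {0} \<or> W = UNIV)"

definition Rep_Sp_Y ::
  "nat \<Rightarrow> ('k::field \<Rightarrow> 'v::ab_group_add \<Rightarrow> 'v) \<Rightarrow> ('k matrix \<Rightarrow> 'v \<Rightarrow> 'v) \<Rightarrow>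
   ('k free_alg set \<Rightarrow> 'v \<Rightarrow> 'v) \<Rightarrow> bool" where
  "Rep_Sp_Y n scale \<rho> \<pi> \<longleftrightarrow>
     vector_space scale \<and> (\<exists>B. finite B \<and> module.span scale B = UNIV) \<and>
     Sp_module n scale \<rho> \<and> Y_module n scale \<pi> \<and>
     (\<forall>i\<in>index_set n. \<forall>j\<in>index_set n. is_differential n scale \<rho> (F_mat i j) (\<pi> (s_Y n i j 1)))"

text \<open>\<open>\<mu> i\<close> is the series \<open>\<mu>\<^sub>i(u)\<close>, as a power series in \<open>u\<^sup>-\<^sup>1\<close>.\<close>

definition highest_weight_rep ::
  "nat \<Rightarrow> ('k::field \<Rightarrow> 'v::ab_group_add \<Rightarrow> 'v) \<Rightarrow> ('k free_alg set \<Rightarrow> 'v \<Rightarrow> 'v) \<Rightarrow>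
   (nat \<Rightarrow> 'k fps) \<Rightarrow> bool" where
  "highest_weight_rep n scale \<pi> \<mu> \<longleftrightarrow>
     (\<forall>i\<in>{1..n}. fps_nth (\<mu> i) 0 = 1) \<and>
     (\<exists>\<xi>. \<xi> \<noteq> 0 \<and>
        (\<lambda>a. \<pi> a \<xi>) ` carrier (Y_sp n) = UNIV \<and>
        (\<forall>i\<in>index_set n. \<forall>j\<in>index_set n. i < j \<longrightarrow> (\<forall>r. \<pi> (s_Y n i j r) \<xi> = 0)) \<and>
        (\<forall>i\<in>{1..n}. \<forall>r. \<pi> (s_Y n (int i) (int i) r) \<xi> = scale (fps_nth (\<mu> i) r) \<xi>))"

text \<open>The representation is the irreducible highest weight representation \<open>V(\<mu>(u))\<close>.\<close>

definition is_V_mu ::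
  "nat \<Rightarrow> ('k::field \<Rightarrow> 'v::ab_group_add \<Rightarrow> 'v) \<Rightarrow> ('k free_alg set \<Rightarrow> 'v \<Rightarrow> 'v) \<Rightarrow>
   (nat \<Rightarrow> 'k fps) \<Rightarrow> bool" where
  "is_V_mu n scale \<pi> \<mu> \<longleftrightarrow> highest_weight_rep n scale \<pi> \<mu> \<and> Y_simple n scale \<pi>"


section \<open>The relations between components of a highest weight\<close>

text \<open>The field \<open>\<bbbK>((u\<^sup>-\<^sup>1))\<close> is the field of Laurent series in \<open>x = u\<^sup>-\<^sup>1\<close>; thus \<open>u\<close> itself is the
  inverse of the variable.\<close>

definition poly_at :: "'k::field poly \<Rightarrow> 'k fls \<Rightarrow> 'k fls" where
  "poly_at P z = poly (map_poly fls_const P) z"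

definition shift_ratio :: "'k::field poly \<Rightarrow> 'k fls" where
  "shift_ratio P = poly_at P (fls_X_inv + 1) / poly_at P fls_X_inv"

definition neg_arg :: "'k::field fps \<Rightarrow> 'k fps" where
  "neg_arg \<mu> = fps_compose \<mu> (- fps_X)"

definition arrow :: "'k::field fps \<Rightarrow> 'k fps \<Rightarrow> bool" where
  "arrow \<nu> \<mu> \<longleftrightarrow> (\<exists>P. lead_coeff P = 1 \<and> fps_to_fls \<nu> / fps_to_fls \<mu> = shift_ratio P)"

text \<open>\<open>double_arrow \<mu>\<close> is the relation \<open>\<mu>(-u) \<Longrightarrow> \<mu>(u)\<close>, whose left-hand side is
  determined by \<open>\<mu>\<close>.\<close>

definition double_arrow :: "'k::field fps \<Rightarrow> bool" where
  "double_arrow \<mu> \<longleftrightarrow> (\<exists>P. lead_coeff P = 1 \<and> pcompose P [:1, - 1:] = P \<and>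
     fps_to_fls (neg_arg \<mu>) / fps_to_fls \<mu> = shift_ratio P)"

end

theory Submission
  imports Defs
begin

text \<open>
  Choose a summand whose highest weight \<open>\<lambda>\<close> has maximal height, and let \<open>\<Xi>\<close> be the space of vectors
  of Lie algebra weight \<open>\<lambda>\<close> killed by the raising operators.  The alcove condition bounds the weights of
  the summands so tightly that a singular weight vector is a highest weight vector and that congruences
  modulo \<open>p\<close> between weights become equalities; hence all \<open>s\<^sub>i\<^sub>j(u)\<close> with \<open>i < j\<close> vanish on \<open>\<Xi>\<close>, the
  \<open>s\<^sub>i\<^sub>i(u)\<close> commute there, and a common eigenvector \<open>\<xi>\<close> is a highest vector for the twisted Yangian.

  As \<open>\<lambda>\<^sub>1 = 0\<close>, also \<open>s\<^sub>1\<^sub>,\<^sub>-\<^sub>1(u)\<close> kills \<open>\<xi>\<close>; commuting it with \<open>F\<^sub>-\<^sub>1\<^sub>,\<^sub>1\<close> shows that \<open>s\<^sub>-\<^sub>1\<^sub>,\<^sub>-\<^sub>1(u)\<close> and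
  \<open>s\<^sub>1\<^sub>1(u)\<close> agree on \<open>\<xi>\<close>, so the symmetry relation makes \<open>\<mu>\<^sub>1\<close> even and \<open>P = 1\<close> works.

  On the vectors killed by all \<open>s\<^sub>-\<^sub>a\<^sub>,\<^sub>b(u)\<close>, \<open>a, b > 0\<close>, the relations of the Yangian of \<open>gl\<^sub>n\<close> hold.  For
  neighbouring indices \<open>i, i + 1\<close> the products of \<open>m\<close> coefficients of \<open>s\<^sub>i\<^sub>+\<^sub>1\<^sub>,\<^sub>i(u)\<close> applied to \<open>\<xi>\<close> span spaces
  \<open>M\<^sub>m\<close>.  With \<open>d = \<lambda>\<^sub>i - \<lambda>\<^sub>i\<^sub>+\<^sub>1\<close>, the space \<open>M\<^sub>d\<^sub>+\<^sub>1\<close> is zero and \<open>M\<^sub>d\<close> is the line on which \<open>s\<^sub>i\<^sub>+\<^sub>1\<^sub>,\<^sub>i\<^sub>+\<^sub>1(u)\<close> has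
  eigenvalue \<open>\<mu>\<^sub>i(u)\<close>.  Passing from eigencovectors on \<open>M\<^sub>m\<^sub>+\<^sub>1\<close> to eigencovectors on \<open>M\<^sub>m\<close> multiplies the
  eigenvalue by a factor \<open>(u - c - 1) / (u - c)\<close>, and on \<open>M\<^sub>0\<close> it has become \<open>\<mu>\<^sub>i\<^sub>+\<^sub>1(u)\<close>.
\<close>

section \<open>Linear algebra\<close>

text \<open>What positive characteristic p puts in the way is the gap between the Lie algebra and
  the group: a root subgroup acts through divided powers, so the span of the vectors reached from a
  singular vector by lowering operators need not be stable under the group, and simplicity of a
  summand could not be used. The bounds on the weights make every root string shorter than p, so
  that each divided power that occurs is an honest power divided by an invertible factorial.

  The chain \<open>M_m\<close> is descended with covectors because of the direction of
  \<open>B(u) = s_{i+1,i}(u)\<close>. It maps \<open>M_m\<close> to \<open>M_{m+1}\<close>, whereas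
  the known eigenvalue sits at the far end. Since the images of the coefficients of
  \<open>B(u)\<close> span \<open>M_{m+1}\<close>, a nonzero covector there stays nonzero when
  pulled back along some coefficient. The far end exchanges the two diagonal series much as a Weyl
  reflection would: \<open>B(u)\<close> kills the last vector, and the raising operator applied to
  this vanishing compares the two series.\<close>

lemma infinite_UNIV_alg_closed: "infinite (UNIV :: 'k::alg_closed_field set)"
proof
  assume fin: "finite (UNIV :: 'k set)"
  define P :: "'k poly" where "P = (\<Prod>a\<in>UNIV. [:- a, 1:]) + 1"
  have ev: "poly P x = 1" for x
  proof -
    have "poly (\<Prod>a\<in>UNIV. [:- a, 1:]) x = (\<Prod>a\<in>UNIV. x - a)"
      by (simp add: poly_prod)
    also have "\<dots> = 0" using fin by (metis UNIV_I diff_self prod_zero)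
    finally show ?thesis by (simp add: P_def)
  qed
  have "degree (\<Prod>a\<in>(UNIV :: 'k set). [:- a, 1:]) = card (UNIV :: 'k set)"
    by (subst degree_prod_eq_sum_degree) auto
  moreover have "card (UNIV :: 'k set) > 0" using fin by (simp add: card_gt_0_iff)
  ultimately have "degree P > 0" unfolding P_def by (simp add: degree_add_eq_left)
  then show False using alg_closed_imp_poly_has_root[of P] ev by auto
qed

lemma poly_eqI_infinite:
  fixes P Q :: "'k::idom poly"
  assumes "infinite A" "\<And>s. s \<in> A \<Longrightarrow> poly P s = poly Q s"
  shows "P = Q"
proof (rule ccontr)
  assume "P \<noteq> Q"
  then have "finite {s. poly (P - Q) s = 0}" by (intro poly_roots_finite) simp
  moreover have "A \<subseteq> {s. poly (P - Q) s = 0}" using assms(2) by auto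
  ultimately show False using assms(1) finite_subset by blast
qed

locale fin_vector_space = vector_space scale
  for scale :: "'k::alg_closed_field \<Rightarrow> 'v::ab_group_add \<Rightarrow> 'v" +
  assumes finite_spanning: "\<exists>B. finite B \<and> span B = UNIV"
begin

abbreviation lin :: "('v \<Rightarrow> 'v) \<Rightarrow> bool" where "lin \<equiv> Vector_Spaces.linear scale scale"
abbreviation functional :: "('v \<Rightarrow> 'k) \<Rightarrow> bool" where
  "functional \<equiv> Vector_Spaces.linear scale ((*) :: 'k \<Rightarrow> 'k \<Rightarrow> 'k)"

lemma vector_space_times: "vector_space ((*) :: 'k \<Rightarrow> 'k \<Rightarrow> 'k)"
  by unfold_locales (auto simp: algebra_simps)

lemma lin_iff: "lin T \<longleftrightarrow> (\<forall>x y. T (x + y) = T x + T y) \<and> (\<forall>c x. T (scale c x) = scale c (T x))"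
  using vector_space_axioms
  by (auto simp: Vector_Spaces.linear_def module_hom_def module_hom_axioms_def module_iff_vector_space)

lemma functional_iff:
  "functional l \<longleftrightarrow> (\<forall>x y. l (x + y) = l x + l y) \<and> (\<forall>c x. l (scale c x) = c * l x)"
  using vector_space_axioms vector_space_times
  by (auto simp: Vector_Spaces.linear_def module_hom_def module_hom_axioms_def module_iff_vector_space)

lemma lin_add: "lin T \<Longrightarrow> T (x + y) = T x + T y"
  and lin_scale: "lin T \<Longrightarrow> T (scale c x) = scale c (T x)"
  by (auto simp: lin_iff)

lemma lin_0: "lin T \<Longrightarrow> T 0 = 0"
  using lin_scale[of T 0 0] by simp

lemma lin_minus: "lin T \<Longrightarrow> T (- x) = - T x"
  using lin_scale[of T "-1" x] by simp

lemma lin_diff: "lin T \<Longrightarrow> T (x - y) = T x - T y"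
  using lin_add[of T x "- y"] lin_minus[of T y] by simp

lemma lin_sum: "lin T \<Longrightarrow> T (sum f A) = (\<Sum>a\<in>A. T (f a))"
  by (induction A rule: infinite_finite_induct) (auto simp: lin_0 lin_add)

lemma functional_add: "functional l \<Longrightarrow> l (x + y) = l x + l y"
  and functional_scale: "functional l \<Longrightarrow> l (scale c x) = c * l x"
  by (auto simp: functional_iff)

lemma functional_0: "functional l \<Longrightarrow> l 0 = 0"
  using functional_scale[of l 0 0] by simp

lemma functional_minus: "functional l \<Longrightarrow> l (- x) = - l x"
  using functional_scale[of l "-1" x] by simp

lemma functional_diff: "functional l \<Longrightarrow> l (x - y) = l x - l y"
  using functional_add[of l x "- y"] functional_minus[of l y] by simp

lemma functional_sum: "functional l \<Longrightarrow> l (sum f A) = (\<Sum>a\<in>A. l (f a))"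
  by (induction A rule: infinite_finite_induct) (auto simp: functional_0 functional_add)

lemma lin_funpow: "lin T \<Longrightarrow> lin (T ^^ k)"
  by (induction k) (auto simp: lin_iff)

text \<open>Rationality and the differential are formulated through matrix coefficients only;
  functionals that separate a vector from a subspace carry this information back to vectors.\<close>

lemma separating_functional:
  assumes U: "subspace U" and v: "v \<notin> U"
  shows "\<exists>l. functional l \<and> (\<forall>u\<in>U. l u = 0) \<and> l v = 1"
proof -
  interpret p: vector_space_pair scale "(*) :: 'k \<Rightarrow> 'k \<Rightarrow> 'k"
    by (simp add: vector_space_pair_def vector_space_axioms vector_space_times)
  obtain B where B: "B \<subseteq> U" "independent B" "U \<subseteq> span B"
    using maximal_independent_subset by blast
  have sB: "span B = U" using B U by (meson span_minimal subset_antisym)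
  have "independent (insert v B)" using B sB v by (simp add: independent_insertI)
  then obtain l where l: "functional l" "\<forall>x\<in>insert v B. l x = (if x = v then 1 else 0)"
    using p.linear_independent_extend[of "insert v B" "\<lambda>x. if x = v then 1 else 0"] by blast
  have "l u = 0" if "u \<in> span B" for u
    using that
  proof (induction rule: span_induct_alt)
    case base
    show ?case using functional_0[OF l(1)] .
  next
    case (step c x y)
    have "x \<noteq> v" using step v sB span_base by blast
    then show ?case using step l by (auto simp: functional_add functional_scale)
  qed
  then show ?thesis using l sB by (intro exI[of _ l]) auto
qed

lemma separating_functional_0:
  assumes "v \<noteq> 0"
  shows "\<exists>l. functional l \<and> l v = 1"
  using separating_functional[of "{0}" v] assms by (auto simp: subspace_single_0)

lemma vector_eqI:
  assumes "\<And>l. functional l \<Longrightarrow> l v = l w"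
  shows "v = w"
proof (rule ccontr)
  assume "v \<noteq> w"
  then obtain l where "functional l" "l (v - w) = 1" using separating_functional_0[of "v - w"] by auto
  then show False using assms[of l] by (auto simp: functional_diff)
qed

text \<open>A functional that kills \<open>U\<close> but not \<open>c k\<close> would turn the
  hypothesis into a nonzero polynomial with infinitely many zeros.\<close>

lemma coeffs_in_subspace:
  assumes U: "subspace U" and A: "infinite A"
    and mem: "\<And>s. s \<in> A \<Longrightarrow> (\<Sum>k\<le>N. scale (s ^ k) (c k)) \<in> U" and k: "k \<le> N"
  shows "c k \<in> U"
proof (rule ccontr)
  assume "c k \<notin> U"
  then obtain l where l: "functional l" "\<forall>u\<in>U. l u = 0" "l (c k) = 1"
    using separating_functional[OF U] by blast
  define P where "P = (\<Sum>j\<le>N. monom (l (c j)) j)"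
  have "poly P s = l (\<Sum>k\<le>N. scale (s ^ k) (c k))" for s
    by (simp add: P_def poly_sum poly_monom functional_sum[OF l(1)] functional_scale[OF l(1)] mult.commute)
  then have "P = 0" using mem l A by (intro poly_eqI_infinite[of A]) auto
  moreover have "coeff P k = l (c k)" using k by (simp add: P_def coeff_sum)
  ultimately show False using l by simp
qed

lemma coeffs_eqI:
  assumes A: "infinite A" and eq: "\<And>s. s \<in> A \<Longrightarrow> (\<Sum>k\<le>N. scale (s ^ k) (c k)) = (\<Sum>k\<le>N. scale (s ^ k) (d k))"
    and k: "k \<le> N"
  shows "c k = d k"
proof -
  have "c k - d k \<in> {0}"
    by (rule coeffs_in_subspace[where A = A and N = N and c = "\<lambda>k. c k - d k"])
       (use assms in \<open>auto simp: scale_right_diff_distrib sum_subtractf\<close>)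
  then show ?thesis by simp
qed

section \<open>Polynomials in an operator and eigenvectors\<close>

definition poly_op :: "('v \<Rightarrow> 'v) \<Rightarrow> 'k poly \<Rightarrow> 'v \<Rightarrow> 'v" where
  "poly_op T P v = (\<Sum>j\<le>degree P. scale (coeff P j) ((T ^^ j) v))"

lemma poly_op_bound: "degree P \<le> N \<Longrightarrow> poly_op T P v = (\<Sum>j\<le>N. scale (coeff P j) ((T ^^ j) v))"
  unfolding poly_op_def by (rule sum.mono_neutral_left) (auto simp: coeff_eq_0)

lemma poly_op_0 [simp]: "poly_op T 0 v = 0"
  by (simp add: poly_op_def)

lemma poly_op_const: "poly_op T [:c:] v = scale c v"
  by (simp add: poly_op_def)

lemma poly_op_add: "poly_op T (P + Q) v = poly_op T P v + poly_op T Q v"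
proof -
  let ?N = "max (degree P) (degree Q)"
  have "degree (P + Q) \<le> ?N" by (rule degree_add_le_max)
  then show ?thesis
    by (simp add: poly_op_bound[where N = ?N] scale_left_distrib sum.distrib)
qed

lemma poly_op_smult: "poly_op T (smult c P) v = scale c (poly_op T P v)"
proof -
  have "degree (smult c P) \<le> degree P" by (rule degree_smult_le)
  then show ?thesis by (simp add: poly_op_bound[where N = "degree P"] scale_sum_right)
qed

lemma lin_poly_op: "lin T \<Longrightarrow> lin (poly_op T P)"
  unfolding lin_iff poly_op_def
  using lin_add[OF lin_funpow, of T] lin_scale[OF lin_funpow, of T]
  by (simp add: scale_right_distrib sum.distrib scale_sum_right mult.commute lin_iff)

lemma poly_op_pCons: 
  assumes "lin T"
  shows "poly_op T (pCons c P) v = scale c v + poly_op T P (T v)"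
proof -
  have "degree (pCons c P) \<le> Suc (degree P)" by (rule degree_pCons_le)
  then show ?thesis
    by (subst poly_op_bound[where N = "Suc (degree P)"])
       (auto simp: sum.atMost_Suc_shift poly_op_def funpow_swap1 simp del: sum.atMost_Suc)
qed

lemma poly_op_comm: "lin T \<Longrightarrow> poly_op T P (T v) = T (poly_op T P v)"
  by (simp add: poly_op_def lin_sum lin_scale funpow_swap1)

lemma poly_op_mult:
  assumes "lin T"
  shows "poly_op T (P * Q) v = poly_op T P (poly_op T Q v)"
proof (induction P arbitrary: v)
  case 0
  show ?case by simp
next
  case (pCons c P)
  have "poly_op T (pCons c P * Q) v = scale c (poly_op T Q v) + poly_op T (P * Q) (T v)"
    by (simp add: poly_op_add poly_op_smult poly_op_pCons[OF assms])
  also have "\<dots> = poly_op T (pCons c P) (poly_op T Q v)"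
    by (simp add: pCons.IH poly_op_pCons[OF assms] poly_op_comm[OF assms])
  finally show ?case .
qed

lemma poly_op_in_subspace:
  assumes "subspace U" "\<And>u. u \<in> U \<Longrightarrow> T u \<in> U" "u \<in> U"
  shows "poly_op T P u \<in> U"
proof -
  have "(T ^^ j) u \<in> U" for j by (induction j) (auto simp: assms)
  then show ?thesis unfolding poly_op_def by (intro subspace_sum subspace_scale assms) auto
qed

lemma annihilating_poly_vector:
  assumes "lin T"
  shows "\<exists>P. P \<noteq> 0 \<and> poly_op T P v = 0"
proof -
  obtain B where B: "finite B" "span B = UNIV" using finite_spanning by blast
  let ?f = "\<lambda>j. (T ^^ j) v"
  let ?N = "Suc (card B)"
  show ?thesis
  proof (cases "inj_on ?f {..<?N}")
    \<comment> \<open>Repeated iterates do not make the set of iterates dependent, but then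
      \<open>X^i - X^j\<close> annihilates \<open>v\<close>.\<close>
    case False
    then obtain i j where ij: "i < j" "?f i = ?f j"
      by (metis (no_types, lifting) inj_onI linorder_neqE_nat)
    define P :: "'k poly" where "P = monom 1 i - monom 1 j"
    have "coeff P i = 1" using ij by (simp add: P_def)
    moreover have "poly_op T P v = 0"
    proof -
      have "degree P \<le> j" unfolding P_def using ij by (intro degree_diff_le) (auto simp: degree_monom_le order_trans[OF degree_monom_le])
      then have "poly_op T P v = (\<Sum>k\<le>j. scale (coeff P k) (?f k))" by (rule poly_op_bound)
      also have "\<dots> = (\<Sum>k\<in>{i,j}. scale (coeff P k) (?f k))"
        by (rule sum.mono_neutral_right) (use ij in \<open>auto simp: P_def\<close>)
      also have "\<dots> = 0" using ij by (simp add: P_def)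
      finally show ?thesis .
    qed
    ultimately show ?thesis by (intro exI[of _ P]) auto
  next
    case True
    have "dependent (?f ` {..<?N})"
    proof (rule ccontr)
      assume "independent (?f ` {..<?N})"
      then have "card (?f ` {..<?N}) \<le> card B"
        using B independent_span_bound by (metis finite_imageI finite_lessThan subset_UNIV)
      then show False using True by (simp add: card_image)
    qed
    then obtain u where u: "(\<Sum>w\<in>?f ` {..<?N}. scale (u w) w) = 0" "\<exists>w\<in>?f ` {..<?N}. u w \<noteq> 0"
      using dependent_finite[of "?f ` {..<?N}"] by auto
    define P :: "'k poly" where "P = (\<Sum>j<?N. monom (u (?f j)) j)"
    have cP: "coeff P j = (if j < ?N then u (?f j) else 0)" for j
      by (simp add: P_def coeff_sum)
    have "P \<noteq> 0" using u(2) cP by (metis (no_types, lifting) coeff_0 imageE lessThan_iff)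
    moreover have "poly_op T P v = 0"
    proof -
      have "degree P \<le> card B" by (rule degree_le) (simp add: cP)
      then have "poly_op T P v = (\<Sum>j\<le>card B. scale (coeff P j) (?f j))" by (rule poly_op_bound)
      also have "\<dots> = (\<Sum>j<?N. scale (u (?f j)) (?f j))"
        by (rule sum.cong) (auto simp: cP)
      also have "\<dots> = (\<Sum>w\<in>?f ` {..<?N}. scale (u w) w)" using True by (simp add: sum.reindex)
      finally show ?thesis using u by simp
    qed
    ultimately show ?thesis by blast
  qed
qed

lemma annihilating_poly:
  assumes "lin T"
  shows "\<exists>P. P \<noteq> 0 \<and> (\<forall>v. poly_op T P v = 0)"
proof -
  obtain B where B: "finite B" "span B = UNIV" using finite_spanning by blast
  obtain Q where Q: "\<And>v. Q v \<noteq> 0" "\<And>v. poly_op T (Q v) v = 0"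
    using annihilating_poly_vector[OF assms] by metis
  define P where "P = (\<Prod>b\<in>B. Q b)"
  have *: "poly_op T P b = 0" if "b \<in> B" for b
  proof -
    have "P = (\<Prod>b\<in>B - {b}. Q b) * Q b" using that B by (simp add: P_def prod.remove mult.commute)
    then show ?thesis using Q lin_0[OF lin_poly_op[OF assms]] by (simp add: poly_op_mult[OF assms])
  qed
  have "poly_op T P v = 0" if "v \<in> span B" for v
    using that by (induction rule: span_induct_alt)
      (auto simp: lin_add[OF lin_poly_op[OF assms]] lin_0[OF lin_poly_op[OF assms]] lin_scale[OF lin_poly_op[OF assms]] *)
  then show ?thesis using Q B by (intro exI[of _ P]) (auto simp: P_def)
qed

text \<open>A nonzero polynomial of least degree that kills \<open>l\<close> on \<open>M\<close> has
  a root, and splitting off the linear factor leaves \<open>Q\<close>. The eigencovector is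
  exhibited as \<open>l\<close> composed with a polynomial in \<open>T\<close> because the descent
  expands it in the covectors from which it is built.\<close>

lemma eigen_functional:
  assumes T: "lin T" and stab: "\<And>v. v \<in> M \<Longrightarrow> T v \<in> M" and M: "subspace M"
    and l: "functional l" and nz: "\<exists>v\<in>M. l v \<noteq> 0"
  shows "\<exists>Q a. (\<exists>v\<in>M. l (poly_op T Q v) \<noteq> 0) \<and> (\<forall>v\<in>M. l (poly_op T Q (T v)) = a * l (poly_op T Q v))"
proof -
  let ?bad = "\<lambda>P. P \<noteq> 0 \<and> (\<forall>v\<in>M. l (poly_op T P v) = 0)"
  obtain P0 where "?bad P0" using annihilating_poly[OF T] functional_0[OF l] by metis
  then obtain P where P: "?bad P" and min: "\<And>Q. ?bad Q \<Longrightarrow> degree P \<le> degree Q"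
    using ex_has_least_nat[of ?bad P0 degree] by blast
  have "degree P > 0"
  proof (rule ccontr)
    assume "\<not> degree P > 0"
    then obtain c where "P = [:c:]" by (metis degree_eq_zeroE not_gr_zero)
    then show False using P nz by (auto simp: poly_op_const functional_scale[OF l])
  qed
  then obtain a where "poly P a = 0" using alg_closed_imp_poly_has_root by blast
  then obtain Q where Q: "P = [:- a, 1:] * Q" by (metis poly_eq_0_iff_dvd dvdE)
  have Q0: "Q \<noteq> 0" using P Q by auto
  have "degree Q < degree P" unfolding Q using Q0 by (subst degree_mult_eq) auto
  then have "\<exists>v\<in>M. l (poly_op T Q v) \<noteq> 0" using min[of Q] Q0 by fastforce
  moreover have "l (poly_op T Q (T v)) = a * l (poly_op T Q v)" if "v \<in> M" for v
  proof -
    have "poly_op T P v = poly_op T Q (poly_op T [:- a, 1:] v)"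
      unfolding Q by (subst mult.commute) (rule poly_op_mult[OF T])
    also have "\<dots> = poly_op T Q (T v) - scale a (poly_op T Q v)"
      by (simp add: poly_op_pCons[OF T] poly_op_const lin_diff[OF lin_poly_op[OF T]]
          lin_scale[OF lin_poly_op[OF T]] lin_add[OF lin_poly_op[OF T]] lin_minus[OF lin_poly_op[OF T]])
    finally show ?thesis using P that by (auto simp: functional_diff[OF l] functional_scale[OF l])
  qed
  ultimately show ?thesis by blast
qed

lemma eigenvector_in_subspace:
  assumes T: "lin T" and stab: "\<And>v. v \<in> M \<Longrightarrow> T v \<in> M" and M: "subspace M" and nz: "M \<noteq> {0}"
  shows "\<exists>v\<in>M. v \<noteq> 0 \<and> (\<exists>a. T v = scale a v)"
proof -
  obtain w where w: "w \<in> M" "w \<noteq> 0" using nz subspace_0[OF M] by blast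
  let ?bad = "\<lambda>P. P \<noteq> 0 \<and> poly_op T P w = 0"
  obtain P0 where "?bad P0" using annihilating_poly_vector[OF T] by blast
  then obtain P where P: "?bad P" and min: "\<And>Q. ?bad Q \<Longrightarrow> degree P \<le> degree Q"
    using ex_has_least_nat[of ?bad P0 degree] by blast
  have "degree P > 0"
  proof (rule ccontr)
    assume "\<not> degree P > 0"
    then obtain c where "P = [:c:]" by (metis degree_eq_zeroE not_gr_zero)
    then show False using P w by (auto simp: poly_op_const)
  qed
  then obtain a where "poly P a = 0" using alg_closed_imp_poly_has_root by blast
  then obtain Q where Q: "P = [:- a, 1:] * Q" by (metis poly_eq_0_iff_dvd dvdE)
  have Q0: "Q \<noteq> 0" using P Q by auto
  have "degree Q < degree P" unfolding Q using Q0 by (subst degree_mult_eq) auto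
  then have "poly_op T Q w \<noteq> 0" using min[of Q] Q0 by fastforce
  moreover have "poly_op T P w = T (poly_op T Q w) - scale a (poly_op T Q w)"
    unfolding Q poly_op_mult[OF T] by (simp add: poly_op_pCons[OF T] poly_op_const)
  moreover have "poly_op T Q w \<in> M" using poly_op_in_subspace[OF M, of T] stab w by blast
  ultimately show ?thesis using P by (intro bexI[of _ "poly_op T Q w"]) auto
qed

text \<open>The family may be infinite, so there is no induction over its members. In an invariant
  subspace of least dimension the eigenspace of each operator is again invariant, by commutation,
  and hence the whole subspace.\<close>

lemma common_eigenvector:
  assumes lin: "\<And>T. T \<in> F \<Longrightarrow> lin T" and stab: "\<And>T v. T \<in> F \<Longrightarrow> v \<in> M \<Longrightarrow> T v \<in> M"
    and comm: "\<And>T R v. T \<in> F \<Longrightarrow> R \<in> F \<Longrightarrow> v \<in> M \<Longrightarrow> T (R v) = R (T v)"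
    and M: "subspace M" and nz: "M \<noteq> {0}"
  shows "\<exists>v\<in>M. v \<noteq> 0 \<and> (\<forall>T\<in>F. \<exists>a. T v = scale a v)"
proof -
  let ?ok = "\<lambda>U. subspace U \<and> U \<subseteq> M \<and> U \<noteq> {0} \<and> (\<forall>T\<in>F. \<forall>v\<in>U. T v \<in> U)"
  obtain B where B: "finite B" "span B = UNIV" using finite_spanning by blast
  interpret fd: finite_dimensional_vector_space scale "extend_basis {}"
  proof unfold_locales
    have "independent (extend_basis {})" by (simp add: independent_extend_basis independent_empty)
    then show "finite (extend_basis {})" using B independent_span_bound by (metis subset_UNIV)
  qed (auto simp: independent_extend_basis independent_empty span_extend_basis)
  have "?ok M" using stab M nz by blast
  then have "\<exists>U. ?ok U \<and> (\<forall>W. ?ok W \<longrightarrow> dim U \<le> dim W)" by (rule ex_has_least_nat)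
  then obtain U where U: "?ok U" and min: "\<And>W. ?ok W \<Longrightarrow> dim U \<le> dim W" by (elim exE conjE) (rule that, auto)
  have "\<exists>a. \<forall>v\<in>U. T v = scale a v" if T: "T \<in> F" for T
  proof -
    obtain u a where u: "u \<in> U" "u \<noteq> 0" "T u = scale a u"
      using eigenvector_in_subspace[of T U] lin T U by blast
    define W where "W = {v \<in> U. T v = scale a v}"
    have "subspace W" using U lin[OF T]
      by (auto simp: W_def subspace_def lin_add lin_scale lin_0 scale_right_distrib scale_left_commute)
    moreover have "W \<noteq> {0}" using u by (auto simp: W_def)
    moreover have "R v \<in> W" if "R \<in> F" "v \<in> W" for R v
    proof -
      have "T (R v) = R (T v)" using comm[of T R v] T that U by (auto simp: W_def)
      then show ?thesis using that U lin[OF that(1)] by (auto simp: W_def lin_scale)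
    qed
    ultimately have "?ok W" using U by (auto simp: W_def)
    then have "dim U \<le> dim W" by (rule min)
    moreover have "W \<subseteq> U" by (auto simp: W_def)
    ultimately have "W = U" using U \<open>subspace W\<close> by (metis fd.subspace_dim_equal)
    then show ?thesis by (auto simp: W_def)
  qed
  moreover obtain v where "v \<in> U" "v \<noteq> 0" using U subspace_0[of U] by blast
  ultimately show ?thesis using U by (metis subsetD)
qed

end

section \<open>The symplectic group\<close>

lemma index_set_iff: "i \<in> index_set n \<longleftrightarrow> i \<noteq> 0 \<and> \<bar>i\<bar> \<le> int n"
  by (auto simp: index_set_def)

lemma finite_index_set [simp]: "finite (index_set n)"
  by (simp add: index_set_def)

lemma uminus_in_index_set [simp]: "- i \<in> index_set n \<longleftrightarrow> i \<in> index_set n"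
  by (auto simp: index_set_iff)

lemma sgn_of_int_square: "i \<noteq> 0 \<Longrightarrow> of_int (sgn i) * of_int (sgn i) = (1 :: 'k::ring_1)"
  by (cases i "0 :: int" rule: linorder_cases) auto

lemma theta_eq: "theta i j = (of_int (sgn i) * of_int (sgn j) :: 'k::ring_1)"
  by (simp add: theta_def)

lemma sum_delta_uminus:
  assumes "finite I"
  shows "(\<Sum>k\<in>I. if - k = c then f k else 0) = (if - c \<in> I then f (- c :: int) else (0::'a::comm_monoid_add))"
proof -
  have "(\<Sum>k\<in>I. if - k = c then f k else 0) = (\<Sum>k\<in>I. if k = - c then f k else 0)"
    by (rule sum.cong) auto
  then show ?thesis using assms by simp
qed

text \<open>The form \<open>x^t G y\<close>, summed over the index of \<open>y\<close>. It turns
  membership in the group into conditions on pairs of columns, and left multiplication acts on each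
  column separately.\<close>

definition symp :: "nat \<Rightarrow> (int \<Rightarrow> 'k::field) \<Rightarrow> (int \<Rightarrow> 'k) \<Rightarrow> 'k" where
  "symp n x y = (\<Sum>k\<in>index_set n. of_int (sgn (- k)) * x (- k) * y k)"

lemma symp_add_left: "symp n (\<lambda>i. x i + x' i) y = symp n x y + symp n x' y"
  and symp_add_right: "symp n x (\<lambda>i. y i + y' i) = symp n x y + symp n x y'"
  and symp_scale_left: "symp n (\<lambda>i. c * x i) y = c * symp n x y"
  and symp_scale_right: "symp n x (\<lambda>i. c * y i) = c * symp n x y"
  unfolding symp_def sum.distrib[symmetric] sum_distrib_left
  by (rule sum.cong; simp add: algebra_simps)+

lemma symp_unit_left: "c \<in> index_set n \<Longrightarrow> symp n (\<lambda>i. if i = c then 1 else 0) y = of_int (sgn c) * y (- c)"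
proof -
  assume c: "c \<in> index_set n"
  have "symp n (\<lambda>i. if i = c then 1 else 0) y = (\<Sum>k\<in>index_set n. if - k = c then of_int (sgn (- k)) * y k else 0)"
    unfolding symp_def by (rule sum.cong) auto
  then show ?thesis using c by (simp add: sum_delta_uminus)
qed

lemma symp_unit_right: "c \<in> index_set n \<Longrightarrow> symp n x (\<lambda>i. if i = c then 1 else 0) = - of_int (sgn c) * x (- c)"
proof -
  assume c: "c \<in> index_set n"
  have "symp n x (\<lambda>i. if i = c then 1 else 0) = (\<Sum>k\<in>index_set n. if k = c then of_int (sgn (- k)) * x (- k) else 0)"
    unfolding symp_def by (rule sum.cong) auto
  then show ?thesis using c by simp
qed

lemma carrier_Sp_iff:
  "g \<in> carrier (Sp n) \<longleftrightarrow> (\<forall>i j. i \<notin> index_set n \<or> j \<notin> index_set n \<longrightarrow> g i j = 0) \<and>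
     (\<forall>i\<in>index_set n. \<forall>j\<in>index_set n. symp n (\<lambda>k. g k i) (\<lambda>k. g k j) = form_G n i j)"
proof -
  let ?I = "index_set n"
  let ?M = "mat_mult ?I (mat_mult ?I (mat_transpose g) (form_G n)) g"
  have M: "?M i j = symp n (\<lambda>k. g k i) (\<lambda>k. g k j)" for i j
  proof -
    have "mat_mult ?I (mat_transpose g) (form_G n) i k = g (- k) i * of_int (sgn (- k))"
      if "k \<in> ?I" for k
    proof -
      have "mat_mult ?I (mat_transpose g) (form_G n) i k =
        (\<Sum>l\<in>?I. if l = - k then g l i * of_int (sgn l) else 0)"
        unfolding mat_mult_def mat_transpose_def form_G_def by (rule sum.cong) auto
      then show ?thesis using that by simp
    qed
    then show ?thesis
      unfolding mat_mult_def[of ?I "mat_mult ?I (mat_transpose g) (form_G n)"] symp_def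
      by (intro sum.cong) auto
  qed
  have "?M i j = 0 \<and> form_G n i j = 0" if "i \<notin> ?I \<or> j \<notin> ?I"
    "\<forall>i j. i \<notin> ?I \<or> j \<notin> ?I \<longrightarrow> g i j = 0" for i j
    by (subst M) (use that in \<open>auto simp: symp_def form_G_def\<close>)
  then have "?M = form_G n \<longleftrightarrow> (\<forall>i\<in>?I. \<forall>j\<in>?I. ?M i j = form_G n i j)"
    if "\<forall>i j. i \<notin> ?I \<or> j \<notin> ?I \<longrightarrow> g i j = 0"
    using that by (fastforce simp: fun_eq_iff)
  then show ?thesis unfolding Sp_def M[symmetric] by auto
qed

lemma one_Sp [simp]: "\<one>\<^bsub>Sp n\<^esub> = mat_one (index_set n)"
  and mult_Sp [simp]: "g \<otimes>\<^bsub>Sp n\<^esub> h = mat_mult (index_set n) g h"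
  by (simp_all add: Sp_def)

lemma one_in_Sp: "mat_one (index_set n) \<in> carrier (Sp n)"
proof -
  have "symp n (\<lambda>k. mat_one (index_set n) k i) (\<lambda>k. mat_one (index_set n) k j) = (form_G n i j :: 'k::field)"
    if "i \<in> index_set n" "j \<in> index_set n" for i j
  proof -
    have *: "(\<lambda>k. mat_one (index_set n) k i) = (\<lambda>k. if k = i then 1 else (0::'k))" if "i \<in> index_set n" for i
      using that by (auto simp: mat_one_def fun_eq_iff)
    show ?thesis unfolding *[OF that(1)] symp_unit_left[OF that(1)]
      using that by (auto simp: mat_one_def form_G_def)
  qed
  then show ?thesis by (auto simp: carrier_Sp_iff mat_one_def)
qed

lemma mat_mult_one_left: "g \<in> carrier (Sp n) \<Longrightarrow> mat_mult (index_set n) (mat_one (index_set n)) g = g"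
proof (intro ext)
  fix i j assume g: "g \<in> carrier (Sp n)"
  show "mat_mult (index_set n) (mat_one (index_set n)) g i j = g i j"
    using g by (cases "i \<in> index_set n")
      (auto simp: mat_mult_def mat_one_def carrier_Sp_iff if_distrib[of "\<lambda>x. x * _"] cong: if_cong)
qed

text \<open>For \<open>a \<noteq> b\<close> the matrix \<open>F_mat a b\<close> squares to zero, so
  this is its exponential and is additive in \<open>s\<close>. For \<open>b = - a\<close> it equals
  \<open>1 + 2 s E_{a,-a}\<close>; this 2 is why the characteristic matters in the elimination
  below.\<close>

definition root_elem :: "nat \<Rightarrow> int \<Rightarrow> int \<Rightarrow> 'k::field \<Rightarrow> 'k matrix" where
  "root_elem n a b s = (\<lambda>i j. mat_one (index_set n) i j + s * F_mat a b i j)"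

lemma root_elem_0: "root_elem n a b 0 = mat_one (index_set n)"
  by (simp add: root_elem_def)

lemma F_mat_outside:
  assumes "a \<in> index_set n" "b \<in> index_set n" "i \<notin> index_set n \<or> j \<notin> index_set n"
  shows "F_mat a b i j = 0"
proof -
  have A: "(i = a \<and> j = b) = False" using assms by blast
  have B: "(i = - b \<and> j = - a) = False" using assms uminus_in_index_set by metis
  show ?thesis unfolding F_mat_def mat_unit_def A B by simp
qed

lemma F_mat_mult:
  assumes "a \<in> index_set n" "b \<in> index_set n"
  shows "(\<Sum>k\<in>index_set n. F_mat a b i k * y k) =
    (if i = a then y b else 0) - theta a b * (if i = - b then y (- a) else (0::'k::field))"
proof -
  have "(\<Sum>k\<in>index_set n. F_mat a b i k * y k) =
    (\<Sum>k\<in>index_set n. if k = b then (if i = a then y k else 0) else 0) -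
    (\<Sum>k\<in>index_set n. if k = - a then theta a b * (if i = - b then y k else 0) else 0)"
    unfolding sum_subtractf[symmetric]
    by (rule sum.cong) (auto simp: F_mat_def mat_unit_def algebra_simps)
  then show ?thesis using assms by simp
qed

lemma root_elem_mult:
  assumes "a \<in> index_set n" "b \<in> index_set n" "i \<in> index_set n"
  shows "mat_mult (index_set n) (root_elem n a b s) g i j =
    g i j + s * ((if i = a then g b j else 0) - theta a b * (if i = - b then g (- a) j else 0))"
proof -
  have "mat_mult (index_set n) (root_elem n a b s) g i j =
     (\<Sum>k\<in>index_set n. (if i = k then g k j else 0)) + s * (\<Sum>k\<in>index_set n. F_mat a b i k * g k j)"
    unfolding mat_mult_def root_elem_def sum_distrib_left sum.distrib[symmetric]
    by (rule sum.cong) (auto simp: mat_one_def algebra_simps assms)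
  then show ?thesis using assms by (simp add: F_mat_mult)
qed

lemma root_elem_mult_outside:
  assumes "a \<in> index_set n" "b \<in> index_set n" "i \<notin> index_set n \<or> j \<notin> index_set n"
    "\<And>i j. i \<notin> index_set n \<or> j \<notin> index_set n \<Longrightarrow> g i j = 0"
  shows "mat_mult (index_set n) (root_elem n a b s) g i j = 0"
  unfolding mat_mult_def root_elem_def
  by (rule sum.neutral) (use assms in \<open>auto simp: mat_one_def F_mat_def mat_unit_def\<close>)

lemma root_elem_mult_one:
  assumes "a \<in> index_set n" "b \<in> index_set n"
  shows "mat_mult (index_set n) (root_elem n a b s) (mat_one (index_set n)) = root_elem n a b s"
proof (intro ext)
  fix i j
  have "mat_mult (index_set n) (root_elem n a b s) (mat_one (index_set n)) i j =
    (\<Sum>k\<in>index_set n. if k = j then root_elem n a b s i k else 0)"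
    unfolding mat_mult_def by (rule sum.cong) (auto simp: mat_one_def)
  also have "\<dots> = root_elem n a b s i j"
    using F_mat_outside[OF assms, of i j] by (auto simp: root_elem_def mat_one_def)
  finally show "mat_mult (index_set n) (root_elem n a b s) (mat_one (index_set n)) i j = root_elem n a b s i j" .
qed

text \<open>Left multiplication applies one and the same map \<open>?X\<close> to every column, so
  it suffices that \<open>?X\<close> preserves \<open>symp\<close>.\<close>

lemma root_elem_mult_in_Sp:
  assumes ab: "a \<in> index_set n" "b \<in> index_set n" "a \<noteq> b" and g: "g \<in> carrier (Sp n)"
  shows "mat_mult (index_set n) (root_elem n a b s) g \<in> carrier (Sp n)"
proof -
  let ?X = "\<lambda>(x :: int \<Rightarrow> 'a) i. x i + s * (x b * (if i = a then 1 else 0) + (- theta a b * x (- a)) * (if i = - b then 1 else 0))"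
  have pres: "symp n (?X x) (?X y) = symp n x y" for x y :: "int \<Rightarrow> 'a"
  proof -
    have sg: "of_int (sgn a) * of_int (sgn a) = (1::'a)" "of_int (sgn b) * of_int (sgn b) = (1::'a)"
      using ab by (auto intro!: sgn_of_int_square simp: index_set_iff)
    have nb: "- b \<in> index_set n" using ab by simp
    have nz: "a \<noteq> - a" "b \<noteq> - b" "- b \<noteq> b" "- a \<noteq> a" "a \<noteq> 0" "b \<noteq> 0" using ab by (auto simp: index_set_iff)
    have cancel: "s * (- (y1 * (c * x1)) - c * d * y2 * (d * x2)) + s * (x2 * (c * y2) + c * d * x1 * (d * y1)) = 0"
      if "d * d = 1" for c d x1 x2 y1 y2 :: 'a
    proof -
      have "s * (- (y1 * (c * x1)) - c * d * y2 * (d * x2)) + s * (x2 * (c * y2) + c * d * x1 * (d * y1))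
        = (d * d - 1) * (c * s * (x1 * y1 - x2 * y2))" by (simp add: algebra_simps)
      then show ?thesis using that by simp
    qed
    show ?thesis
      unfolding symp_add_left symp_add_right symp_scale_left symp_scale_right symp_unit_left[OF ab(1)]
        symp_unit_right[OF ab(1)] symp_unit_left[OF nb] symp_unit_right[OF nb] theta_eq
      using ab(3) nz cancel[OF sg(2)] by simp
  qed
  have col: "symp n (\<lambda>k. mat_mult (index_set n) (root_elem n a b s) g k i) (\<lambda>k. mat_mult (index_set n) (root_elem n a b s) g k j)
     = symp n (?X (\<lambda>k. g k i)) (?X (\<lambda>k. g k j))" for i j
    unfolding symp_def by (rule sum.cong) (auto simp: root_elem_mult[OF ab(1,2)])
  have col': "symp n (\<lambda>k. mat_mult (index_set n) (root_elem n a b s) g k i) (\<lambda>k. mat_mult (index_set n) (root_elem n a b s) g k j)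
     = symp n (\<lambda>k. g k i) (\<lambda>k. g k j)" for i j
    using col[of i j] pres[of "\<lambda>k. g k i" "\<lambda>k. g k j"] by (rule trans)
  show ?thesis
    using g unfolding carrier_Sp_iff col' by (auto intro!: root_elem_mult_outside[OF ab(1,2)])
qed

lemma root_elem_in_Sp:
  assumes "a \<in> index_set n" "b \<in> index_set n" "a \<noteq> b"
  shows "root_elem n a b s \<in> carrier (Sp n)"
proof -
  show ?thesis using root_elem_mult_in_Sp[OF assms one_in_Sp, of s] assms by (simp add: root_elem_mult_one)
qed

lemma root_elem_add_mult:
  assumes ab: "a \<in> index_set n" "b \<in> index_set n" "a \<noteq> b" 
    and supp: "\<And>i j. i \<notin> index_set n \<or> j \<notin> index_set n \<Longrightarrow> g i j = 0"
  shows "mat_mult (index_set n) (root_elem n a b s) (mat_mult (index_set n) (root_elem n a b t) g) =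
    mat_mult (index_set n) (root_elem n a b (s + t)) g"
proof (intro ext)
  fix i j
  have nz: "a \<noteq> 0" "b \<noteq> 0" using ab by (auto simp: index_set_iff)
  show "mat_mult (index_set n) (root_elem n a b s) (mat_mult (index_set n) (root_elem n a b t) g) i j =
    mat_mult (index_set n) (root_elem n a b (s + t)) g i j"
  proof (cases "i \<in> index_set n")
    case True
    then show ?thesis using ab nz
      by (auto simp: root_elem_mult root_elem_mult[of _ _ _ "- _"] algebra_simps)
  next
    case False
    let ?h = "mat_mult (index_set n) (root_elem n a b t) g"
    have out: "?h i j = 0" if "i \<notin> index_set n \<or> j \<notin> index_set n" for i j
      using that ab supp by (intro root_elem_mult_outside) auto
    show ?thesis
      using False root_elem_mult_outside[OF ab(1,2), of i j ?h s] root_elem_mult_outside[OF ab(1,2), of i j g "s + t"] out supp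
      by auto
  qed
qed

lemma root_elem_add:
  assumes ab: "a \<in> index_set n" "b \<in> index_set n" "a \<noteq> b" 
  shows "mat_mult (index_set n) (root_elem n a b s) (root_elem n a b t) = root_elem n a b (s + t)"
proof -
  have "mat_one (index_set n) i j = (0::'a)" if "i \<notin> index_set n \<or> j \<notin> index_set n" for i j
    using that by (auto simp: mat_one_def)
  from root_elem_add_mult[OF ab, of "mat_one (index_set n)" s t, OF this] ab
  show ?thesis by (simp add: root_elem_mult_one)
qed

subsection \<open>The torus and the monomial elements\<close>

definition torus_entry :: "(nat \<Rightarrow> 'k::field) \<Rightarrow> int \<Rightarrow> 'k" where
  "torus_entry t i = (if i > 0 then t (nat i) else inverse (t (nat (- i))))"

lemma torus_elem_eq: "torus_elem n t = (\<lambda>i j. if i \<in> index_set n \<and> i = j then torus_entry t i else 0)"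
  by (auto simp: torus_elem_def torus_entry_def fun_eq_iff)

text \<open>Sends basis vector \<open>j\<close> to \<open>c j\<close> times basis vector
  \<open>\<sigma> j\<close>: a torus element if \<open>\<sigma>\<close> is the identity, a
  representative of a Weyl group element if \<open>\<sigma>\<close> is a signed permutation.\<close>

definition monomial_mat :: "nat \<Rightarrow> (int \<Rightarrow> int) \<Rightarrow> (int \<Rightarrow> 'k::field) \<Rightarrow> 'k matrix" where
  "monomial_mat n \<sigma> c = (\<lambda>i j. if j \<in> index_set n \<and> i = \<sigma> j then c j else 0)"

lemma monomial_in_Sp:
  assumes \<sigma>: "\<And>i. i \<in> index_set n \<Longrightarrow> \<sigma> i \<in> index_set n" "inj_on \<sigma> (index_set n)"
    "\<And>i. i \<in> index_set n \<Longrightarrow> \<sigma> (- i) = - \<sigma> i"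
    and c: "\<And>i. i \<in> index_set n \<Longrightarrow> c i * c (- i) * of_int (sgn (\<sigma> i)) = (of_int (sgn i) :: 'k::field)"
  shows "monomial_mat n \<sigma> c \<in> carrier (Sp n)"
proof -
  have "symp n (\<lambda>k. monomial_mat n \<sigma> c k i) (\<lambda>k. monomial_mat n \<sigma> c k j) = form_G n i j"
    if ij: "i \<in> index_set n" "j \<in> index_set n" for i j
  proof -
    have *: "(\<lambda>k. monomial_mat n \<sigma> c k i) = (\<lambda>k. c i * (if k = \<sigma> i then 1 else 0))" if "i \<in> index_set n" for i
      using that by (auto simp: monomial_mat_def)
    have "symp n (\<lambda>k. monomial_mat n \<sigma> c k i) (\<lambda>k. monomial_mat n \<sigma> c k j)
      = c i * (c j * (of_int (sgn (\<sigma> i)) * (if - \<sigma> i = \<sigma> j then 1 else 0)))"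
      unfolding *[OF ij(1)] *[OF ij(2)] symp_scale_left symp_scale_right
      by (simp add: symp_unit_left[OF \<sigma>(1)[OF ij(1)]])
    moreover have "- \<sigma> i = \<sigma> j \<longleftrightarrow> i = - j"
      using \<sigma>(3)[OF ij(1)] inj_onD[OF \<sigma>(2), of "- i" j] ij by auto
    ultimately show ?thesis using c[OF ij(1)] ij by (auto simp: form_G_def mult.assoc)
  qed
  moreover have "monomial_mat n \<sigma> c i j = 0" if "i \<notin> index_set n \<or> j \<notin> index_set n" for i j
    using that \<sigma>(1) by (auto simp: monomial_mat_def)
  ultimately show ?thesis by (auto simp: carrier_Sp_iff)
qed

lemma torus_entry_uminus: "i \<in> index_set n \<Longrightarrow> torus_entry t (- i) = inverse (torus_entry t i)"
  by (auto simp: torus_entry_def index_set_iff)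

lemma torus_entry_nonzero:
  assumes "\<And>i. i \<in> {1..n} \<Longrightarrow> t i \<noteq> 0" and "i \<in> index_set n"
  shows "torus_entry t i \<noteq> 0"
  using assms(1)[of "nat i"] assms(1)[of "nat (- i)"] assms(2)
  by (auto simp: torus_entry_def index_set_iff nat_le_iff Suc_le_eq)

lemma torus_in_Sp:
  assumes "\<And>i. i \<in> {1..n} \<Longrightarrow> t i \<noteq> (0::'k::field)"
  shows "torus_elem n t \<in> carrier (Sp n)"
proof -
  have "torus_elem n t = monomial_mat n (\<lambda>i. i) (torus_entry t)"
    by (auto simp: torus_elem_eq monomial_mat_def fun_eq_iff)
  moreover have "\<dots> \<in> carrier (Sp n)"
    by (rule monomial_in_Sp) (use torus_entry_nonzero[of n t] assms in \<open>auto simp: torus_entry_uminus\<close>)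
  ultimately show ?thesis by simp
qed

lemma torus_mult_left:
  "i \<in> index_set n \<Longrightarrow> mat_mult (index_set n) (torus_elem n t) g i j = torus_entry t i * g i j"
  "i \<notin> index_set n \<Longrightarrow> mat_mult (index_set n) (torus_elem n t) g i j = 0"
  by (auto simp: mat_mult_def torus_elem_eq if_distrib[of "\<lambda>x. x * _"] cong: if_cong)

lemma torus_mult_right:
  "j \<in> index_set n \<Longrightarrow> mat_mult (index_set n) g (torus_elem n t) i j = g i j * torus_entry t j"
  "j \<notin> index_set n \<Longrightarrow> mat_mult (index_set n) g (torus_elem n t) i j = 0"
proof -
  have "mat_mult (index_set n) g (torus_elem n t) i j = (\<Sum>k\<in>index_set n. if k = j then g i k * torus_entry t k else 0)"
    unfolding mat_mult_def torus_elem_eq by (rule sum.cong) auto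
  then show "j \<in> index_set n \<Longrightarrow> mat_mult (index_set n) g (torus_elem n t) i j = g i j * torus_entry t j"
    "j \<notin> index_set n \<Longrightarrow> mat_mult (index_set n) g (torus_elem n t) i j = 0" by simp_all
qed

lemma torus_mult:
  "mat_mult (index_set n) (torus_elem n t) (torus_elem n t') = torus_elem n (\<lambda>i. t i * t' i)"
proof (intro ext)
  fix i j show "mat_mult (index_set n) (torus_elem n t) (torus_elem n t') i j = torus_elem n (\<lambda>i. t i * t' i) i j"
    by (cases "i \<in> index_set n") (simp_all add: torus_mult_left, simp_all add: torus_elem_eq torus_entry_def)
qed

lemma torus_root_elem:
  assumes t: "\<And>i. i \<in> {1..n} \<Longrightarrow> t i \<noteq> (0::'k::field)" and ab: "a \<in> index_set n" "b \<in> index_set n"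
  shows "mat_mult (index_set n) (torus_elem n t) (root_elem n a b s) =
    mat_mult (index_set n) (root_elem n a b (torus_entry t a / torus_entry t b * s)) (torus_elem n t)"
proof (intro ext)
  fix i j
  have out: "root_elem n a b s i j = 0" if "i \<notin> index_set n \<or> j \<notin> index_set n" for i j and s :: 'k
    using that F_mat_outside[OF ab, of i j] by (auto simp: root_elem_def mat_one_def)
  have nz: "torus_entry t a \<noteq> 0" "torus_entry t b \<noteq> 0" using torus_entry_nonzero[OF t] ab by auto
  show "mat_mult (index_set n) (torus_elem n t) (root_elem n a b s) i j =
    mat_mult (index_set n) (root_elem n a b (torus_entry t a / torus_entry t b * s)) (torus_elem n t) i j"
  proof (cases "i \<in> index_set n \<and> j \<in> index_set n")
    case True
    have F: "torus_entry t i * F_mat a b i j = torus_entry t a / torus_entry t b * F_mat a b i j * torus_entry t j"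
      using nz ab by (simp add: F_mat_def mat_unit_def torus_entry_uminus field_simps)
    have one: "torus_entry t i * mat_one (index_set n) i j = mat_one (index_set n) i j * torus_entry t j"
      by (simp add: mat_one_def)
    have "torus_entry t i * root_elem n a b s i j =
      torus_entry t i * mat_one (index_set n) i j + s * (torus_entry t i * F_mat a b i j)"
      by (simp add: root_elem_def algebra_simps)
    also have "\<dots> = root_elem n a b (torus_entry t a / torus_entry t b * s) i j * torus_entry t j"
      unfolding F one by (simp add: root_elem_def algebra_simps)
    finally show ?thesis using True by (simp add: torus_mult_left torus_mult_right)
  next
    case False
    then show ?thesis by (cases "i \<in> index_set n"; cases "j \<in> index_set n") (auto simp: torus_mult_left torus_mult_right out)
  qed
qed

lemma torus_monomial:
  assumes "\<And>i. i \<in> index_set n \<Longrightarrow> \<sigma> i \<in> index_set n"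
    and "\<And>i. i \<in> index_set n \<Longrightarrow> torus_entry t (\<sigma> i) = torus_entry t' i"
  shows "mat_mult (index_set n) (torus_elem n t) (monomial_mat n \<sigma> c) =
    mat_mult (index_set n) (monomial_mat n \<sigma> c) (torus_elem n t')"
proof (intro ext)
  fix i j
  show "mat_mult (index_set n) (torus_elem n t) (monomial_mat n \<sigma> c) i j =
    mat_mult (index_set n) (monomial_mat n \<sigma> c) (torus_elem n t') i j"
    using assms by (cases "i \<in> index_set n"; cases "j \<in> index_set n")
      (auto simp: torus_mult_left torus_mult_right monomial_mat_def)
qed

subsection \<open>Generation by root elements\<close>

lemma Sp_column_symp:
  "g \<in> carrier (Sp n) \<Longrightarrow> i \<in> index_set n \<Longrightarrow> j \<in> index_set n \<Longrightarrow>
    symp n (\<lambda>k. g k i) (\<lambda>k. g k j) = (if i = - j then of_int (sgn i) else 0)"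
  by (auto simp: carrier_Sp_iff form_G_def)

definition unit_col :: "'k::zero_neq_one matrix \<Rightarrow> int \<Rightarrow> bool" where
  "unit_col g j \<longleftrightarrow> (\<forall>i. g i j = (if i = j then 1 else 0))"

text \<open>Pairing column \<open>j\<close> with the unit column \<open>i\<close> reads off row
  \<open>- i\<close>. Finished columns thus force zeros in the columns still to be treated.\<close>

lemma Sp_unit_col_entry:
  assumes g: "g \<in> carrier (Sp n)" and i: "i \<in> index_set n" "unit_col g i" and j: "j \<in> index_set n"
  shows "g (- i) j = (if i = - j then 1 else (0::'k::field))"
proof -
  have "symp n (\<lambda>k. g k i) (\<lambda>k. g k j) = of_int (sgn i) * g (- i) j"
    using symp_unit_left[OF i(1), of "\<lambda>k. g k j"] i(2) by (simp add: unit_col_def)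
  with Sp_column_symp[OF g i(1) j] have "of_int (sgn i) * g (- i) j = (if i = - j then of_int (sgn i) else 0)" by simp
  then have "of_int (sgn i) * of_int (sgn i) * g (- i) j = of_int (sgn i) * (if i = - j then of_int (sgn i) else 0)"
    by (simp add: mult.assoc)
  then show ?thesis using i sgn_of_int_square[of i, where 'k = 'k] by (auto simp: index_set_iff split: if_splits)
qed

lemma unit_col_root_elem_mult:
  assumes g: "g \<in> carrier (Sp n)" and ab: "a \<in> index_set n" "b \<in> index_set n"
    and c: "unit_col g c" "c \<noteq> b" "c \<noteq> - a"
  shows "unit_col (mat_mult (index_set n) (root_elem n a b s) g) c"
  unfolding unit_col_def
proof
  fix i
  show "mat_mult (index_set n) (root_elem n a b s) g i c = (if i = c then 1 else 0)"
  proof (cases "i \<in> index_set n")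
    case True
    then show ?thesis using c ab by (auto simp: root_elem_mult unit_col_def)
  next
    case False
    have "mat_mult (index_set n) (root_elem n a b s) g i c = 0"
      by (rule root_elem_mult_outside) (use ab g False in \<open>auto simp: carrier_Sp_iff\<close>)
    moreover have "i \<noteq> c"
    proof
      assume "i = c"
      then have "g c c = 0" using False g by (auto simp: carrier_Sp_iff)
      then show False using c by (simp add: unit_col_def)
    qed
    ultimately show ?thesis by simp
  qed
qed

text \<open>Symplectic Gaussian elimination: for \<open>K = n, ..., 1\<close> the columns
  \<open>K\<close> and \<open>- K\<close> become unit columns under left multiplication by root
  elements. The inverse of a root element is a root element, so \<open>P\<close> passes back from
  the reduced matrix.\<close>

lemma Sp_root_elem_induct [consumes 2, case_names one root]:
  fixes g :: "'k::field matrix"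
  assumes two: "(2::'k) \<noteq> 0" and g: "g \<in> carrier (Sp n)"
    and one: "P (mat_one (index_set n))"
    and root: "\<And>a b s h. a \<in> index_set n \<Longrightarrow> b \<in> index_set n \<Longrightarrow> a \<noteq> b \<Longrightarrow> h \<in> carrier (Sp n) \<Longrightarrow> P h \<Longrightarrow>
      P (mat_mult (index_set n) (root_elem n a b s) h)"
  shows "P g"
proof -
  let ?I = "index_set n"
  let ?R = "\<lambda>a b s g. mat_mult ?I (root_elem n a b s) (g :: 'k matrix)"
  have undo: "P g" if ab: "a \<in> ?I" "b \<in> ?I" "a \<noteq> b" and g: "g \<in> carrier (Sp n)" and "P (?R a b s g)" for a b s g
  proof -
    have "?R a b (- s) (?R a b s g) = ?R a b (- s + s) g"
      by (rule root_elem_add_mult) (use ab g in \<open>auto simp: carrier_Sp_iff\<close>)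
    then have "?R a b (- s) (?R a b s g) = g" using mat_mult_one_left[OF g] by (simp add: root_elem_0)
    then show ?thesis using root[OF ab root_elem_mult_in_Sp[OF ab g] that(5), of "- s"] by simp
  qed
  have "P g" if "g \<in> carrier (Sp n)" "k \<le> n" "\<forall>i\<in>?I. \<bar>i\<bar> > int k \<longrightarrow> unit_col g i" for k g
    using that
  proof (induction k arbitrary: g)
    case 0
    have "g = mat_one ?I"
    proof (intro ext)
      fix i j show "g i j = mat_one ?I i j"
      proof (cases "j \<in> ?I")
        case True
        then have "unit_col g j" using 0 by (auto simp: index_set_iff)
        then show ?thesis using True by (auto simp: unit_col_def mat_one_def)
      next
        case False
        then show ?thesis using 0 by (auto simp: mat_one_def carrier_Sp_iff)
      qed
    qed
    then show ?case using one by simp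
  next
    case (Suc k)
    define K where "K = int (Suc k)"
    have K: "K \<in> ?I" "- K \<in> ?I" "K \<noteq> - K" "K \<noteq> 0" "- K \<noteq> K" "K > 0" using Suc.prems by (auto simp: K_def index_set_iff)
    define fix' where "fix' g \<longleftrightarrow> g \<in> carrier (Sp n) \<and> (\<forall>i\<in>?I. \<bar>i\<bar> > K \<longrightarrow> unit_col g i)" for g :: "'k matrix"
    have fixR: "fix' (?R a b s g)" if "fix' g" "a \<in> ?I" "b \<in> ?I" "a \<noteq> b" "\<bar>a\<bar> \<le> K" "\<bar>b\<bar> \<le> K" for a b s g
      unfolding fix'_def
    proof (intro conjI ballI impI)
      show "?R a b s g \<in> carrier (Sp n)" using that root_elem_mult_in_Sp unfolding fix'_def by blast
      fix i assume "i \<in> ?I" "\<bar>i\<bar> > K"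
      then show "unit_col (?R a b s g) i" using that unfolding fix'_def by (intro unit_col_root_elem_mult) auto
    qed
    have supp: "g i j = 0" if "fix' g" "\<bar>i\<bar> > K" "\<bar>j\<bar> \<le> K" for g i j
    proof (cases "i \<in> ?I \<and> j \<in> ?I")
      case True
      then have "unit_col g (- i)" using that unfolding fix'_def by auto
      then show ?thesis using Sp_unit_col_entry[of g n "- i" j] that True unfolding fix'_def by auto
    next
      case False
      then show ?thesis using that unfolding fix'_def carrier_Sp_iff by blast
    qed
    have entry: "?R a b s g i j = g i j + s * ((if i = a then g b j else 0) - theta a b * (if i = - b then g (- a) j else 0))"
      if "a \<in> ?I" "b \<in> ?I" "fix' g" for a b s g i j
    proof (cases "i \<in> ?I")
      case True then show ?thesis using that by (simp add: root_elem_mult)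
    next
      case False
      then have "i \<noteq> a" "i \<noteq> - b" using that by auto
      moreover have "?R a b s g i j = 0"
        by (rule root_elem_mult_outside) (use that False in \<open>auto simp: fix'_def carrier_Sp_iff\<close>)
      moreover have "g i j = 0" using that False by (auto simp: fix'_def carrier_Sp_iff)
      ultimately show ?thesis by simp
    qed
    have C: "P g" if "fix' g" "unit_col g K" "unit_col g (- K)" for g
    proof (rule Suc.IH)
      show "\<forall>i\<in>?I. \<bar>i\<bar> > int k \<longrightarrow> unit_col g i"
      proof (intro ballI impI)
        fix i assume i: "i \<in> ?I" "\<bar>i\<bar> > int k"
        then consider "\<bar>i\<bar> > K" | "i = K" | "i = - K" unfolding K_def by linarith
        then show "unit_col g i" using that i by cases (auto simp: fix'_def)
      qed
    qed (use that Suc.prems in \<open>auto simp: fix'_def\<close>)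
    define mid where "mid = {i \<in> ?I. \<bar>i\<bar> < K}"
    have mid: "finite mid" "\<And>i. i \<in> mid \<Longrightarrow> i \<in> ?I \<and> i \<noteq> K \<and> i \<noteq> - K \<and> - i \<noteq> K \<and> i \<noteq> - i \<and> \<bar>i\<bar> \<le> K"
      unfolding mid_def by simp (auto simp: index_set_iff)
    have out: "\<bar>i\<bar> > K" if "i \<notin> mid" "i \<noteq> K" "i \<noteq> - K" "i \<in> ?I" for i
      using that by (auto simp: mid_def)
    have zero_out: "g i j = 0" if "fix' g" "i \<notin> mid" "i \<noteq> K" "i \<noteq> - K" "\<bar>j\<bar> \<le> K" for g i j
    proof (cases "i \<in> ?I")
      case True then show ?thesis using supp out that by blast
    next
      case False then show ?thesis using that by (auto simp: fix'_def carrier_Sp_iff)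
    qed
    have th: "theta K (- K) = (- 1 :: 'k)" "theta (- K) K = (- 1 :: 'k)" using K(6) by (auto simp: theta_eq)
    \<comment> \<open>With pivot 1 in place, the entries strictly between \<open>- K\<close> and
      \<open>K\<close> are removed one by one. Each such operation also changes row
      \<open>- c\<close>, whose entry is therefore left to \<open>finish\<close>.\<close>
    have clear: "P g" if "fix' g" "unit_col g K \<or> c = K" "c = K \<or> c = - K" "g c c = 1"
      and fin: "\<And>h. fix' h \<Longrightarrow> (unit_col h K \<or> c = K) \<Longrightarrow> (\<forall>i. i \<noteq> - c \<longrightarrow> h i c = (if i = c then 1 else 0)) \<Longrightarrow> P h" for g c
      using that(1-4)
    proof (induction "card {i\<in>mid. g i c \<noteq> 0}" arbitrary: g rule: less_induct)
      case less
      show ?case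
      proof (cases "\<exists>j\<in>mid. g j c \<noteq> 0")
        case False
        show ?thesis
        proof (rule fin[OF less.prems(1,2)], intro allI impI)
          fix i assume "i \<noteq> - c"
          then show "g i c = (if i = c then 1 else 0)"
            using False zero_out[OF less.prems(1), of i c] less.prems(3,4) K(6) by (cases "i \<in> mid") (auto simp: mid)
        qed
      next
        case True
        then obtain j where j: "j \<in> mid" "g j c \<noteq> 0" by blast
        have jI: "j \<in> ?I" "j \<noteq> c" "\<bar>j\<bar> \<le> K" "j \<noteq> - c" "c \<in> ?I" "\<bar>c\<bar> \<le> K" "c \<noteq> - c" "- c \<noteq> c" using mid(2)[OF j(1)] less.prems(3) K by auto
        let ?h = "?R j c (- g j c) g"
        have h: "?h i c = (if i = j then 0 else if i = - c then ?h i c else g i c)" for i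
          using less.prems(4) jI by (auto simp: entry[OF jI(1,5) less.prems(1)])
        have "{i\<in>mid. ?h i c \<noteq> 0} \<subset> {i\<in>mid. g i c \<noteq> 0}"
        proof
          show "{i\<in>mid. ?h i c \<noteq> 0} \<subseteq> {i\<in>mid. g i c \<noteq> 0}"
          proof clarify
            fix i assume i: "i \<in> mid" "?h i c \<noteq> 0" "g i c = 0"
            have "i \<noteq> - c" using mid(2)[OF i(1)] less.prems(3) by auto
            then show False using h[of i] i by (auto split: if_splits)
          qed
          show "{i\<in>mid. ?h i c \<noteq> 0} \<noteq> {i\<in>mid. g i c \<noteq> 0}" using h[of j] j by auto
        qed
        then have "card {i\<in>mid. ?h i c \<noteq> 0} < card {i\<in>mid. g i c \<noteq> 0}" by (intro psubset_card_mono) (auto simp: mid(1))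
        moreover have "fix' ?h" by (rule fixR) (use less.prems jI in auto)
        moreover have "unit_col ?h K \<or> c = K"
        proof (cases "c = K")
          case False
          then have "c = - K" "unit_col g K" using less.prems by auto
          then have "unit_col ?h K" using less.prems(1) jI mid(2)[OF j(1)] K unfolding fix'_def
            by (intro unit_col_root_elem_mult) auto
          then show ?thesis ..
        qed auto
        moreover have "?h c c = 1" using h[of c] less.prems(4) jI by auto
        ultimately have "P ?h" using less.prems(3) by (intro less.hyps) auto
        then show ?thesis by (rule undo[rotated 4]) (use less.prems(1) jI in \<open>auto simp: fix'_def\<close>)
      qed
    qed
    have finish: "\<exists>s. fix' (?R (- c) c s h) \<and> unit_col (?R (- c) c s h) c"
      if "fix' h" "c = K \<or> c = - K" "\<forall>i. i \<noteq> - c \<longrightarrow> h i c = (if i = c then 1 else 0)" for h c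
    proof (intro exI conjI)
      have c: "c \<in> ?I" "- c \<in> ?I" "\<bar>c\<bar> \<le> K" "- c \<noteq> c" "c \<noteq> - c" "theta (- c) c = (-1 :: 'k)" using that(2) K th by auto
      \<comment> \<open>The off-diagonal entry of a long root element is twice its
        parameter.\<close>
      let ?s = "- h (- c) c / 2"
      show "fix' (?R (- c) c ?s h)" by (rule fixR) (use that c in auto)
      show "unit_col (?R (- c) c ?s h) c"
        unfolding unit_col_def using that(3) c two by (auto simp: entry[OF c(2,1) that(1)] field_simps)
    qed
    have B: "P g" if g: "fix' g" "unit_col g K" for g
    proof (rule clear[of g "- K"])
      have "g (- K) (- K) = 1" using Sp_unit_col_entry[of g n K "- K"] g K unfolding fix'_def by auto
      then show "g (- K) (- K) = 1" .
      fix h assume h: "fix' h" "unit_col h K \<or> - K = K" "\<forall>i. i \<noteq> - (- K) \<longrightarrow> h i (- K) = (if i = - K then 1 else 0)"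
      then obtain s where s: "fix' (?R K (- K) s h)" "unit_col (?R K (- K) s h) (- K)" using finish[of h "- K"] by auto
      have "unit_col (?R K (- K) s h) K" using h K unfolding fix'_def by (intro unit_col_root_elem_mult) auto
      then have "P (?R K (- K) s h)" using C s by blast
      then show "P h" by (rule undo[rotated 4]) (use h(1) K in \<open>auto simp: fix'_def\<close>)
    qed (use g in auto)
    have A1: "P g" if g: "fix' g" "g K K = 1" for g
    proof (rule clear[of g K])
      fix h assume h: "fix' h" "\<forall>i. i \<noteq> - K \<longrightarrow> h i K = (if i = K then 1 else 0)"
      then obtain s where s: "fix' (?R (- K) K s h)" "unit_col (?R (- K) K s h) K" using finish[of h K] by auto
      then have "P (?R (- K) K s h)" using B by blast
      then show "P h" by (rule undo[rotated 4]) (use h(1) K in \<open>auto simp: fix'_def\<close>)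
    qed (use g in auto)
    have A2: "P g" if g: "fix' g" "j \<noteq> K" "\<bar>j\<bar> \<le> K" "g j K \<noteq> 0" for g j
    proof -
      have j: "j \<in> ?I" using g by (auto simp: fix'_def carrier_Sp_iff)
      \<comment> \<open>The parameter that makes the pivot 1; the 2 is again that of a long
        root.\<close>
      define s where "s = (1 - g K K) / (if j = - K then 2 * g j K else g j K)"
      have ne: "K \<noteq> j" using g by auto
      have "?R K j s g K K = 1"
        using g K th two by (auto simp: entry[OF K(1) j g(1)] s_def field_simps)
      moreover have "fix' (?R K j s g)" by (rule fixR) (use g j K in auto)
      ultimately have "P (?R K j s g)" by (rule A1[rotated])
      then show ?thesis by (rule undo[rotated 4]) (use g j K in \<open>auto simp: fix'_def\<close>)
    qed
    have A: "P g" if g: "fix' g" for g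
    proof (cases "\<exists>j. j \<noteq> K \<and> \<bar>j\<bar> \<le> K \<and> g j K \<noteq> 0")
      case True then show ?thesis using A2 g by blast
    next
      case False
      have "g K K \<noteq> 0"
      proof
        assume "g K K = 0"
        then have "g i K = 0" for i using False supp[OF g, of i K] K(6) by (cases "i = K"; cases "\<bar>i\<bar> \<le> K") auto
        then have "symp n (\<lambda>i. g i K) (\<lambda>i. g i (- K)) = 0" by (simp add: symp_def)
        then show False using Sp_column_symp[of g n K "- K"] g K by (auto simp: fix'_def)
      qed
      \<comment> \<open>The pivot is the only relevant nonzero entry of its column. Adding a
        multiple of its row to row \<open>- K\<close> creates a second one, and \<open>A2\<close>
        applies.\<close>
      let ?h = "?R (- K) K 1 g"
      have "g (- K) K = 0" using False K(3,6) by (metis abs_minus_cancel abs_of_pos order_refl)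
      then have "?h (- K) K = 2 * g K K" using K th by (auto simp: entry[OF K(2,1) g])
      then have "?h (- K) K \<noteq> 0" using two \<open>g K K \<noteq> 0\<close> by simp
      moreover have "fix' ?h" by (rule fixR) (use g K in auto)
      ultimately have "P ?h" using K by (intro A2[of ?h "- K"]) auto
      then show ?thesis by (rule undo[rotated 4]) (use g K in \<open>auto simp: fix'_def\<close>)
    qed
    show ?case using Suc.prems by (intro A) (auto simp: fix'_def K_def)
  qed
  from this[OF g, of n] show ?thesis by (auto simp: index_set_iff)
qed

subsection \<open>Regular functions along curves\<close>

lemma point_derivation_add:
  "point_derivation n D \<Longrightarrow> f \<in> regular_functions n \<Longrightarrow> h \<in> regular_functions n \<Longrightarrow>
    D (\<lambda>g\<in>carrier (Sp n). f g + h g) = D f + D h"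
  by (auto simp: point_derivation_def)

lemma point_derivation_mult:
  "point_derivation n D \<Longrightarrow> f \<in> regular_functions n \<Longrightarrow> h \<in> regular_functions n \<Longrightarrow>
    D (\<lambda>g\<in>carrier (Sp n). f g * h g) = D f * h (mat_one (index_set n)) + f (mat_one (index_set n)) * D h"
  by (auto simp: point_derivation_def)

text \<open>The curve \<open>x\<close> has its entries in \<open>\<bbbK>[s, 1/e(s)]\<close> and passes through the identity at
  \<open>s\<^sub>0\<close> with tangent vector \<open>X\<close>; root subgroups have \<open>e = 1\<close>, one-parameter tori \<open>e = s\<close>.
  The second conjunct is the quotient rule for \<open>f(x(s)) = q(s) / e(s)\<^sup>d\<close> at \<open>s\<^sub>0\<close>.\<close>

lemma regular_function_along_curve:
  fixes x :: "'k::field \<Rightarrow> 'k matrix"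
  assumes x: "\<And>s. poly e s \<noteq> 0 \<Longrightarrow> x s \<in> carrier (Sp n)" and x0: "x s0 = mat_one (index_set n)" and e0: "poly e s0 = 1"
    and coord: "\<And>i j. i \<in> index_set n \<Longrightarrow> j \<in> index_set n \<Longrightarrow>
      \<exists>q. (\<forall>s. poly e s \<noteq> 0 \<longrightarrow> x s i j * poly e s = poly q s) \<and>
          X i j + poly (pderiv e) s0 * mat_one (index_set n) i j = poly (pderiv q) s0"
    and D: "tangent_derivation n X D" and f: "f \<in> regular_functions n"
  shows "\<exists>d q. (\<forall>s. poly e s \<noteq> 0 \<longrightarrow> f (x s) * poly e s ^ d = poly q s) \<and>
     D f + of_nat d * poly (pderiv e) s0 * f (mat_one (index_set n)) = poly (pderiv q) s0"
  using f
proof induction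
  case (const c)
  have "D (\<lambda>g\<in>carrier (Sp n). c) = 0" using D by (auto simp: tangent_derivation_def point_derivation_def)
  then show ?case by (intro exI[of _ "0::nat"] exI[of _ "[:c:]"] conjI)
    (simp add: x, simp add: pderiv_pCons del: restrict_apply)
next
  case (coord i j)
  then obtain q where q: "\<forall>s. poly e s \<noteq> 0 \<longrightarrow> x s i j * poly e s = poly q s"
    "X i j + poly (pderiv e) s0 * mat_one (index_set n) i j = poly (pderiv q) s0"
    using assms(4) by blast
  have "D (\<lambda>g\<in>carrier (Sp n). g i j) = X i j" using D coord by (auto simp: tangent_derivation_def)
  then show ?case using q by (intro exI[of _ "1::nat"] exI[of _ q] conjI)
    (simp add: x, simp add: one_in_Sp restrict_apply' del: restrict_apply)
next
  case (add f h)
  have pd: "point_derivation n D" using D by (simp add: tangent_derivation_def)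
  obtain d1 q1 where 1: "\<forall>s. poly e s \<noteq> 0 \<longrightarrow> f (x s) * poly e s ^ d1 = poly q1 s"
    "D f + of_nat d1 * poly (pderiv e) s0 * f (mat_one (index_set n)) = poly (pderiv q1) s0" using add by blast
  obtain d2 q2 where 2: "\<forall>s. poly e s \<noteq> 0 \<longrightarrow> h (x s) * poly e s ^ d2 = poly q2 s"
    "D h + of_nat d2 * poly (pderiv e) s0 * h (mat_one (index_set n)) = poly (pderiv q2) s0" using add by blast
  have v: "poly q1 s0 = f (mat_one (index_set n))" "poly q2 s0 = h (mat_one (index_set n))"
    using 1(1)[rule_format, of s0] 2(1)[rule_format, of s0] e0 x0 by auto
  have "(f (x s) + h (x s)) * poly e s ^ (d1 + d2) = poly (q1 * e ^ d2 + q2 * e ^ d1) s" if "poly e s \<noteq> 0" for s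
    using 1(1)[rule_format, OF that, symmetric] 2(1)[rule_format, OF that, symmetric]
    by (simp add: algebra_simps power_add)
  moreover have "poly (pderiv (q1 * e ^ d2 + q2 * e ^ d1)) s0 =
    poly (pderiv q1) s0 + of_nat d2 * poly (pderiv e) s0 * poly q1 s0 + (poly (pderiv q2) s0 + of_nat d1 * poly (pderiv e) s0 * poly q2 s0)"
    by (simp add: pderiv_add pderiv_mult pderiv_power e0 algebra_simps)
  ultimately show ?case
    using x one_in_Sp[of n, where 'a = 'k]
    by (intro exI[of _ "d1 + d2"] exI[of _ "q1 * e ^ d2 + q2 * e ^ d1"])
       (simp add: point_derivation_add[OF pd add.hyps(1,2)] v 1(2)[symmetric] 2(2)[symmetric] algebra_simps restrict_apply' del: restrict_apply)
next
  case (mult f h)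
  have pd: "point_derivation n D" using D by (simp add: tangent_derivation_def)
  obtain d1 q1 where 1: "\<forall>s. poly e s \<noteq> 0 \<longrightarrow> f (x s) * poly e s ^ d1 = poly q1 s"
    "D f + of_nat d1 * poly (pderiv e) s0 * f (mat_one (index_set n)) = poly (pderiv q1) s0" using mult by blast
  obtain d2 q2 where 2: "\<forall>s. poly e s \<noteq> 0 \<longrightarrow> h (x s) * poly e s ^ d2 = poly q2 s"
    "D h + of_nat d2 * poly (pderiv e) s0 * h (mat_one (index_set n)) = poly (pderiv q2) s0" using mult by blast
  have v: "poly q1 s0 = f (mat_one (index_set n))" "poly q2 s0 = h (mat_one (index_set n))"
    using 1(1)[rule_format, of s0] 2(1)[rule_format, of s0] e0 x0 by auto
  have "(f (x s) * h (x s)) * poly e s ^ (d1 + d2) = poly (q1 * q2) s" if "poly e s \<noteq> 0" for s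
    using 1(1)[rule_format, OF that, symmetric] 2(1)[rule_format, OF that, symmetric]
    by (simp add: algebra_simps power_add)
  moreover have "poly (pderiv (q1 * q2)) s0 = poly (pderiv q1) s0 * poly q2 s0 + poly q1 s0 * poly (pderiv q2) s0"
    by (simp add: pderiv_mult algebra_simps)
  ultimately show ?case
    using x one_in_Sp[of n, where 'a = 'k]
    by (intro exI[of _ "d1 + d2"] exI[of _ "q1 * q2"])
       (simp add: point_derivation_mult[OF pd mult.hyps(1,2)] v 1(2)[symmetric] 2(2)[symmetric] algebra_simps restrict_apply' del: restrict_apply)
qed

section \<open>Rational modules of the symplectic group\<close>

text \<open>The weight of basis vector \<open>a\<close>, that is, the sign of \<open>a\<close> times
  \<open>\<epsilon>\<close> with index \<open>\<bar>a\<bar>\<close>. Hence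
  \<open>root_weight a b\<close> is the weight of \<open>F_mat a b\<close>.\<close>

definition index_weight :: "int \<Rightarrow> nat \<Rightarrow> int" where
  "index_weight a i = (if a = int i then 1 else 0) - (if a = - int i then 1 else 0)"

definition root_weight :: "int \<Rightarrow> int \<Rightarrow> nat \<Rightarrow> int" where
  "root_weight a b i = index_weight a i - index_weight b i"

lemma prod_powi_delta:
  fixes t :: "nat \<Rightarrow> 'k::field"
  assumes "i \<in> {1..n}"
  shows "(\<Prod>j=1..n. t j powi (if j = i then m else 0)) = t i powi m"
proof -
  have "(\<Prod>j=1..n. t j powi (if j = i then m else 0)) = (\<Prod>j=1..n. if j = i then t j powi m else 1)"
    by (rule prod.cong) auto
  then show ?thesis using assms by simp
qed

lemma torus_entry_eq_prod:
  fixes t :: "nat \<Rightarrow> 'k::field"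
  assumes "a \<in> index_set n"
  shows "torus_entry t a = (\<Prod>i=1..n. t i powi index_weight a i)"
proof (cases "a > 0")
  case True
  have "index_weight a = (\<lambda>j. if j = nat a then 1 else 0)" using True by (auto simp: index_weight_def fun_eq_iff)
  moreover have "nat a \<in> {1..n}" using True assms by (auto simp: index_set_iff)
  ultimately show ?thesis using True prod_powi_delta[of "nat a" n t 1] by (simp add: torus_entry_def)
next
  case False
  have "index_weight a = (\<lambda>j. if j = nat (- a) then - 1 else 0)" using False assms by (auto simp: index_weight_def fun_eq_iff index_set_iff)
  moreover have "nat (- a) \<in> {1..n}" using False assms by (auto simp: index_set_iff)
  ultimately show ?thesis using False prod_powi_delta[of "nat (- a)" n t "- 1"]
    by (simp add: torus_entry_def power_int_minus)
qed

text \<open>\<open>T a b\<close> stands for the action of \<open>F_mat a b\<close>. Its symmetry and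
  bracket relations are assumptions because in the application they are instances of the relations
  of the twisted Yangian.\<close>

locale sp_module = fin_vector_space scale
  for scale :: "'k::alg_closed_field \<Rightarrow> 'v::ab_group_add \<Rightarrow> 'v" +
  fixes n :: nat and \<rho> :: "'k matrix \<Rightarrow> 'v \<Rightarrow> 'v" and T :: "int \<Rightarrow> int \<Rightarrow> 'v \<Rightarrow> 'v"
  assumes two_nonzero: "(2::'k) \<noteq> 0" and n_pos: "1 \<le> n"
    and module: "Sp_module n scale \<rho>"
    and T_lin: "\<And>a b. a \<in> index_set n \<Longrightarrow> b \<in> index_set n \<Longrightarrow> lin (T a b)"
    and differential: "\<And>a b. a \<in> index_set n \<Longrightarrow> b \<in> index_set n \<Longrightarrow> is_differential n scale \<rho> (F_mat a b) (T a b)"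
    and T_sym: "\<And>a b v. a \<in> index_set n \<Longrightarrow> b \<in> index_set n \<Longrightarrow>
      T a b v = - scale (theta a b) (T (- b) (- a) v)"
    and T_bracket: "\<And>a b c d v. a \<in> index_set n \<Longrightarrow> b \<in> index_set n \<Longrightarrow> c \<in> index_set n \<Longrightarrow> d \<in> index_set n \<Longrightarrow>
      T a b (T c d v) - T c d (T a b v) =
        (if b = c then T a d v else 0) - (if a = d then T c b v else 0)
        - (if a = - c then scale (theta (- c) b) (T (- b) d v) else 0)
        + (if b = - d then scale (theta a (- d)) (T c (- a) v) else 0)"
begin

abbreviation "I \<equiv> index_set n"
abbreviation weight :: "(nat \<Rightarrow> int) \<Rightarrow> 'v \<Rightarrow> bool" where "weight \<equiv> weight_vector n scale \<rho>"
abbreviation submodule :: "'v set \<Rightarrow> bool" where "submodule \<equiv> Sp_submodule n scale \<rho>"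
abbreviation nonvanishing :: "(nat \<Rightarrow> 'k) \<Rightarrow> bool" where "nonvanishing t \<equiv> (\<forall>i\<in>{1..n}. t i \<noteq> 0)"

lemma rho_unit: "g \<in> carrier (Sp n) \<Longrightarrow> \<rho> g \<in> Units (End_ring scale)"
  using module by (auto simp: Sp_module_def hom_def units_of_def Pi_def)

lemma rho_lin: "g \<in> carrier (Sp n) \<Longrightarrow> lin (\<rho> g)"
  using rho_unit[of g] by (auto simp: Units_def End_ring_def)

lemma rho_mult:
  "g \<in> carrier (Sp n) \<Longrightarrow> h \<in> carrier (Sp n) \<Longrightarrow> \<rho> (mat_mult I g h) v = \<rho> g (\<rho> h v)"
  using module by (auto simp: Sp_module_def hom_def units_of_def End_ring_def)

lemma rho_eq_0: "g \<in> carrier (Sp n) \<Longrightarrow> \<rho> g v = 0 \<Longrightarrow> v = 0"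
proof -
  assume g: "g \<in> carrier (Sp n)" "\<rho> g v = 0"
  obtain f where f: "lin f" "f \<circ> \<rho> g = id" using rho_unit[OF g(1)] by (auto simp: Units_def End_ring_def)
  then have "v = f (\<rho> g v)" by (metis comp_apply id_apply)
  then show "v = 0" using g lin_0[OF f(1)] by simp
qed

lemma rho_one: "\<rho> (mat_one I) v = v"
proof -
  have "\<rho> (mat_one I) (\<rho> (mat_one I) v) = \<rho> (mat_one I) v"
    using rho_mult[OF one_in_Sp one_in_Sp, of v] mat_mult_one_left[OF one_in_Sp, of n, where 'a = 'k] by simp
  then have "\<rho> (mat_one I) (\<rho> (mat_one I) v - v) = 0"
    by (simp add: lin_diff[OF rho_lin[OF one_in_Sp]])
  then have "\<rho> (mat_one I) v - v = 0" by (rule rho_eq_0[OF one_in_Sp])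
  then show ?thesis by simp
qed

lemma matrix_coefficient_regular:
  "functional l \<Longrightarrow> (\<lambda>g\<in>carrier (Sp n). l (\<rho> g v)) \<in> regular_functions n"
  using module by (auto simp: Sp_module_def)

lemma matrix_coefficient_along_curve:
  assumes ab: "a \<in> I" "b \<in> I"
    and x: "\<And>s. poly e s \<noteq> 0 \<Longrightarrow> x s \<in> carrier (Sp n)" and x0: "x s0 = mat_one I" and e0: "poly e s0 = 1"
    and coord: "\<And>i j. i \<in> I \<Longrightarrow> j \<in> I \<Longrightarrow>
      \<exists>q. (\<forall>s. poly e s \<noteq> 0 \<longrightarrow> x s i j * poly e s = poly q s) \<and>
          F_mat a b i j + poly (pderiv e) s0 * mat_one I i j = poly (pderiv q) s0"
    and l: "functional l"
  shows "\<exists>d q. (\<forall>s. poly e s \<noteq> 0 \<longrightarrow> l (\<rho> (x s) v) * poly e s ^ d = poly q s) \<and>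
     l (T a b v) + of_nat d * poly (pderiv e) s0 * l v = poly (pderiv q) s0"
proof -
  obtain D where D: "tangent_derivation n (F_mat a b) D"
    "\<And>l v. functional l \<Longrightarrow> l (T a b v) = D (\<lambda>g\<in>carrier (Sp n). l (\<rho> g v))"
    using differential[OF ab] unfolding is_differential_def by blast
  show ?thesis
    using regular_function_along_curve[OF x x0 e0 coord D(1) matrix_coefficient_regular[OF l, of v]]
    unfolding D(2)[OF l, of v] by (simp add: x one_in_Sp rho_one restrict_apply' del: restrict_apply cong: conj_cong)
qed

text \<open>Coordinates with respect to a basis are functionals. There are finitely many, so one
  common power of \<open>e\<close> clears all their denominators.\<close>

lemma vector_valued_polynomial:
  assumes y: "\<And>l. functional l \<Longrightarrow> \<exists>d q. \<forall>s. poly e s \<noteq> 0 \<longrightarrow> l (y s) * poly e s ^ d = poly q s"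
  shows "\<exists>d N c. (\<forall>k>N. c k = 0) \<and> (\<forall>s. poly e s \<noteq> 0 \<longrightarrow> scale (poly e s ^ d) (y s) = (\<Sum>k\<le>N. scale (s ^ k) (c k)))"
proof -
  obtain B0 where B0: "finite B0" "span B0 = UNIV" using finite_spanning by blast
  obtain B where B: "B \<subseteq> B0" "independent B" "B0 \<subseteq> span B" using maximal_independent_subset by blast
  have finB: "finite B" using B B0 finite_subset by blast
  have spB: "span B = UNIV" using B B0 by (metis span_mono span_span top.extremum_uniqueI)
  let ?r = "representation B"
  have rep: "w = (\<Sum>b\<in>B. scale (?r w b) b)" for w
    using sum_representation_eq[OF B(2), of w B] finB spB by simp
  have fr: "functional (\<lambda>w. ?r w b)" for b
    unfolding functional_iff using representation_add[OF B(2)] representation_scale[OF B(2)] spB by auto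
  have "\<exists>d q. \<forall>s. poly e s \<noteq> 0 \<longrightarrow> ?r (y s) b * poly e s ^ d = poly q s" for b
    using y[OF fr] .
  then obtain d q where dq: "\<And>b s. poly e s \<noteq> 0 \<Longrightarrow> ?r (y s) b * poly e s ^ d b = poly (q b) s" by metis
  define D where "D = sum d B"
  define Q where "Q b = q b * e ^ (D - d b)" for b
  have Q: "?r (y s) b * poly e s ^ D = poly (Q b) s" if "poly e s \<noteq> 0" "b \<in> B" for b s
  proof -
    have "d b \<le> D" unfolding D_def using that finB by (simp add: member_le_sum)
    then have "poly e s ^ D = poly e s ^ d b * poly e s ^ (D - d b)" by (simp add: power_add[symmetric])
    then show ?thesis using dq[OF that(1), of b, symmetric] by (simp add: Q_def algebra_simps)
  qed
  define N where "N = (\<Sum>b\<in>B. degree (Q b))"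
  have N: "degree (Q b) \<le> N" if "b \<in> B" for b
    unfolding N_def by (rule member_le_sum[of b B "\<lambda>b. degree (Q b)"]) (use that finB in auto)
  define c where "c k = (\<Sum>b\<in>B. scale (coeff (Q b) k) b)" for k
  have "scale (poly e s ^ D) (y s) = (\<Sum>k\<le>N. scale (s ^ k) (c k))" if s: "poly e s \<noteq> 0" for s
  proof -
    have "scale (poly e s ^ D) (y s) = (\<Sum>b\<in>B. scale (poly (Q b) s) b)"
      by (subst rep[of "y s"]) (auto simp: scale_sum_right Q[OF s, symmetric] mult.commute intro!: sum.cong)
    also have "\<dots> = (\<Sum>b\<in>B. \<Sum>k\<le>N. scale (s ^ k) (scale (coeff (Q b) k) b))"
    proof (rule sum.cong)
      fix b assume "b \<in> B"
      then have "poly (Q b) s = (\<Sum>k\<le>N. coeff (Q b) k * s ^ k)"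
        unfolding poly_altdef by (intro sum.mono_neutral_left) (use N[OF \<open>b \<in> B\<close>] in \<open>auto simp: coeff_eq_0\<close>)
      then show "scale (poly (Q b) s) b = (\<Sum>k\<le>N. scale (s ^ k) (scale (coeff (Q b) k) b))"
        by (simp add: scale_sum_left mult.commute)
    qed simp
    also have "\<dots> = (\<Sum>k\<le>N. scale (s ^ k) (c k))"
      by (subst sum.swap) (simp add: c_def scale_sum_right)
    finally show ?thesis .
  qed
  moreover have "c k = 0" if "k > N" for k
    unfolding c_def by (rule sum.neutral) (use that N in \<open>fastforce simp: coeff_eq_0\<close>)
  ultimately show ?thesis by blast
qed

subsection \<open>Root subgroups act by polynomials\<close>

text \<open>The \<open>c k\<close> are the divided powers of \<open>T a b\<close> applied to
  \<open>v\<close>; unlike quotients by \<open>k!\<close> they exist in every characteristic. The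
  recursion is the derivative at \<open>t = 0\<close> of the additivity of the root subgroup in
  \<open>t + s\<close>.\<close>

lemma root_coeffs_exist:
  assumes ab: "a \<in> I" "b \<in> I" "a \<noteq> b"
  shows "\<exists>c N. (\<forall>k>N. c k = 0) \<and> (\<forall>s. \<rho> (root_elem n a b s) v = (\<Sum>k\<le>N. scale (s ^ k) (c k))) \<and>
    c 0 = v \<and> (\<forall>k. T a b (c k) = scale (of_nat (Suc k)) (c (Suc k)))"
proof -
  have curve: "\<exists>q. (\<forall>s. l (\<rho> (root_elem n a b s) w) = poly q s) \<and> l (T a b w) = poly (pderiv q) 0"
    if l: "functional l" for l w
  proof -
    have "\<exists>q. (\<forall>s. poly 1 s \<noteq> 0 \<longrightarrow> root_elem n a b s i j * poly 1 s = poly q s) \<and>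
          F_mat a b i j + poly (pderiv 1) 0 * mat_one I i j = poly (pderiv q) (0::'k)" for i j
      by (rule exI[of _ "[:mat_one I i j, F_mat a b i j:]"]) (auto simp: root_elem_def pderiv_pCons)
    from matrix_coefficient_along_curve[OF ab(1,2), of 1 "root_elem n a b" 0 l w, OF _ root_elem_0 _ this l]
    show ?thesis using root_elem_in_Sp[OF ab] by auto
  qed
  have "\<exists>d N c. (\<forall>k>N. c k = 0) \<and> (\<forall>s. poly 1 s \<noteq> (0::'k) \<longrightarrow> scale (poly 1 s ^ d) (\<rho> (root_elem n a b s) v) = (\<Sum>k\<le>N. scale (s ^ k) (c k)))"
    by (rule vector_valued_polynomial) (use curve[of _ v] in fastforce)
  then obtain N c where c: "\<And>k. k > N \<Longrightarrow> c k = 0"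
    "\<And>s. \<rho> (root_elem n a b s) v = (\<Sum>k\<le>N. scale (s ^ k) (c k))" by auto
  have "c 0 = v"
    using c(2)[of 0] by (simp add: root_elem_0 rho_one sum.atMost_shift zero_power)
  moreover have "T a b (c k) = scale (of_nat (Suc k)) (c (Suc k))" for k
  proof (rule vector_eqI)
    fix l assume l: "functional l"
    define P where "P = (\<Sum>k\<le>N. monom (l (c k)) k)"
    have P: "l (\<rho> (root_elem n a b s) v) = poly P s" for s
      unfolding c(2) P_def by (simp add: functional_sum[OF l] functional_scale[OF l] poly_sum poly_monom mult.commute)
    have Pc: "coeff P k = l (c k)" for k
      unfolding P_def using c(1)[of k] functional_0[OF l] by (auto simp: coeff_sum not_le)
    have "l (T a b (\<rho> (root_elem n a b s) v)) = poly (pderiv P) s" for s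
    proof -
      obtain q where q: "\<And>t. l (\<rho> (root_elem n a b t) (\<rho> (root_elem n a b s) v)) = poly q t"
        "l (T a b (\<rho> (root_elem n a b s) v)) = poly (pderiv q) 0" using curve[OF l] by blast
      have "poly q t = poly (pcompose P [:s, 1:]) t" for t
        unfolding q(1)[symmetric] rho_mult[OF root_elem_in_Sp[OF ab] root_elem_in_Sp[OF ab], symmetric]
        using ab by (simp add: root_elem_add P poly_pcompose add.commute)
      then have "q = pcompose P [:s, 1:]" by (intro poly_eqI_infinite[OF infinite_UNIV_alg_closed])
      then show ?thesis using q(2) by (simp add: pderiv_pcompose poly_pcompose pderiv_pCons)
    qed
    moreover have "l (T a b (\<rho> (root_elem n a b s) v)) = poly (\<Sum>k\<le>N. monom (l (T a b (c k))) k) s" for s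
      unfolding c(2) using T_lin[OF ab(1,2)]
      by (simp add: functional_sum[OF l] functional_scale[OF l] lin_sum lin_scale poly_sum poly_monom mult.commute)
    ultimately have "pderiv P = (\<Sum>k\<le>N. monom (l (T a b (c k))) k)"
      by (intro poly_eqI_infinite[OF infinite_UNIV_alg_closed]) simp
    then have "coeff (pderiv P) k = coeff (\<Sum>k\<le>N. monom (l (T a b (c k))) k) k" by simp
    moreover have "coeff (\<Sum>k\<le>N. monom (l (T a b (c k))) k) k = l (T a b (c k))"
      using c(1)[of k] lin_0[OF T_lin[OF ab(1,2)]] functional_0[OF l] by (auto simp: coeff_sum not_le)
    ultimately show "l (T a b (c k)) = l (scale (of_nat (Suc k)) (c (Suc k)))"
      by (simp add: coeff_pderiv Pc functional_scale[OF l] del: of_nat_Suc)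
  qed
  ultimately show ?thesis using c by blast
qed

definition root_coeff :: "int \<Rightarrow> int \<Rightarrow> 'v \<Rightarrow> nat \<Rightarrow> 'v" where
  "root_coeff a b v = (SOME c. \<exists>N. (\<forall>k>N. c k = 0) \<and> (\<forall>s. \<rho> (root_elem n a b s) v = (\<Sum>k\<le>N. scale (s ^ k) (c k))) \<and>
    c 0 = v \<and> (\<forall>k. T a b (c k) = scale (of_nat (Suc k)) (c (Suc k))))"

lemma root_coeff:
  assumes "a \<in> I" "b \<in> I" "a \<noteq> b"
  shows "\<exists>N. (\<forall>k>N. root_coeff a b v k = 0) \<and> (\<forall>s. \<rho> (root_elem n a b s) v = (\<Sum>k\<le>N. scale (s ^ k) (root_coeff a b v k)))"
    and root_coeff_0: "root_coeff a b v 0 = v"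
    and root_coeff_Suc: "T a b (root_coeff a b v k) = scale (of_nat (Suc k)) (root_coeff a b v (Suc k))"
  unfolding root_coeff_def using someI_ex[OF root_coeffs_exist[OF assms, of v]] by auto

lemma root_coeff_1: "a \<in> I \<Longrightarrow> b \<in> I \<Longrightarrow> a \<noteq> b \<Longrightarrow> root_coeff a b v (Suc 0) = T a b v"
  using root_coeff_Suc[of a b v 0] root_coeff_0[of a b v] by simp

lemma root_coeff_in_submodule:
  assumes W: "submodule W" and v: "v \<in> W" and ab: "a \<in> I" "b \<in> I" "a \<noteq> b"
  shows "root_coeff a b v k \<in> W"
proof -
  obtain N where N: "\<forall>k>N. root_coeff a b v k = 0" "\<And>s. \<rho> (root_elem n a b s) v = (\<Sum>k\<le>N. scale (s ^ k) (root_coeff a b v k))"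
    using root_coeff(1)[OF ab, of v] by blast
  have sub: "subspace W" using W by (simp add: Sp_submodule_def)
  show ?thesis
  proof (cases "k \<le> N")
    case True
    show ?thesis
      by (rule coeffs_in_subspace[OF sub infinite_UNIV_alg_closed _ True])
        (use N(2)[symmetric] W v root_elem_in_Sp[OF ab] in \<open>auto simp: Sp_submodule_def\<close>)
  next
    case False
    then show ?thesis using N sub by (simp add: subspace_0)
  qed
qed

lemma nonvanishing_torus: "nonvanishing t \<Longrightarrow> torus_elem n t \<in> carrier (Sp n)"
  by (rule torus_in_Sp) auto

lemma prod_powi_add:
  assumes "nonvanishing t"
  shows "(\<Prod>i=1..n. t i powi (\<nu> i + \<kappa> i)) = (\<Prod>i=1..n. t i powi \<nu> i) * (\<Prod>i=1..n. t i powi \<kappa> i)"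
  unfolding prod.distrib[symmetric] by (rule prod.cong) (use assms in \<open>auto simp: power_int_add\<close>)

lemma prod_powi_root_weight:
  assumes t: "nonvanishing t" and ab: "a \<in> I" "b \<in> I"
  shows "(\<Prod>i=1..n. t i powi (\<nu> i + int k * root_weight a b i)) = (torus_entry t a / torus_entry t b) ^ k * (\<Prod>i=1..n. t i powi \<nu> i)"
proof (induction k)
  case (Suc k)
  have "\<nu> i + int (Suc k) * root_weight a b i = (\<nu> i + int k * root_weight a b i) + index_weight a i + (- index_weight b i)" for i
    by (simp add: root_weight_def algebra_simps)
  then have "(\<Prod>i=1..n. t i powi (\<nu> i + int (Suc k) * root_weight a b i)) =
     (\<Prod>i=1..n. t i powi (\<nu> i + int k * root_weight a b i)) * torus_entry t a * (\<Prod>i=1..n. t i powi (- index_weight b i))"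
    using t ab by (simp only: prod_powi_add[OF t] torus_entry_eq_prod)
  also have "(\<Prod>i=1..n. t i powi (- index_weight b i)) = inverse (torus_entry t b)"
    using ab by (simp add: torus_entry_eq_prod power_int_minus prod_inversef[symmetric] comp_def)
  also have "(\<Prod>i=1..n. t i powi (\<nu> i + int k * root_weight a b i)) * torus_entry t a * inverse (torus_entry t b)
    = (torus_entry t a / torus_entry t b) ^ Suc k * (\<Prod>i=1..n. t i powi \<nu> i)"
    unfolding Suc.IH by (simp add: divide_inverse mult_ac)
  finally show ?case .
qed simp

text \<open>Conjugation by the torus rescales the parameter of the root subgroup by the root;
  comparing powers of \<open>s\<close> gives the weight of each coefficient.\<close>

lemma weight_root_coeff:
  assumes v: "weight \<nu> v" and ab: "a \<in> I" "b \<in> I" "a \<noteq> b"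
  shows "weight (\<lambda>i. \<nu> i + int k * root_weight a b i) (root_coeff a b v k)"
  unfolding weight_vector_def
proof (intro allI impI)
  fix t assume t: "nonvanishing t"
  let ?c = "root_coeff a b v"
  obtain N where N: "\<And>k. k > N \<Longrightarrow> ?c k = 0" "\<And>s. \<rho> (root_elem n a b s) v = (\<Sum>k\<le>N. scale (s ^ k) (?c k))"
    using root_coeff(1)[OF ab, of v] by blast
  let ?\<chi> = "torus_entry t a / torus_entry t b"
  let ?p = "\<Prod>i=1..n. t i powi \<nu> i"
  have tS: "torus_elem n t \<in> carrier (Sp n)" using t by (rule nonvanishing_torus)
  have "\<rho> (torus_elem n t) (?c k) = scale (?\<chi> ^ k * ?p) (?c k)"
  proof (cases "k \<le> N")
    case True
    show ?thesis
    proof (rule coeffs_eqI[OF infinite_UNIV_alg_closed _ True])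
      fix s :: 'k
      have "(\<Sum>k\<le>N. scale (s ^ k) (\<rho> (torus_elem n t) (?c k))) = \<rho> (torus_elem n t) (\<rho> (root_elem n a b s) v)"
        unfolding N(2) by (simp add: lin_sum[OF rho_lin[OF tS]] lin_scale[OF rho_lin[OF tS]])
      also have "\<dots> = \<rho> (root_elem n a b (?\<chi> * s)) (\<rho> (torus_elem n t) v)"
        using torus_root_elem[of n t a b s] t ab rho_mult[OF tS root_elem_in_Sp[OF ab]] rho_mult[OF root_elem_in_Sp[OF ab] tS] by metis
      also have "\<dots> = scale ?p (\<rho> (root_elem n a b (?\<chi> * s)) v)"
        using v t by (simp add: weight_vector_def lin_scale[OF rho_lin[OF root_elem_in_Sp[OF ab]]])
      also have "\<dots> = (\<Sum>k\<le>N. scale (s ^ k) (scale (?\<chi> ^ k * ?p) (?c k)))"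
        unfolding N(2) scale_sum_right by (rule sum.cong) (simp_all add: power_mult_distrib power_divide mult_ac)
      finally show "(\<Sum>k\<le>N. scale (s ^ k) (\<rho> (torus_elem n t) (?c k))) = (\<Sum>k\<le>N. scale (s ^ k) (scale (?\<chi> ^ k * ?p) (?c k)))" .
    qed
  next
    case False
    then show ?thesis using N(1)[of k] by (simp add: lin_0[OF rho_lin[OF tS]])
  qed
  then show "\<rho> (torus_elem n t) (?c k) = scale (\<Prod>i=1..n. t i powi (\<nu> i + int k * root_weight a b i)) (?c k)"
    unfolding prod_powi_root_weight[OF t ab(1,2)] .
qed

lemma weight_T_root: "weight \<nu> v \<Longrightarrow> a \<in> I \<Longrightarrow> b \<in> I \<Longrightarrow> a \<noteq> b \<Longrightarrow> weight (\<lambda>i. \<nu> i + root_weight a b i) (T a b v)"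
  using weight_root_coeff[of \<nu> v a b 1] by (simp add: root_coeff_1)

subsection \<open>Weight spaces\<close>

text \<open>After multiplication by a power of \<open>s\<close> only nonnegative exponents remain,
  and a polynomial is determined by its values on an infinite set.\<close>

lemma powi_independent:
  assumes F: "finite F" and eq: "\<And>s. s \<noteq> 0 \<Longrightarrow> (\<Sum>j\<in>F. scale (s powi j) (w j)) = 0" and j: "j \<in> F"
  shows "w j = 0"
proof -
  obtain m where m: "\<And>i. i \<in> F \<Longrightarrow> i + int m \<ge> 0"
  proof -
    have "i + int (nat (\<Sum>i\<in>F. \<bar>i\<bar>)) \<ge> 0" if "i \<in> F" for i
      using member_le_sum[OF that, of abs] F by simp
    then show ?thesis by (rule that)
  qed
  let ?e = "\<lambda>i. nat (i + int m)"
  have inj: "inj_on ?e F" using m by (intro inj_onI) (metis add_right_cancel int_nat_eq)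
  define N where "N = (\<Sum>i\<in>F. ?e i)"
  have N: "?e i \<le> N" if "i \<in> F" for i
    unfolding N_def by (rule member_le_sum[of i F "\<lambda>i. nat (i + int m)"]) (use that F in auto)
  define c where "c k = (if k \<in> ?e ` F then w (int k - int m) else 0)" for k
  have "c (?e j) = (0 :: 'v)"
  proof (rule coeffs_eqI[where A = "UNIV - {0}" and N = N and d = "\<lambda>_. 0"])
    show "infinite (UNIV - {0} :: 'k set)" using infinite_UNIV_alg_closed by simp
    fix s :: 'k assume "s \<in> UNIV - {0}"
    then have s: "s \<noteq> 0" by simp
    have "(\<Sum>k\<le>N. scale (s ^ k) (c k)) = (\<Sum>k\<in>?e ` F. scale (s ^ k) (c k))"
      by (rule sum.mono_neutral_right) (use N in \<open>auto simp: c_def\<close>)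
    also have "\<dots> = (\<Sum>i\<in>F. scale (s ^ ?e i) (w i))"
      unfolding sum.reindex[OF inj] by (rule sum.cong) (use m in \<open>auto simp: c_def\<close>)
    also have "\<dots> = (\<Sum>i\<in>F. scale (s ^ m) (scale (s powi i) (w i)))"
    proof (rule sum.cong)
      fix i assume "i \<in> F"
      then have "s ^ ?e i = s powi (i + int m)" using m[of i] by (simp add: power_int_def)
      then show "scale (s ^ ?e i) (w i) = scale (s ^ m) (scale (s powi i) (w i))"
        using s by (simp add: power_int_add mult.commute)
    qed simp
    also have "\<dots> = 0" unfolding scale_sum_right[symmetric] using eq[OF s] by simp
    finally show "(\<Sum>k\<le>N. scale (s ^ k) (c k)) = (\<Sum>k\<le>N. scale (s ^ k) 0)" by simp
  qed (use N j in auto)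
  then show ?thesis using j m[OF j] by (auto simp: c_def)
qed

section \<open>One-parameter tori and weight decompositions\<close>

definition cochar :: "nat \<Rightarrow> 'k \<Rightarrow> 'k matrix" where
  "cochar i s = torus_elem n ((\<lambda>_. 1)(i := s))"

lemma cochar_in_Sp: "s \<noteq> 0 \<Longrightarrow> cochar i s \<in> carrier (Sp n)"
  unfolding cochar_def by (rule nonvanishing_torus) auto

text \<open>The Lie algebra element is the derivative of the torus action at \<open>s = 1\<close>,
  and differentiating \<open>s powi j\<close> there gives the factor \<open>j\<close>. This links
  torus weights to Lie algebra weights.\<close>

lemma cochar_expansion:
  assumes i: "i \<in> {1..n}"
  shows "\<exists>M c. (\<forall>s. s \<noteq> 0 \<longrightarrow> \<rho> (cochar i s) v = (\<Sum>j=-int M..int M. scale (s powi j) (c j))) \<and>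
    T (int i) (int i) v = (\<Sum>j=-int M..int M. scale (of_int j) (c j))"
proof -
  let ?e = "[:0, 1:] :: 'k poly"
  have iI: "int i \<in> I" using i by (auto simp: index_set_iff)
  have curve: "\<exists>d q. (\<forall>s. s \<noteq> 0 \<longrightarrow> l (\<rho> (cochar i s) v) * s ^ d = poly q s) \<and>
      l (T (int i) (int i) v) + of_nat d * l v = poly (pderiv q) 1"
    if l: "functional l" for l
  proof -
    have coord: "\<exists>q. (\<forall>s. poly ?e s \<noteq> 0 \<longrightarrow> cochar i s x y * poly ?e s = poly q s) \<and>
          F_mat (int i) (int i) x y + poly (pderiv ?e) 1 * mat_one I x y = poly (pderiv q) (1::'k)"
      if xy: "x \<in> I" "y \<in> I" for x y
    proof -
      \<comment> \<open>The diagonal entries \<open>s\<close>, \<open>1/s\<close> and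
        \<open>1\<close>, each multiplied by the denominator \<open>s\<close>.\<close>
      define q :: "'k poly" where "q = (if x \<noteq> y then 0 else if x = int i then [:0, 0, 1:] else if x = - int i then 1 else [:0, 1:])"
      have "cochar i s x y * s = poly q s" if "s \<noteq> 0" for s
        using xy that i by (auto simp: cochar_def torus_elem_eq torus_entry_def q_def index_set_iff)
      moreover have "F_mat (int i) (int i) x y + mat_one I x y = poly (pderiv q) (1::'k)"
        using xy i by (auto simp: F_mat_def mat_unit_def mat_one_def q_def theta_eq pderiv_pCons)
      ultimately show ?thesis by (intro exI[of _ q]) (auto simp: pderiv_pCons)
    qed
    have 1: "cochar i 1 = mat_one I" by (auto simp: cochar_def torus_elem_eq torus_entry_def mat_one_def fun_eq_iff)
    from matrix_coefficient_along_curve[OF iI iI, of ?e "cochar i" 1 l v, OF _ 1 _ coord l]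
    show ?thesis using cochar_in_Sp by (simp add: pderiv_pCons)
  qed
  have "\<exists>d N c. (\<forall>k>N. c k = 0) \<and> (\<forall>s. poly ?e s \<noteq> (0::'k) \<longrightarrow> scale (poly ?e s ^ d) (\<rho> (cochar i s) v) = (\<Sum>k\<le>N. scale (s ^ k) (c k)))"
  proof (rule vector_valued_polynomial)
    fix l assume "functional l"
    then obtain d q where "\<forall>s. s \<noteq> 0 \<longrightarrow> l (\<rho> (cochar i s) v) * s ^ d = poly q s" using curve by blast
    then show "\<exists>d q. \<forall>s. poly ?e s \<noteq> 0 \<longrightarrow> l (\<rho> (cochar i s) v) * poly ?e s ^ d = poly q s"
      by (intro exI[of _ d] exI[of _ q]) simp
  qed
  then obtain d N c where c: "\<And>k. k > N \<Longrightarrow> c k = 0"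
    "\<And>s. s \<noteq> 0 \<Longrightarrow> scale (s ^ d) (\<rho> (cochar i s) v) = (\<Sum>k\<le>N. scale (s ^ k) (c k))" by auto
  define M where "M = N + d"
  define c' where "c' j = (if j + int d \<in> {0..int N} then c (nat (j + int d)) else 0)" for j
  have sum_c': "(\<Sum>j=-int M..int M. f j (c' j)) = (\<Sum>k\<le>N. f (int k - int d) (c k))"
    if "\<And>j. f j 0 = 0" for f :: "int \<Rightarrow> 'v \<Rightarrow> 'w::comm_monoid_add"
  proof -
    have "(\<Sum>j=-int M..int M. f j (c' j)) = (\<Sum>j\<in>(\<lambda>k. int k - int d) ` {..N}. f j (c' j))"
    proof (rule sum.mono_neutral_right)
      show "\<forall>j\<in>{-int M..int M} - (\<lambda>k. int k - int d) ` {..N}. f j (c' j) = 0"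
      proof
        fix j assume j: "j \<in> {-int M..int M} - (\<lambda>k. int k - int d) ` {..N}"
        have "j + int d \<notin> {0..int N}"
        proof
          assume a: "j + int d \<in> {0..int N}"
          then have "j = int (nat (j + int d)) - int d" "nat (j + int d) \<le> N" by auto
          then show False using j by blast
        qed
        then have "c' j = 0" by (simp add: c'_def del: atLeastAtMost_iff)
        then show "f j (c' j) = 0" using that by simp
      qed
    qed (auto simp: M_def)
    also have "\<dots> = (\<Sum>k\<le>N. f (int k - int d) (c k))"
      by (subst sum.reindex) (auto simp: inj_on_def c'_def)
    finally show ?thesis .
  qed
  have exp: "\<rho> (cochar i s) v = (\<Sum>j=-int M..int M. scale (s powi j) (c' j))" if s: "s \<noteq> 0" for s
  proof -
    have "\<rho> (cochar i s) v = scale (s powi (- int d)) (scale (s ^ d) (\<rho> (cochar i s) v))"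
      using s by (simp add: power_int_minus)
    also have "\<dots> = (\<Sum>k\<le>N. scale (s powi (int k - int d)) (c k))"
      unfolding c(2)[OF s] scale_sum_right
      by (rule sum.cong) (use s in \<open>simp_all add: power_int_diff power_int_minus field_simps\<close>)
    also have "\<dots> = (\<Sum>j=-int M..int M. scale (s powi j) (c' j))" by (rule sum_c'[symmetric]) simp
    finally show ?thesis .
  qed
  moreover have "T (int i) (int i) v = (\<Sum>j=-int M..int M. scale (of_int j) (c' j))"
  proof (rule vector_eqI)
    fix l assume l: "functional l"
    obtain d' q where q: "\<And>s. s \<noteq> 0 \<Longrightarrow> l (\<rho> (cochar i s) v) * s ^ d' = poly q s"
      "l (T (int i) (int i) v) + of_nat d' * l v = poly (pderiv q) 1" using curve[OF l] by blast
    have 1: "cochar i 1 = mat_one I" by (auto simp: cochar_def torus_elem_eq torus_entry_def mat_one_def fun_eq_iff)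
    have lv: "l v = poly q 1" using q(1)[of 1] by (simp add: 1 rho_one)
    define P where "P = (\<Sum>k\<le>N. monom (l (c k)) (k + d'))"
    have "poly (q * monom 1 d) s = poly P s" if s: "s \<noteq> 0" for s
    proof -
      have "poly (q * monom 1 d) s = l (scale (s ^ d) (\<rho> (cochar i s) v)) * s ^ d'"
        by (simp add: poly_monom q(1)[OF s, symmetric] functional_scale[OF l])
      then show ?thesis unfolding c(2)[OF s]
        by (simp add: P_def functional_sum[OF l] functional_scale[OF l] poly_sum poly_monom sum_distrib_right sum_distrib_left power_add mult_ac)
    qed
    then have "q * monom 1 d = P"
      using infinite_UNIV_alg_closed by (intro poly_eqI_infinite[of "UNIV - {0}"]) auto
    then have eq: "poly (pderiv (q * monom 1 d)) 1 = poly (pderiv P) 1" "poly (q * monom 1 d) 1 = poly P 1" by auto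
    have "poly (pderiv P) 1 = (\<Sum>k\<le>N. of_nat (k + d') * l (c k))"
      by (simp add: P_def higher_pderiv_sum[where n = 1, simplified] pderiv_monom poly_sum poly_monom)
    moreover have lv': "poly q 1 = (\<Sum>k\<le>N. l (c k))" using eq(2) by (simp add: P_def poly_sum poly_monom)
    ultimately have calculation_deriv: "poly (pderiv q) 1 + of_nat d * poly q 1 = (\<Sum>k\<le>N. of_nat k * l (c k)) + of_nat d' * poly q 1"
      using eq(1) by (simp add: pderiv_mult pderiv_monom poly_monom algebra_simps sum.distrib sum_distrib_left)
    have "l (T (int i) (int i) v) = (\<Sum>k\<le>N. of_nat k * l (c k)) - of_nat d * (\<Sum>k\<le>N. l (c k))"
    proof -
      have "l (T (int i) (int i) v) = poly (pderiv q) 1 - of_nat d' * poly q 1"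
        using q(2) unfolding lv by (simp add: eq_diff_eq)
      moreover have "poly (pderiv q) 1 = (\<Sum>k\<le>N. of_nat k * l (c k)) + of_nat d' * poly q 1 - of_nat d * poly q 1"
        using calculation_deriv by (simp only: eq_diff_eq)
      ultimately show ?thesis by (simp add: lv')
    qed
    also have "\<dots> = (\<Sum>k\<le>N. of_int (int k - int d) * l (c k))"
      by (simp add: sum_distrib_left sum_subtractf[symmetric] algebra_simps)
    also have "\<dots> = (\<Sum>j=-int M..int M. of_int j * l (c' j))"
      by (rule sum_c'[symmetric]) (simp add: functional_0[OF l])
    also have "\<dots> = l (\<Sum>j=-int M..int M. scale (of_int j) (c' j))"
      by (simp add: functional_sum[OF l] functional_scale[OF l])
    finally show "l (T (int i) (int i) v) = l (\<Sum>j=-int M..int M. scale (of_int j) (c' j))" .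
  qed
  ultimately show ?thesis by blast
qed

end

lemma torus_elem_cong: "(\<And>i. i \<in> {1..n} \<Longrightarrow> t i = t' i) \<Longrightarrow> torus_elem n t = torus_elem n t'"
proof -
  assume eq: "\<And>i. i \<in> {1..n} \<Longrightarrow> t i = t' i"
  have "torus_entry t a = torus_entry t' a" if "a \<in> index_set n" for a
    using that eq[of "nat a"] eq[of "nat (- a)"] by (auto simp: torus_entry_def index_set_iff nat_le_iff Suc_le_eq)
  then show ?thesis by (auto simp: torus_elem_eq fun_eq_iff)
qed

context sp_module begin

lemma cochar_mult: "mat_mult I (cochar i s) (cochar i t) = cochar i (s * t)"
  unfolding cochar_def torus_mult by (rule torus_elem_cong) auto

text \<open>A functional that vanishes on \<open>U\<close> kills the whole Laurent polynomial and
  hence each coefficient, so the coefficients lie in \<open>U\<close>; multiplicativity of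
  \<open>cochar\<close> makes them eigenvectors.\<close>

lemma cochar_components:
  assumes U: "subspace U" and v: "\<And>s. s \<noteq> 0 \<Longrightarrow> \<rho> (cochar i s) v \<in> U" and i: "i \<in> {1..n}"
  shows "\<exists>M c. v = (\<Sum>j=-int M..int M. c j) \<and>
    (\<forall>j\<in>{-int M..int M}. c j \<in> U \<and> (\<forall>s. s \<noteq> 0 \<longrightarrow> \<rho> (cochar i s) (c j) = scale (s powi j) (c j)))"
proof -
  obtain M c where c: "\<And>s. s \<noteq> 0 \<Longrightarrow> \<rho> (cochar i s) v = (\<Sum>j=-int M..int M. scale (s powi j) (c j))"
    using cochar_expansion[OF i, of v] by blast
  let ?F = "{-int M..int M}"
  have "cochar i 1 = mat_one I"
    by (auto simp: cochar_def torus_elem_eq torus_entry_def mat_one_def fun_eq_iff)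
  then have "v = (\<Sum>j\<in>?F. c j)" using c[of 1] by (simp add: rho_one)
  moreover have "c j \<in> U" if j: "j \<in> ?F" for j
  proof (rule ccontr)
    assume nj: "c j \<notin> U"
    then obtain l where l: "functional l" "\<forall>u\<in>U. l u = 0" "l (c j) = 1" using separating_functional[OF U] by blast
    have "scale (l (c j)) (c j) = 0"
    proof (rule powi_independent[of ?F "\<lambda>i. scale (l (c i)) (c j)" j])
      fix s :: 'k assume s: "s \<noteq> 0"
      have "(\<Sum>i\<in>?F. scale (s powi i) (scale (l (c i)) (c j))) = scale (l (\<Sum>i\<in>?F. scale (s powi i) (c i))) (c j)"
        by (simp add: functional_sum[OF l(1)] functional_scale[OF l(1)] scale_sum_left)
      also have "\<dots> = 0" using c[OF s] v[OF s] l(2) by simp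
      finally show "(\<Sum>i\<in>?F. scale (s powi i) (scale (l (c i)) (c j))) = 0" .
    qed (use j in auto)
    then show False using l(3) nj subspace_0[OF U] by simp
  qed
  moreover have "\<rho> (cochar i t) (c j) = scale (t powi j) (c j)" if j: "j \<in> ?F" and t: "t \<noteq> 0" for j t
  proof -
    have lt: "lin (\<rho> (cochar i t))" by (rule rho_lin[OF cochar_in_Sp[OF t]])
    have "\<rho> (cochar i t) (c j) - scale (t powi j) (c j) = 0"
    proof (rule powi_independent[of ?F "\<lambda>j. \<rho> (cochar i t) (c j) - scale (t powi j) (c j)" j])
      fix s :: 'k assume s: "s \<noteq> 0"
      have "(\<Sum>j\<in>?F. scale (s powi j) (\<rho> (cochar i t) (c j))) = \<rho> (cochar i t) (\<rho> (cochar i s) v)"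
        unfolding c[OF s] by (simp add: lin_sum[OF lt] lin_scale[OF lt])
      also have "\<dots> = \<rho> (cochar i (t * s)) v"
        using rho_mult[OF cochar_in_Sp[OF t, of i] cochar_in_Sp[OF s, of i], of v] by (simp add: cochar_mult)
      also have "\<dots> = (\<Sum>j\<in>?F. scale (s powi j) (scale (t powi j) (c j)))"
        using s t by (simp add: c power_int_mult_distrib mult.commute)
      finally show "(\<Sum>j\<in>?F. scale (s powi j) (\<rho> (cochar i t) (c j) - scale (t powi j) (c j))) = 0"
        by (simp add: scale_right_diff_distrib sum_subtractf)
    qed (use j in auto)
    then show ?thesis by simp
  qed
  ultimately show ?thesis by blast
qed

lemma weight_cochar:
  assumes "weight \<nu> v" "i \<in> {1..n}" "s \<noteq> 0"
  shows "\<rho> (cochar i s) v = scale (s powi \<nu> i) v"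
proof -
  have "(\<Prod>j=1..n. ((\<lambda>_. 1)(i := s)) j powi \<nu> j) = (\<Prod>j=1..n. if j = i then s powi \<nu> i else 1)"
    by (rule prod.cong) auto
  then have "(\<Prod>j=1..n. ((\<lambda>_. 1)(i := s)) j powi \<nu> j) = s powi \<nu> i" using assms(2) by simp
  moreover have "\<rho> (torus_elem n ((\<lambda>_. 1)(i := s))) v = scale (\<Prod>j=1..n. ((\<lambda>_. 1)(i := s)) j powi \<nu> j) v"
    using assms(1)[unfolded weight_vector_def, rule_format, of "(\<lambda>_. 1)(i := s)"] assms(3) by auto
  ultimately show ?thesis by (simp only: cochar_def)
qed

text \<open>The integer \<open>\<nu> i\<close> enters only through its image in the field: the Lie
  algebra sees a torus weight modulo the characteristic.\<close>

lemma weight_T_diag_pos: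
  assumes v: "weight \<nu> v" and i: "i \<in> {1..n}"
  shows "T (int i) (int i) v = scale (of_int (\<nu> i)) v"
proof -
  obtain M c where c: "\<And>s. s \<noteq> 0 \<Longrightarrow> \<rho> (cochar i s) v = (\<Sum>j=-int M..int M. scale (s powi j) (c j))"
    "T (int i) (int i) v = (\<Sum>j=-int M..int M. scale (of_int j) (c j))"
    using cochar_expansion[OF i, of v] by blast
  \<comment> \<open>Large enough to cover both the expansion and the exponent
    \<open>\<nu> i\<close>, so that the two Laurent polynomials can be compared over one
    range.\<close>
  define K where "K = int M + \<bar>\<nu> i\<bar>"
  define c' where "c' j = (if \<bar>j\<bar> \<le> int M then c j else 0)" for j
  have ext: "(\<Sum>j=-int M..int M. scale (f j) (c j)) = (\<Sum>j=-K..K. scale (f j) (c' j))" for f :: "int \<Rightarrow> 'k"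
    by (rule sum.mono_neutral_cong_left) (auto simp: K_def c'_def)
  have delta: "(\<Sum>j=-K..K. scale (f j) (if j = \<nu> i then v else 0)) = scale (f (\<nu> i)) v" for f :: "int \<Rightarrow> 'k"
  proof -
    have "(\<Sum>j=-K..K. scale (f j) (if j = \<nu> i then v else 0)) = (\<Sum>j=-K..K. if j = \<nu> i then scale (f j) v else 0)"
      by (rule sum.cong) auto
    moreover have "\<nu> i \<in> {-K..K}" by (auto simp: K_def)
    ultimately show ?thesis by (simp del: atLeastAtMost_iff)
  qed
  have "c' j = (if j = \<nu> i then v else 0)" if j: "j \<in> {-K..K}" for j
  proof -
    have "c' j - (if j = \<nu> i then v else 0) = 0"
    proof (rule powi_independent[of "{-K..K}" "\<lambda>j. c' j - (if j = \<nu> i then v else 0)" j])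
      fix s :: 'k assume s: "s \<noteq> 0"
      show "(\<Sum>j=-K..K. scale (s powi j) (c' j - (if j = \<nu> i then v else 0))) = 0"
        using c(1)[OF s] weight_cochar[OF v i s] ext[of "\<lambda>j. s powi j"] delta[of "\<lambda>j. s powi j"]
        by (simp add: scale_right_diff_distrib sum_subtractf)
    qed (use j in auto)
    then show ?thesis by simp
  qed
  then have "T (int i) (int i) v = (\<Sum>j=-K..K. scale (of_int j) (if j = \<nu> i then v else 0))"
    unfolding c(2) ext[of of_int] by (intro sum.cong) auto
  then show ?thesis using delta[of of_int] by simp
qed

lemma weight_T_diag:
  assumes v: "weight \<nu> v" and a: "a \<in> I"
  shows "\<exists>c. T a a v = scale c v"
proof (cases "a > 0")
  case True
  then have "nat a \<in> {1..n}" "int (nat a) = a" using a by (auto simp: index_set_iff)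
  then show ?thesis using weight_T_diag_pos[OF v, of "nat a"] by metis
next
  case False
  then have "nat (- a) \<in> {1..n}" "int (nat (- a)) = - a" using a by (auto simp: index_set_iff)
  then have "T (- a) (- a) v = scale (of_int (\<nu> (nat (- a)))) v"
    using weight_T_diag_pos[OF v, of "nat (- a)"] by metis
  then have "T a a v = scale (- (theta a a * of_int (\<nu> (nat (- a))))) v"
    using T_sym[OF a a, of v] by simp
  then show ?thesis by blast
qed

definition torus_stable :: "'v set \<Rightarrow> bool" where
  "torus_stable U \<longleftrightarrow> subspace U \<and> (\<forall>t. nonvanishing t \<longrightarrow> (\<forall>u\<in>U. \<rho> (torus_elem n t) u \<in> U))"

lemma submodule_torus_stable: "submodule W \<Longrightarrow> torus_stable W"
  by (auto simp: Sp_submodule_def torus_stable_def nonvanishing_torus)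

lemma weight_if_cochar_weight:
  assumes v: "\<And>i s. i \<in> {1..n} \<Longrightarrow> s \<noteq> 0 \<Longrightarrow> \<rho> (cochar i s) v = scale (s powi \<nu> i) v"
  shows "weight \<nu> v"
  unfolding weight_vector_def
proof (intro allI impI)
  fix t assume t: "nonvanishing t"
  let ?t = "\<lambda>m k. if k \<le> m then t k else 1"
  have nv: "nonvanishing (?t m)" for m using t by auto
  have "m \<le> n \<Longrightarrow> \<rho> (torus_elem n (?t m)) v = scale (\<Prod>i=1..m. t i powi \<nu> i) v" for m
  proof (induction m)
    case 0
    have "torus_elem n (?t 0) = mat_one I"
      by (auto simp: torus_elem_eq torus_entry_def mat_one_def fun_eq_iff index_set_iff)
    then show ?case by (simp add: rho_one)
  next
    case (Suc m)
    have tn: "t (Suc m) \<noteq> 0" using t Suc.prems by auto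
    have "torus_elem n (?t (Suc m)) = mat_mult I (cochar (Suc m) (t (Suc m))) (torus_elem n (?t m))"
      unfolding cochar_def torus_mult by (rule torus_elem_cong) (auto simp: le_Suc_eq)
    then have "\<rho> (torus_elem n (?t (Suc m))) v = \<rho> (cochar (Suc m) (t (Suc m))) (\<rho> (torus_elem n (?t m)) v)"
      using rho_mult[OF cochar_in_Sp[OF tn] nonvanishing_torus[OF nv]] by simp
    also have "\<dots> = scale (\<Prod>i=1..Suc m. t i powi \<nu> i) v"
      using Suc tn v[of "Suc m" "t (Suc m)"] by (simp add: lin_scale[OF rho_lin[OF cochar_in_Sp]] mult.commute)
    finally show ?case .
  qed
  from this[of n] show "\<rho> (torus_elem n t) v = scale (\<Prod>i=1..n. t i powi \<nu> i) v"
    using torus_elem_cong[of n t "?t n"] by simp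
qed

text \<open>The one-parameter tori are diagonalised one after the other; a joint eigenspace of the
  earlier ones is stable under the next because the torus is commutative.\<close>

lemma torus_stable_span:
  assumes U: "torus_stable U"
  shows "U \<subseteq> span {v \<in> U. \<exists>\<nu>. weight \<nu> v}"
proof -
  let ?pw = "\<lambda>m \<nu> v. \<forall>i\<in>{1..m}. \<forall>s. s \<noteq> 0 \<longrightarrow> \<rho> (cochar i s) v = scale (s powi \<nu> i) v"
  let ?S = "\<lambda>m. {v \<in> U. \<exists>\<nu>. ?pw m \<nu> v}"
  have "m \<le> n \<Longrightarrow> U \<subseteq> span (?S m)" for m
  proof (induction m)
    case 0
    then show ?case using span_superset by auto
  next
    case (Suc m)
    have "?S m \<subseteq> span (?S (Suc m))"
    proof
      fix v assume "v \<in> ?S m"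
      then obtain \<nu> where v: "v \<in> U" "?pw m \<nu> v" by blast
      let ?U' = "{w \<in> U. ?pw m \<nu> w}"
      have lin: "lin (\<rho> (cochar i s))" if "s \<noteq> 0" for i s using rho_lin[OF cochar_in_Sp[OF that]] .
      have "subspace ?U'"
        using U lin by (auto simp: torus_stable_def subspace_def lin_0 lin_add lin_scale scale_right_distrib scale_left_commute)
      moreover have "\<rho> (cochar (Suc m) s) v \<in> ?U'" if s: "s \<noteq> 0" for s
      proof -
        have "\<rho> (cochar i r) (\<rho> (cochar (Suc m) s) v) = \<rho> (cochar (Suc m) s) (\<rho> (cochar i r) v)" if "r \<noteq> 0" for i r
          using rho_mult[OF cochar_in_Sp[OF that] cochar_in_Sp[OF s], symmetric]
            rho_mult[OF cochar_in_Sp[OF s] cochar_in_Sp[OF that], symmetric]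
          unfolding cochar_def torus_mult by (simp add: mult.commute)
        moreover have "\<rho> (cochar (Suc m) s) v \<in> U"
          using U v(1) s unfolding torus_stable_def cochar_def by (auto)
        ultimately show ?thesis using v(2) s by (auto simp: lin_scale[OF lin])
      qed
      ultimately obtain M c where c: "v = (\<Sum>j=-int M..int M. c j)"
        "\<forall>j\<in>{-int M..int M}. c j \<in> ?U' \<and> (\<forall>s. s \<noteq> 0 \<longrightarrow> \<rho> (cochar (Suc m) s) (c j) = scale (s powi j) (c j))"
        using cochar_components[of ?U' "Suc m" v] Suc.prems by (metis (no_types, lifting) Suc_leD atLeastAtMost_iff le_add1 plus_1_eq_Suc)
      have "c j \<in> ?S (Suc m)" if "j \<in> {-int M..int M}" for j
      proof -
        have "?pw (Suc m) (\<nu>(Suc m := j)) (c j)" using c(2)[rule_format, OF that]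
          by (auto simp: le_Suc_eq)
        then show ?thesis using c(2)[rule_format, OF that] by blast
      qed
      then show "v \<in> span (?S (Suc m))" unfolding c(1) by (intro span_sum span_base)
    qed
    then have "span (?S m) \<subseteq> span (?S (Suc m))" by (simp add: span_minimal)
    then show ?case using Suc by auto
  qed
  from this[of n] have "U \<subseteq> span (?S n)" by simp
  also have "\<dots> \<subseteq> span {v \<in> U. \<exists>\<nu>. weight \<nu> v}"
    by (rule span_mono) (use weight_if_cochar_weight in blast)
  finally show ?thesis .
qed

lemma torus_stable_weight_vector:
  assumes "torus_stable U" "U \<noteq> {0}"
  shows "\<exists>\<nu>. \<exists>v\<in>U. v \<noteq> 0 \<and> weight \<nu> v"
proof (rule ccontr)
  assume "\<not> ?thesis"
  then have "{v \<in> U. \<exists>\<nu>. weight \<nu> v} \<subseteq> {0}" by blast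
  then have "U \<subseteq> span {0}" using torus_stable_span[OF assms(1)] span_mono by blast
  then have "U \<subseteq> {0}" by simp
  then show False using assms subspace_0 by (auto simp: torus_stable_def)
qed

text \<open>Off the diagonal \<open>T a b v\<close> is the linear coefficient of the root subgroup
  action. On the diagonal it is a scalar on weight vectors, and these span.\<close>

lemma T_in_submodule:
  assumes W: "submodule W" and v: "v \<in> W" and ab: "a \<in> I" "b \<in> I"
  shows "T a b v \<in> W"
proof (cases "a = b")
  case False
  then show ?thesis using root_coeff_in_submodule[OF W v ab False, of "Suc 0"] root_coeff_1[OF ab False] by simp
next
  case True
  have sub: "subspace W" using W by (simp add: Sp_submodule_def)
  have "v \<in> span {v \<in> W. \<exists>\<nu>. weight \<nu> v}" using torus_stable_span[OF submodule_torus_stable[OF W]] v by blast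
  then show ?thesis
  proof (induction rule: span_induct_alt)
    case base
    then show ?case using lin_0[OF T_lin[OF ab]] subspace_0[OF sub] by simp
  next
    case (step c x y)
    then obtain c' where "T a b x = scale c' x" using weight_T_diag ab True by blast
    then show ?case using step sub by (simp add: lin_add[OF T_lin[OF ab]] lin_scale[OF T_lin[OF ab]] subspace_add subspace_scale)
  qed
qed

subsection \<open>Weyl group symmetry of the weights\<close>

lemma weight_monomial:
  assumes \<sigma>: "\<And>i. i \<in> I \<Longrightarrow> \<sigma> i \<in> I" "\<And>i. i \<in> I \<Longrightarrow> \<sigma> (- i) = - \<sigma> i"
    and g: "monomial_mat n \<sigma> c \<in> carrier (Sp n)"
    and v: "weight \<nu> v"
    and \<nu>': "\<And>t. nonvanishing t \<Longrightarrow> (\<Prod>i=1..n. t i powi \<nu>' i) = (\<Prod>i=1..n. torus_entry t (\<sigma> (int i)) powi \<nu> i)"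
  shows "weight \<nu>' (\<rho> (monomial_mat n \<sigma> c) v)"
  unfolding weight_vector_def
proof (intro allI impI)
  fix t assume t: "nonvanishing t"
  let ?t = "\<lambda>i. torus_entry t (\<sigma> (int i))"
  have nv: "nonvanishing ?t" using t \<sigma>(1) torus_entry_nonzero[of n t] by (auto simp: index_set_iff)
  have entry: "torus_entry t (\<sigma> i) = torus_entry ?t i" if "i \<in> I" for i
  proof (cases "i > 0")
    case True then show ?thesis by (simp add: torus_entry_def)
  next
    case False
    have "torus_entry t (\<sigma> i) = torus_entry t (- \<sigma> (- i))" using \<sigma>(2)[of "- i"] that by simp
    also have "\<dots> = inverse (torus_entry t (\<sigma> (- i)))" using torus_entry_uminus[of "\<sigma> (- i)" n t] \<sigma>(1) that by simp
    finally show ?thesis using False by (simp add: torus_entry_def[of ?t])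
  qed
  have "\<rho> (torus_elem n t) (\<rho> (monomial_mat n \<sigma> c) v) = \<rho> (monomial_mat n \<sigma> c) (\<rho> (torus_elem n ?t) v)"
    using rho_mult[OF nonvanishing_torus[OF t] g, of v] rho_mult[OF g nonvanishing_torus[OF nv], of v]
      torus_monomial[of n \<sigma> t ?t c, OF \<sigma>(1) entry] by simp
  also have "\<dots> = scale (\<Prod>i=1..n. ?t i powi \<nu> i) (\<rho> (monomial_mat n \<sigma> c) v)"
    using v nv by (simp add: weight_vector_def lin_scale[OF rho_lin[OF g]])
  finally show "\<rho> (torus_elem n t) (\<rho> (monomial_mat n \<sigma> c) v) = scale (\<Prod>i=1..n. t i powi \<nu>' i) (\<rho> (monomial_mat n \<sigma> c) v)"
    unfolding \<nu>'[OF t] .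
qed

lemma is_weight_monomial:
  assumes W: "submodule W" and \<nu>: "is_weight n scale \<rho> W \<nu>"
    and \<sigma>: "\<And>i. i \<in> I \<Longrightarrow> \<sigma> i \<in> I" "\<And>i. i \<in> I \<Longrightarrow> \<sigma> (- i) = - \<sigma> i" "inj_on \<sigma> I"
    and c: "\<And>i. i \<in> I \<Longrightarrow> c i * c (- i) * of_int (sgn (\<sigma> i)) = (of_int (sgn i) :: 'k)"
    and \<nu>': "\<And>t. nonvanishing t \<Longrightarrow> (\<Prod>i=1..n. t i powi \<nu>' i) = (\<Prod>i=1..n. torus_entry t (\<sigma> (int i)) powi \<nu> i)"
  shows "is_weight n scale \<rho> W \<nu>'"
proof -
  have g: "monomial_mat n \<sigma> c \<in> carrier (Sp n)" by (rule monomial_in_Sp[OF \<sigma>(1,3,2) c])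
  obtain v where v: "v \<in> W" "v \<noteq> 0" "weight \<nu> v" using \<nu> by (auto simp: is_weight_def)
  have "weight \<nu>' (\<rho> (monomial_mat n \<sigma> c) v)" by (rule weight_monomial[OF \<sigma>(1,2) g v(3) \<nu>'])
  moreover have "\<rho> (monomial_mat n \<sigma> c) v \<in> W" using W v(1) g by (auto simp: Sp_submodule_def)
  moreover have "\<rho> (monomial_mat n \<sigma> c) v \<noteq> 0" using rho_eq_0[OF g] v(2) by blast
  ultimately show ?thesis unfolding is_weight_def by blast
qed

lemma is_weight_swap:
  assumes W: "submodule W" and \<nu>: "is_weight n scale \<rho> W \<nu>" and ab: "a \<in> {1..n}" "b \<in> {1..n}"
  shows "is_weight n scale \<rho> W (\<lambda>i. \<nu> (if i = a then b else if i = b then a else i))"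
proof (rule is_weight_monomial[OF W \<nu>])
  let ?\<tau> = "\<lambda>i. if i = a then b else if i = b then a else i"
  let ?\<sigma> = "\<lambda>i. sgn i * int (?\<tau> (nat \<bar>i\<bar>))"
  show "?\<sigma> i \<in> I" if "i \<in> I" for i using that ab by (auto simp: index_set_iff sgn_if)
  show "?\<sigma> (- i) = - ?\<sigma> i" if "i \<in> I" for i by (simp add: sgn_if)
  show "inj_on ?\<sigma> I" using ab by (intro inj_onI) (auto simp: index_set_iff sgn_if split: if_splits)
  show "1 * 1 * of_int (sgn (?\<sigma> i)) = (of_int (sgn i) :: 'k)" if "i \<in> I" for i
    using that ab by (auto simp: index_set_iff sgn_if)
  show "(\<Prod>i=1..n. t i powi \<nu> (?\<tau> i)) = (\<Prod>i=1..n. torus_entry t (?\<sigma> (int i)) powi \<nu> i)" for t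
  proof -
    have "(\<Prod>i=1..n. t i powi \<nu> (?\<tau> i)) = (\<Prod>i=1..n. t (?\<tau> i) powi \<nu> i)"
      by (rule prod.reindex_bij_witness[of _ ?\<tau> ?\<tau>]) (use ab in auto)
    also have "\<dots> = (\<Prod>i=1..n. torus_entry t (?\<sigma> (int i)) powi \<nu> i)"
      by (rule prod.cong) (use ab in \<open>auto simp: torus_entry_def\<close>)
    finally show ?thesis .
  qed
qed

lemma is_weight_flip:
  assumes W: "submodule W" and \<nu>: "is_weight n scale \<rho> W \<nu>" and a: "a \<in> {1..n}"
  shows "is_weight n scale \<rho> W (\<nu>(a := - \<nu> a))"
proof (rule is_weight_monomial[OF W \<nu>])
  let ?\<sigma> = "\<lambda>i. if \<bar>i\<bar> = int a then - i else i"
  \<comment> \<open>Exchanging \<open>a\<close> and \<open>- a\<close> alone would change the sign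
    of the form on this pair; one sign repairs this.\<close>
  let ?c = "\<lambda>i. if i = - int a then - 1 else (1::'k)"
  show "?\<sigma> i \<in> I" if "i \<in> I" for i using that by auto
  show "?\<sigma> (- i) = - ?\<sigma> i" if "i \<in> I" for i by simp
  show "inj_on ?\<sigma> I" by (rule inj_onI) (auto split: if_splits)
  show "?c i * ?c (- i) * of_int (sgn (?\<sigma> i)) = (of_int (sgn i) :: 'k)" if "i \<in> I" for i
    using that a by (auto simp: index_set_iff sgn_if)
  show "(\<Prod>i=1..n. t i powi (\<nu>(a := - \<nu> a)) i) = (\<Prod>i=1..n. torus_entry t (?\<sigma> (int i)) powi \<nu> i)" for t
    by (rule prod.cong) (use a in \<open>auto simp: torus_entry_def power_int_inverse power_int_minus\<close>)
qed

end

section \<open>Positive roots and the alcove condition\<close>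

text \<open>Not the height in terms of simple roots, but the functional with value
  \<open>- a\<close> on \<open>index_weight a\<close>. It is positive on positive roots, and
  \<open>F_mat a b\<close> raises it by \<open>b - a\<close>, which makes it a numerical substitute
  for the partial order.\<close>

definition height :: "nat \<Rightarrow> (nat \<Rightarrow> int) \<Rightarrow> int" where
  "height n \<nu> = (\<Sum>i=1..n. - int i * \<nu> i)"

lemma sum_eps: "(\<Sum>i=1..n. f i * eps j i) = (if j \<in> {1..n} then f j else (0::int))"
proof -
  have "(\<Sum>i=1..n. f i * eps j i) = (\<Sum>i=1..n. if i = j then f i else 0)"
    by (rule sum.cong) (auto simp: eps_def)
  then show ?thesis by simp
qed

lemma positive_root_cases:
  assumes "\<alpha> \<in> positive_roots n"
  obtains (minus) i j where "1 \<le> i" "i < j" "j \<le> n" "\<alpha> = (\<lambda>k. eps i k - eps j k)"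
    | (plus) i j where "1 \<le> i" "i < j" "j \<le> n" "\<alpha> = (\<lambda>k. - eps i k - eps j k)"
    | (long) i where "1 \<le> i" "i \<le> n" "\<alpha> = (\<lambda>k. - 2 * eps i k)"
  using assms by (auto simp: positive_roots_def)

lemma sum_positive_root:
  "1 \<le> i \<Longrightarrow> i < j \<Longrightarrow> j \<le> n \<Longrightarrow> (\<Sum>k=1..n. f k * (eps i k - eps j k)) = f i - f j"
  "1 \<le> i \<Longrightarrow> i < j \<Longrightarrow> j \<le> n \<Longrightarrow> (\<Sum>k=1..n. f k * (- eps i k - eps j k)) = - f i - f j"
  "1 \<le> i \<Longrightarrow> i \<le> n \<Longrightarrow> (\<Sum>k=1..n. f k * (- 2 * eps i k)) = - 2 * f i"
proof -
  show "1 \<le> i \<Longrightarrow> i < j \<Longrightarrow> j \<le> n \<Longrightarrow> (\<Sum>k=1..n. f k * (eps i k - eps j k)) = f i - f j"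
    by (simp only: right_diff_distrib sum_subtractf sum_eps) simp
  assume *: "1 \<le> i" "i < j" "j \<le> n"
  have "(\<Sum>k=1..n. f k * (- eps i k - eps j k)) = - (\<Sum>k=1..n. f k * eps i k) - (\<Sum>k=1..n. f k * eps j k)"
    by (simp add: algebra_simps sum.distrib sum_negf sum_subtractf)
  then show "(\<Sum>k=1..n. f k * (- eps i k - eps j k)) = - f i - f j" using * unfolding sum_eps by simp
next
  assume *: "1 \<le> i" "i \<le> n"
  have "(\<Sum>k=1..n. f k * (- 2 * eps i k)) = - 2 * (\<Sum>k=1..n. f k * eps i k)"
    by (simp add: sum_distrib_left algebra_simps)
  then show "(\<Sum>k=1..n. f k * (- 2 * eps i k)) = - 2 * f i" using * unfolding sum_eps by simp
qed

lemma finite_positive_roots: "finite (positive_roots n)"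
proof -
  have "positive_roots n \<subseteq>
     (\<lambda>(i,j). (\<lambda>k. eps i k - eps j k)) ` ({1..n} \<times> {1..n}) \<union>
     (\<lambda>(i,j). (\<lambda>k. - eps i k - eps j k)) ` ({1..n} \<times> {1..n}) \<union>
     (\<lambda>i. (\<lambda>k. - 2 * eps i k)) ` {1..n}"
  proof
    fix \<alpha> assume "\<alpha> \<in> positive_roots n"
    then show "\<alpha> \<in> (\<lambda>(i,j). (\<lambda>k. eps i k - eps j k)) ` ({1..n} \<times> {1..n}) \<union>
     (\<lambda>(i,j). (\<lambda>k. - eps i k - eps j k)) ` ({1..n} \<times> {1..n}) \<union>
     (\<lambda>i. (\<lambda>k. - 2 * eps i k)) ` {1..n}"
    proof (cases rule: positive_root_cases)
      case (minus i j) then show ?thesis by (intro UnI1 image_eqI[of _ _ "(i, j)"]) auto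
    next
      case (plus i j) then show ?thesis by (intro UnI1 UnI2 image_eqI[of _ _ "(i, j)"]) auto
    next
      case (long i) then show ?thesis by (intro UnI2 image_eqI[of _ _ i]) auto
    qed
  qed
  then show ?thesis by (rule finite_subset) auto
qed

lemma height_positive_root:
  assumes "\<alpha> \<in> positive_roots n"
  shows "height n \<alpha> > 0"
  using assms
proof (cases rule: positive_root_cases)
  case (minus i j)
  show ?thesis unfolding height_def minus(4) sum_positive_root(1)[OF minus(1-3)] using minus by simp
next
  case (plus i j)
  show ?thesis unfolding height_def plus(4) sum_positive_root(2)[OF plus(1-3)] using plus by simp
next
  case (long i)
  show ?thesis unfolding height_def long(3) sum_positive_root(3)[OF long(1-2)] using long by simp
qed

lemma positive_root_plusI: "1 \<le> i \<Longrightarrow> i < j \<Longrightarrow> j \<le> n \<Longrightarrow> (\<lambda>k. - eps i k - eps j k) \<in> positive_roots n"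
  and positive_root_longI: "1 \<le> i \<Longrightarrow> i \<le> n \<Longrightarrow> (\<lambda>k. - 2 * eps i k) \<in> positive_roots n"
  unfolding positive_roots_def by blast+

lemma weight_le_functional:
  assumes "weight_le n \<nu> \<kappa>" and "\<And>\<alpha>. \<alpha> \<in> positive_roots n \<Longrightarrow> (\<Sum>i=1..n. f i * \<alpha> i) \<ge> 0"
  shows "(\<Sum>i=1..n. f i * \<nu> i) \<le> (\<Sum>i=1..n. f i * \<kappa> i)"
proof -
  obtain c where c: "\<And>i. i \<in> {1..n} \<Longrightarrow> \<kappa> i - \<nu> i = (\<Sum>\<alpha>\<in>positive_roots n. int (c \<alpha>) * \<alpha> i)"
    using assms(1) by (auto simp: weight_le_def)
  have "(\<Sum>i=1..n. f i * \<kappa> i) - (\<Sum>i=1..n. f i * \<nu> i) = (\<Sum>i=1..n. f i * (\<kappa> i - \<nu> i))"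
    by (simp add: right_diff_distrib sum_subtractf)
  also have "\<dots> = (\<Sum>i=1..n. \<Sum>\<alpha>\<in>positive_roots n. f i * (int (c \<alpha>) * \<alpha> i))"
    by (rule sum.cong) (auto simp: c sum_distrib_left)
  also have "\<dots> = (\<Sum>\<alpha>\<in>positive_roots n. int (c \<alpha>) * (\<Sum>i=1..n. f i * \<alpha> i))"
    by (subst sum.swap) (simp add: sum_distrib_left mult_ac)
  also have "\<dots> \<ge> 0" using assms(2) by (intro sum_nonneg) auto
  finally show ?thesis by simp
qed

lemma weight_le_height: "weight_le n \<nu> \<kappa> \<Longrightarrow> height n \<nu> \<le> height n \<kappa>"
  unfolding height_def using height_positive_root[of _ n]
  by (intro weight_le_functional) (auto simp: height_def less_imp_le)

text \<open>Every positive root has positive height, so without a gain in height all coefficients of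
  the difference vanish.\<close>

lemma weight_le_height_eq:
  assumes "weight_le n \<nu> \<kappa>" "height n \<kappa> \<le> height n \<nu>" "i \<in> {1..n}"
  shows "\<nu> i = \<kappa> i"
proof -
  obtain c where c: "\<And>i. i \<in> {1..n} \<Longrightarrow> \<kappa> i - \<nu> i = (\<Sum>\<alpha>\<in>positive_roots n. int (c \<alpha>) * \<alpha> i)"
    using assms(1) by (auto simp: weight_le_def)
  have "height n \<kappa> - height n \<nu> = (\<Sum>i=1..n. - int i * (\<kappa> i - \<nu> i))"
    by (simp only: height_def right_diff_distrib sum_subtractf)
  also have "\<dots> = (\<Sum>i=1..n. \<Sum>\<alpha>\<in>positive_roots n. - int i * (int (c \<alpha>) * \<alpha> i))"
    by (rule sum.cong) (simp_all only: c sum_distrib_left)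
  also have "\<dots> = (\<Sum>\<alpha>\<in>positive_roots n. int (c \<alpha>) * height n \<alpha>)"
    by (subst sum.swap) (simp add: height_def sum_distrib_left mult_ac)
  finally have eq: "height n \<kappa> - height n \<nu> = (\<Sum>\<alpha>\<in>positive_roots n. int (c \<alpha>) * height n \<alpha>)" .
  have nn: "int (c \<alpha>) * height n \<alpha> \<ge> 0" if "\<alpha> \<in> positive_roots n" for \<alpha>
    using height_positive_root[OF that] by simp
  have "(\<Sum>\<alpha>\<in>positive_roots n. int (c \<alpha>) * height n \<alpha>) = 0"
    using eq assms(2) sum_nonneg[of "positive_roots n" "\<lambda>\<alpha>. int (c \<alpha>) * height n \<alpha>", OF nn] by linarith
  then have "\<forall>\<alpha>\<in>positive_roots n. int (c \<alpha>) * height n \<alpha> = 0"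
    using sum_nonneg_eq_0_iff[OF finite_positive_roots, of n "\<lambda>\<alpha>. int (c \<alpha>) * height n \<alpha>"] nn by blast
  then have "\<forall>\<alpha>\<in>positive_roots n. c \<alpha> = 0" using height_positive_root[of _ n] by fastforce
  then have "\<kappa> i - \<nu> i = 0" using c[OF assms(3)] by simp
  then show ?thesis by simp
qed

lemma index_weight_abs: "a \<noteq> 0 \<Longrightarrow> index_weight a (nat \<bar>a\<bar>) = sgn a"
  by (cases a "0 :: int" rule: linorder_cases) (auto simp: index_weight_def)

lemma index_weight_other: "nat \<bar>a\<bar> \<noteq> i \<Longrightarrow> index_weight a i = 0"
  by (auto simp: index_weight_def)

lemma height_index_weight: "a \<in> index_set n \<Longrightarrow> height n (index_weight a) = - a"
proof -
  assume a: "a \<in> index_set n"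
  have "height n (index_weight a) = (\<Sum>i=1..n. if i = nat \<bar>a\<bar> then - a else 0)"
    unfolding height_def by (rule sum.cong) (use a in \<open>auto simp: index_weight_def index_set_iff\<close>)
  also have "\<dots> = - a" using a by (auto simp: index_set_iff)
  finally show ?thesis .
qed

lemma height_add_mult: "height n (\<lambda>i. \<nu> i + c * \<nu>' i) = height n \<nu> + c * height n \<nu>'"
  by (simp add: height_def sum_distrib_left sum_subtractf sum.distrib algebra_simps sum_negf)

lemma height_root_weight:
  assumes "a \<in> index_set n" "b \<in> index_set n"
  shows "height n (root_weight a b) = b - a"
proof -
  have "root_weight a b = (\<lambda>i. index_weight a i + (- 1) * index_weight b i)"
    by (auto simp: root_weight_def)
  then show ?thesis unfolding height_add_mult using assms by (simp only: height_add_mult height_index_weight)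
qed

text \<open>Only three of the positive roots are needed to see that \<open>\<langle>\<rho>, \<alpha>\<^sub>0\<^sup>\<or>\<rangle> \<ge> 3\<close> for the highest
  short root \<open>\<alpha>\<^sub>0 = - \<epsilon>\<^sub>n\<^sub>-\<^sub>1 - \<epsilon>\<^sub>n\<close>.\<close>

lemma rho_weight_top: 
  assumes n: "n = Suc (Suc m)"
  shows "rho_weight n (Suc m) + rho_weight n n \<le> - 3"
proof -
  let ?f = "\<lambda>\<alpha>. \<alpha> (Suc m) + \<alpha> n :: int"
  let ?A = "{(\<lambda>k. - eps (Suc m) k - eps n k), (\<lambda>k. - 2 * eps (Suc m) k), (\<lambda>k. - 2 * eps n k)}"
  have sub: "?A \<subseteq> positive_roots n"
  proof -
    have "(\<lambda>k. - eps (Suc m) k - eps n k) \<in> positive_roots n"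
      using n by (intro positive_root_plusI) auto
    moreover have "(\<lambda>k. - 2 * eps (Suc m) k) \<in> positive_roots n" "(\<lambda>k. - 2 * eps n k) \<in> positive_roots n"
      using n by (auto intro!: positive_root_longI simp del: mult_minus_left)
    ultimately show ?thesis by blast
  qed
  have "?f \<alpha> \<le> 0" if "\<alpha> \<in> positive_roots n" for \<alpha>
    using that by (cases rule: positive_root_cases) (use n in \<open>auto simp: eps_def\<close>)
  then have "(\<Sum>\<alpha>\<in>positive_roots n - ?A. ?f \<alpha>) \<le> 0" by (intro sum_nonpos) auto
  moreover have "(\<Sum>\<alpha>\<in>?A. ?f \<alpha>) = - 6"
  proof -
    have "(\<lambda>k. - eps (Suc m) k - eps n k) \<noteq> (\<lambda>k. - 2 * eps (Suc m) k)"
      "(\<lambda>k. - eps (Suc m) k - eps n k) \<noteq> (\<lambda>k. - 2 * eps n k)"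
      "(\<lambda>k. - 2 * eps (Suc m) k) \<noteq> (\<lambda>k. - 2 * eps n k)"
      using n by (auto simp: eps_def fun_eq_iff)
    then show ?thesis using n by (simp add: eps_def)
  qed
  moreover have "(\<Sum>\<alpha>\<in>positive_roots n. ?f \<alpha>) = (\<Sum>\<alpha>\<in>positive_roots n - ?A. ?f \<alpha>) + (\<Sum>\<alpha>\<in>?A. ?f \<alpha>)"
    by (rule sum.subset_diff[OF sub finite_positive_roots])
  ultimately have "(\<Sum>\<alpha>\<in>positive_roots n. ?f \<alpha>) \<le> - 6" by linarith
  then have "of_int (\<Sum>\<alpha>\<in>positive_roots n. ?f \<alpha>) \<le> (of_int (- 6) :: rat)" by (simp only: of_int_le_iff)
  then show ?thesis by (simp add: rho_weight_def sum.distrib)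
qed

text \<open>The alcove inequality for the highest short root. Of the constant 4, three come from
  \<open>rho_weight_top\<close> and one from the strictness of an inequality between
  integers.\<close>

lemma alcove_bound:
  assumes n: "n = Suc (Suc m)" and \<kappa>: "\<kappa> \<in> closed_alcove n p" and p: "p > 0"
  shows "- (\<kappa> (Suc m) + \<kappa> n) \<le> int p - 4"
proof -
  let ?\<alpha> = "\<lambda>k. - eps (Suc m) k - eps n k"
  let ?x = "\<lambda>i. of_int (\<kappa> i) + rho_weight n i"
  have "?\<alpha> \<in> positive_roots n"
    using n by (intro positive_root_plusI) auto
  then have lt: "coroot_pairing n ?x ?\<alpha> < of_nat p" using \<kappa> p by (auto simp: closed_alcove_def)
  have s1: "(\<Sum>i=1..n. ?x i * of_int (?\<alpha> i)) = - ?x (Suc m) - ?x n"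
  proof -
    have "(\<Sum>i=1..n. ?x i * of_int (?\<alpha> i)) = (\<Sum>i=1..n. (if i = Suc m then - ?x i else 0) + (if i = n then - ?x i else 0))"
      by (rule sum.cong) (use n in \<open>auto simp: eps_def\<close>)
    then show ?thesis using n by (simp add: sum.distrib)
  qed
  have s2: "(\<Sum>i=1..n. (of_int (?\<alpha> i))\<^sup>2) = (2 :: rat)"
  proof -
    have "(\<Sum>i=1..n. (of_int (?\<alpha> i))\<^sup>2) = (\<Sum>i=1..n. (if i = Suc m then 1 else 0) + (if i = n then 1 else (0::rat)))"
      by (rule sum.cong) (use n in \<open>auto simp: eps_def\<close>)
    then show ?thesis using n by (simp add: sum.distrib)
  qed
  have "- ?x (Suc m) - ?x n < of_nat p" using lt unfolding coroot_pairing_def s1 s2 by simp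
  then have "of_int (- (\<kappa> (Suc m) + \<kappa> n)) + 3 < (of_nat p :: rat)" using rho_weight_top[OF n] by simp
  then have "of_int (- (\<kappa> (Suc m) + \<kappa> n) + 3) < (of_int (int p) :: rat)" by simp
  then show ?thesis unfolding of_int_less_iff by simp
qed

section \<open>Modules in the fundamental alcove\<close>

locale alcove_module = sp_module scale n \<rho> T
  for scale :: "'k::alg_closed_field \<Rightarrow> 'v::ab_group_add \<Rightarrow> 'v" and n \<rho> T +
  fixes k :: nat and \<kappa> :: "nat \<Rightarrow> nat \<Rightarrow> int" and W :: "nat \<Rightarrow> 'v set"
  assumes simple: "\<And>j. j \<in> {1..k} \<Longrightarrow> is_simple_hw_module n scale \<rho> (\<kappa> j) (W j)"
    and decomposition: "\<And>v. \<exists>!w. w \<in> (\<Pi>\<^sub>E j\<in>{1..k}. W j) \<and> v = (\<Sum>j=1..k. w j)"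
    and alcove: "\<And>j. j \<in> {1..k} \<Longrightarrow> \<kappa> j \<in> dominant_weights n \<inter> closed_alcove n CHAR('k)"
    and first_zero: "\<And>j. j \<in> {1..k} \<Longrightarrow> \<kappa> j 1 = 0"
begin

lemma W_submodule: "j \<in> {1..k} \<Longrightarrow> submodule (W j)"
  using simple by (auto simp: is_simple_hw_module_def Sp_simple_submodule_def)

lemma W_subspace: "j \<in> {1..k} \<Longrightarrow> subspace (W j)"
  using W_submodule by (auto simp: Sp_submodule_def)

lemma W_weight_le: "j \<in> {1..k} \<Longrightarrow> is_weight n scale \<rho> (W j) \<nu> \<Longrightarrow> weight_le n \<nu> (\<kappa> j)"
  using simple by (auto simp: is_simple_hw_module_def)

lemma W_weight: "j \<in> {1..k} \<Longrightarrow> is_weight n scale \<rho> (W j) (\<kappa> j)"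
  using simple by (auto simp: is_simple_hw_module_def)

text \<open>Uniqueness of the decomposition makes an operator that preserves the summands act
  componentwise. With \<open>c = 0\<close> this transfers vanishing statements to the
  components.\<close>

lemma component_eigen:
  assumes A: "lin A" "\<And>j v. j \<in> {1..k} \<Longrightarrow> v \<in> W j \<Longrightarrow> A v \<in> W j"
    and w: "w \<in> (\<Pi>\<^sub>E j\<in>{1..k}. W j)" and eig: "A (\<Sum>j=1..k. w j) = scale c (\<Sum>j=1..k. w j)" and j: "j \<in> {1..k}"
  shows "A (w j) = scale c (w j)"
proof -
  let ?v = "A (\<Sum>j=1..k. w j)"
  let ?w1 = "\<lambda>j\<in>{1..k}. A (w j)" and ?w2 = "\<lambda>j\<in>{1..k}. scale c (w j)"
  have "?w1 \<in> (\<Pi>\<^sub>E j\<in>{1..k}. W j) \<and> ?v = (\<Sum>j=1..k. ?w1 j)"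
    using w A(2) by (auto simp: lin_sum[OF A(1)] PiE_mem)
  moreover have "?w2 \<in> (\<Pi>\<^sub>E j\<in>{1..k}. W j) \<and> ?v = (\<Sum>j=1..k. ?w2 j)"
    unfolding eig using w W_subspace by (auto simp: scale_sum_right subspace_scale PiE_mem)
  ultimately have "?w1 = ?w2" using decomposition[of ?v] by blast
  then have "?w1 j = ?w2 j" by simp
  then show ?thesis using j by simp
qed

lemma nonzero_component:
  assumes "v \<noteq> 0"
  obtains w j where "w \<in> (\<Pi>\<^sub>E j\<in>{1..k}. W j)" "v = (\<Sum>j=1..k. w j)" "j \<in> {1..k}" "w j \<noteq> 0" "w j \<in> W j"
proof -
  obtain w where w: "w \<in> (\<Pi>\<^sub>E j\<in>{1..k}. W j)" "v = (\<Sum>j=1..k. w j)" using decomposition[of v] by blast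
  then obtain j where "j \<in> {1..k}" "w j \<noteq> 0" using assms sum.not_neutral_contains_not_neutral by metis
  then show ?thesis using that w by (auto simp: PiE_mem)
qed

lemma weight_component:
  assumes w: "w \<in> (\<Pi>\<^sub>E j\<in>{1..k}. W j)" and v: "weight \<nu> (\<Sum>j=1..k. w j)" and j: "j \<in> {1..k}"
  shows "weight \<nu> (w j)"
  unfolding weight_vector_def
proof (intro allI impI)
  fix t assume t: "nonvanishing t"
  show "\<rho> (torus_elem n t) (w j) = scale (\<Prod>i = 1..n. t i powi \<nu> i) (w j)"
  proof (rule component_eigen[OF rho_lin[OF nonvanishing_torus[OF t]] _ w _ j])
    show "\<rho> (torus_elem n t) v \<in> W j" if "j \<in> {1..k}" "v \<in> W j" for j v
      using W_submodule[OF that(1)] that(2) nonvanishing_torus[OF t] by (auto simp: Sp_submodule_def)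
  qed (use v t in \<open>simp add: weight_vector_def\<close>)
qed

lemma weight_in_some_W:
  assumes "weight \<nu> v" "v \<noteq> 0"
  shows "\<exists>j\<in>{1..k}. is_weight n scale \<rho> (W j) \<nu>"
  using nonzero_component[OF assms(2)] weight_component assms(1) unfolding is_weight_def by metis

lemma kappa_nonpos: "j \<in> {1..k} \<Longrightarrow> i \<in> {1..n} \<Longrightarrow> \<kappa> j i \<le> 0"
proof -
  assume j: "j \<in> {1..k}"
  have "Suc i \<in> {1..n} \<Longrightarrow> \<kappa> j (Suc i) \<le> 0" for i
  proof (induction i)
    case 0 then show ?case using first_zero[OF j] by simp
  next
    case (Suc i)
    then have "\<kappa> j (Suc (Suc i)) \<le> \<kappa> j (Suc i)" using alcove[OF j] by (auto simp: dominant_weights_def)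
    then show ?case using Suc by auto
  qed
  from this[of "i - 1"] show "i \<in> {1..n} \<Longrightarrow> \<kappa> j i \<le> 0" by auto
qed

text \<open>Sign changes and transpositions make the two coordinates nonpositive and move them to
  the last two places. Minus the sum of the last two coordinates is nonnegative on positive roots,
  hence largest at the highest weight, where \<open>alcove_bound\<close> applies.\<close>

lemma weight_pair_bound:
  assumes j: "j \<in> {1..k}" and \<nu>: "is_weight n scale \<rho> (W j) \<nu>" and p: "CHAR('k) > 0"
    and il: "i \<in> {1..n}" "l \<in> {1..n}" "i \<noteq> l"
  shows "\<bar>\<nu> i\<bar> + \<bar>\<nu> l\<bar> \<le> int CHAR('k) - 4"
proof -
  obtain m where n: "n = Suc (Suc m)" using il by (cases n; cases "n - 1") auto
  note W = W_submodule[OF j]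
  define \<nu>0 where "\<nu>0 = (if \<nu> i > 0 then \<nu>(i := - \<nu> i) else \<nu>)"
  have 0: "is_weight n scale \<rho> (W j) \<nu>0" "\<nu>0 i = - \<bar>\<nu> i\<bar>" "\<nu>0 l = \<nu> l"
    using is_weight_flip[OF W \<nu> il(1)] \<nu> il by (auto simp: \<nu>0_def)
  define \<nu>1 where "\<nu>1 = (if \<nu>0 l > 0 then \<nu>0(l := - \<nu>0 l) else \<nu>0)"
  have 1: "is_weight n scale \<rho> (W j) \<nu>1" "\<nu>1 i = - \<bar>\<nu> i\<bar>" "\<nu>1 l = - \<bar>\<nu> l\<bar>"
    using is_weight_flip[OF W 0(1) il(2)] 0 il by (auto simp: \<nu>1_def)
  define \<nu>2 where "\<nu>2 = (\<lambda>x. \<nu>1 (if x = l then n else if x = n then l else x))"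
  define i' where "i' = (if i = n then l else i)"
  have 2: "is_weight n scale \<rho> (W j) \<nu>2" "\<nu>2 n = \<nu>1 l" "\<nu>2 i' = \<nu>1 i" "i' \<noteq> n" "i' \<in> {1..n}"
    using is_weight_swap[OF W 1(1) il(2), of n] il by (auto simp: \<nu>2_def i'_def)
  define \<nu>3 where "\<nu>3 = (\<lambda>x. \<nu>2 (if x = i' then Suc m else if x = Suc m then i' else x))"
  have 3: "is_weight n scale \<rho> (W j) \<nu>3" "\<nu>3 n = \<nu>1 l" "\<nu>3 (Suc m) = \<nu>1 i"
    using is_weight_swap[OF W 2(1) 2(5), of "Suc m"] 2 n by (auto simp: \<nu>3_def)
  let ?f = "\<lambda>x. if x = Suc m \<or> x = n then - 1 else (0::int)"
  have f: "(\<Sum>x=1..n. ?f x * g x) = - (g (Suc m) + g n)" for g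
  proof -
    have "(\<Sum>x=1..n. ?f x * g x) = (\<Sum>x=1..n. (if x = Suc m then - g x else 0) + (if x = n then - g x else 0))"
      by (rule sum.cong) (use n in auto)
    then show ?thesis using n by (simp add: sum.distrib)
  qed
  have "(\<Sum>x=1..n. ?f x * \<nu>3 x) \<le> (\<Sum>x=1..n. ?f x * \<kappa> j x)"
  proof (rule weight_le_functional[OF W_weight_le[OF j 3(1)]])
    fix \<alpha> assume "\<alpha> \<in> positive_roots n"
    then show "(\<Sum>x=1..n. ?f x * \<alpha> x) \<ge> 0"
      unfolding f by (cases rule: positive_root_cases) (use n in \<open>auto simp: eps_def\<close>)
  qed
  then have "\<bar>\<nu> i\<bar> + \<bar>\<nu> l\<bar> \<le> - (\<kappa> j (Suc m) + \<kappa> j n)" unfolding f using 1 3 by simp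
  also have "\<dots> \<le> int CHAR('k) - 4" using alcove_bound[OF n _ p, of "\<kappa> j"] alcove[OF j] by auto
  finally show ?thesis .
qed

lemma char_ge_3: "CHAR('k) > 0 \<Longrightarrow> CHAR('k) \<ge> 3"
proof -
  assume p: "CHAR('k) > 0"
  have "CHAR('k) \<noteq> 1" by simp
  moreover have "CHAR('k) \<noteq> 2"
  proof
    assume "CHAR('k) = 2"
    then have "of_nat 2 = (0::'k)" by (metis of_nat_CHAR)
    then show False using two_nonzero by simp
  qed
  ultimately show ?thesis using p by linarith
qed

lemma weight_bound:
  assumes j: "j \<in> {1..k}" and \<nu>: "is_weight n scale \<rho> (W j) \<nu>" and p: "CHAR('k) > 0" and i: "i \<in> {1..n}"
  shows "\<bar>\<nu> i\<bar> \<le> int CHAR('k) - 3"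
proof (cases "n = 1")
  case False
  then obtain l where "l \<in> {1..n}" "i \<noteq> l" using i n_pos that[of 1] that[of n] by (cases "i = 1") auto
  then show ?thesis using weight_pair_bound[OF j \<nu> p i] by fastforce
next
  \<comment> \<open>There is no second coordinate to pair with. Here \<open>first_zero\<close>
    forces every weight to vanish, and the bound holds because the characteristic is at least
    3.\<close>
  case True
  have *: "\<nu>' 1 \<ge> 0" if "is_weight n scale \<rho> (W j) \<nu>'" for \<nu>'
  proof -
    have "(\<Sum>x=1..n. - 1 * \<nu>' x) \<le> (\<Sum>x=1..n. - 1 * \<kappa> j x)"
    proof (rule weight_le_functional[OF W_weight_le[OF j that]])
      fix \<alpha> assume "\<alpha> \<in> positive_roots n"
      then show "(\<Sum>x=1..n. - 1 * \<alpha> x) \<ge> 0"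
        by (cases rule: positive_root_cases) (use True in \<open>auto simp: eps_def\<close>)
    qed
    then show ?thesis using True first_zero[OF j] by simp
  qed
  have "\<nu> 1 = 0" using *[OF \<nu>] *[OF is_weight_flip[OF W_submodule[OF j] \<nu>, of 1]] True by simp
  then show ?thesis using i True char_ge_3[OF p] by simp
qed

text \<open>Both ends of the string obey the weight bounds. A long root moves one coordinate by
  \<open>2 q\<close> between values of size at most \<open>CHAR('k) - 3\<close>. A short root moves
  two coordinates by \<open>q\<close> each, and the sum of two triangle inequalities is controlled
  by \<open>weight_pair_bound\<close> at both ends.\<close>

lemma root_string_short:
  assumes v: "weight \<nu> v" "v \<noteq> 0" and u: "weight (\<lambda>i. \<nu> i + int q * root_weight a b i) u" "u \<noteq> 0"
    and ab: "a \<in> I" "b \<in> I" "a \<noteq> b" and p: "CHAR('k) > 0"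
  shows "q < CHAR('k)"
proof -
  obtain j where j: "j \<in> {1..k}" "is_weight n scale \<rho> (W j) \<nu>" using weight_in_some_W[OF v] by blast
  obtain j' where j': "j' \<in> {1..k}" "is_weight n scale \<rho> (W j') (\<lambda>i. \<nu> i + int q * root_weight a b i)"
    using weight_in_some_W[OF u] by blast
  let ?i = "nat \<bar>a\<bar>" and ?l = "nat \<bar>b\<bar>"
  have il: "?i \<in> {1..n}" "?l \<in> {1..n}" using ab by (auto simp: index_set_iff)
  show ?thesis
  proof (cases "?i = ?l")
    case True
    then have "a = - b" using ab by auto
    then have "\<bar>root_weight a b ?i\<bar> = 2"
      using ab index_weight_abs[of b] index_weight_abs[of "- b"] by (auto simp: root_weight_def index_set_iff sgn_if)
    then have "\<bar>int q * root_weight a b ?i\<bar> = 2 * int q" by (simp add: abs_mult)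
    moreover have "\<bar>\<nu> ?i + int q * root_weight a b ?i\<bar> \<le> int CHAR('k) - 3" "\<bar>\<nu> ?i\<bar> \<le> int CHAR('k) - 3"
      using weight_bound[OF j p il(1)] weight_bound[OF j' p il(1)] by auto
    ultimately show ?thesis by linarith
  next
    case False
    then have "\<bar>root_weight a b ?i\<bar> = 1" "\<bar>root_weight a b ?l\<bar> = 1"
      using ab index_weight_abs[of a] index_weight_abs[of b] index_weight_other[OF False] index_weight_other[OF False[symmetric]]
      by (auto simp: root_weight_def index_set_iff sgn_if)
    then have q: "\<bar>int q * root_weight a b ?i\<bar> = int q" "\<bar>int q * root_weight a b ?l\<bar> = int q" by (simp_all add: abs_mult)
    have tri: "\<bar>y\<bar> \<le> \<bar>x + y\<bar> + \<bar>x\<bar>" for x y :: int by linarith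
    have "int q < int CHAR('k)"
      if "int q \<le> A + B" "int q \<le> C + D" "A + C \<le> int CHAR('k) - 4" "B + D \<le> int CHAR('k) - 4" for A B C D
      using that by linarith
    from this[OF tri[of "int q * root_weight a b ?i" "\<nu> ?i", unfolded q] tri[of "int q * root_weight a b ?l" "\<nu> ?l", unfolded q]
        weight_pair_bound[OF j' p il False] weight_pair_bound[OF j p il False]]
    show ?thesis by simp
  qed
qed

end

section \<open>Submodules generated by singular vectors\<close>

context alcove_module begin

inductive_set lowered :: "'v \<Rightarrow> 'v set" for w where
  base: "w \<in> lowered w"
| step: "u \<in> lowered w \<Longrightarrow> a \<in> I \<Longrightarrow> b \<in> I \<Longrightarrow> b < a \<Longrightarrow> T a b u \<in> lowered w"

lemma T_span_lowered_neg:
  assumes "u \<in> span (lowered w)" "a \<in> I" "b \<in> I" "b < a"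
  shows "T a b u \<in> span (lowered w)"
  using assms(1)
proof (induction rule: span_induct_alt)
  case base
  then show ?case using lin_0[OF T_lin[OF assms(2,3)]] by (simp add: span_zero)
next
  case (step c x y)
  then show ?case using lowered.step[OF step(1) assms(2-4)]
    by (simp add: lin_add[OF T_lin[OF assms(2,3)]] lin_scale[OF T_lin[OF assms(2,3)]] span_add span_scale span_base)
qed

text \<open>No order is imposed on the lowering operators, so moving an arbitrary
  \<open>T c d\<close> past the outermost one yields only terms covered by the induction
  hypothesis.\<close>

lemma T_lowered:
  assumes w: "weight \<nu> w" and killed: "\<And>a b. a \<in> I \<Longrightarrow> b \<in> I \<Longrightarrow> a < b \<Longrightarrow> T a b w = 0"
    and u: "u \<in> lowered w" and cd: "c \<in> I" "d \<in> I"
  shows "T c d u \<in> span (lowered w)"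
  using u cd
proof (induction arbitrary: c d)
  case base
  consider "c < d" | "c = d" | "d < c" by linarith
  then show ?case
  proof cases
    case 1 then show ?thesis using killed base by (simp add: span_zero)
  next
    case 2
    then obtain x where "T c d w = scale x w" using weight_T_diag[OF w] base by blast
    then show ?thesis using lowered.base by (simp add: span_scale span_base)
  next
    case 3 then show ?thesis using lowered.step[OF lowered.base] base by (simp add: span_base)
  qed
next
  case (step u a b)
  have "T c d (T a b u) = T a b (T c d u) + (T c d (T a b u) - T a b (T c d u))" by simp
  also have "\<dots> \<in> span (lowered w)"
  proof (rule span_add)
    show "T a b (T c d u) \<in> span (lowered w)" using T_span_lowered_neg step by blast
    show "T c d (T a b u) - T a b (T c d u) \<in> span (lowered w)"
      unfolding T_bracket[OF step.prems step.hyps(2,3)]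
      using step.IH step.prems step.hyps by (intro span_add span_diff) (auto intro: span_zero span_scale)
  qed
  finally show ?case .
qed

lemma T_span_lowered:
  assumes w: "weight \<nu> w" and killed: "\<And>a b. a \<in> I \<Longrightarrow> b \<in> I \<Longrightarrow> a < b \<Longrightarrow> T a b w = 0"
    and u: "u \<in> span (lowered w)" and cd: "c \<in> I" "d \<in> I"
  shows "T c d u \<in> span (lowered w)"
  using u
proof (induction rule: span_induct_alt)
  case base
  then show ?case using lin_0[OF T_lin[OF cd]] by (simp add: span_zero)
next
  case (step c' x y)
  then show ?case using T_lowered[OF w killed step(1) cd]
    by (simp add: lin_add[OF T_lin[OF cd]] lin_scale[OF T_lin[OF cd]] span_add span_scale span_base)
qed

lemma lowered_weight:
  assumes w: "weight \<nu> w" and u: "u \<in> lowered w"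
  shows "\<exists>\<nu>'. weight \<nu>' u \<and> height n \<nu>' \<le> height n \<nu>"
  using u
proof induction
  case base
  then show ?case using w by blast
next
  case (step u a b)
  then obtain \<nu>' where \<nu>': "weight \<nu>' u" "height n \<nu>' \<le> height n \<nu>" by blast
  have "height n (\<lambda>i. \<nu>' i + root_weight a b i) = height n \<nu>' + (b - a)"
    using height_add_mult[of n \<nu>' 1 "root_weight a b"] height_root_weight[OF step(2,3)] by simp
  then show ?case using weight_T_root[OF \<nu>'(1) step(2,3)] \<nu>' step(4) by (intro exI[of _ "\<lambda>i. \<nu>' i + root_weight a b i"]) auto
qed

lemma of_nat_fact_nonzero: "CHAR('k) = 0 \<or> q < CHAR('k) \<Longrightarrow> of_nat (fact q) \<noteq> (0::'k)"
proof
  assume q: "CHAR('k) = 0 \<or> q < CHAR('k)" and "of_nat (fact q) = (0::'k)"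
  then have dvd: "CHAR('k) dvd fact q" by (simp only: of_nat_eq_0_iff_char_dvd)
  show False
  proof (cases "CHAR('k) = 0")
    case True
    then show False using dvd by simp
  next
    case False
    then have "prime CHAR('k)" by (intro prime_CHAR_semidom) simp
    then show False using dvd q False prime_dvd_fact_iff[of "CHAR('k)" q] by simp
  qed
qed

lemma funpow_T_root_coeff:
  assumes "a \<in> I" "b \<in> I" "a \<noteq> b"
  shows "(T a b ^^ q) v = scale (of_nat (fact q)) (root_coeff a b v q)"
proof (induction q)
  case 0
  then show ?case by (simp add: root_coeff_0[OF assms])
next
  case (Suc q)
  have "of_nat (fact (Suc q)) = (of_nat (fact q) * of_nat (Suc q) :: 'k)"
    by (simp only: fact_Suc of_nat_mult of_nat_id mult.commute)
  then show ?case using root_coeff_Suc[OF assms, of v q] Suc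
    by (simp add: lin_scale[OF T_lin[OF assms(1,2)]] del: of_nat_Suc fact_Suc)
qed

text \<open>Stability under the Lie algebra alone would not suffice. If
  \<open>root_coeff a b u q\<close> is nonzero, \<open>root_string_short\<close> puts
  \<open>q\<close> below the characteristic, so it is the \<open>q\<close>-th power of
  \<open>T a b\<close> applied to \<open>u\<close> and divided by an invertible \<open>q!\<close>.
  Root elements generate the group.\<close>

lemma span_lowered_submodule:
  assumes w: "weight \<nu> w" and killed: "\<And>a b. a \<in> I \<Longrightarrow> b \<in> I \<Longrightarrow> a < b \<Longrightarrow> T a b w = 0"
  shows "submodule (span (lowered w))"
proof -
  let ?U = "span (lowered w)"
  have root_step: "\<rho> (root_elem n a b s) u \<in> ?U" if ab: "a \<in> I" "b \<in> I" "a \<noteq> b" and u: "u \<in> lowered w" for a b s u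
  proof -
    obtain N where N: "\<rho> (root_elem n a b s) u = (\<Sum>q\<le>N. scale (s ^ q) (root_coeff a b u q))"
      using root_coeff(1)[OF ab, of u] by blast
    obtain \<nu>' where \<nu>': "weight \<nu>' u" using lowered_weight[OF w u] by blast
    have "root_coeff a b u q \<in> ?U" for q
    proof (cases "root_coeff a b u q = 0")
      case True then show ?thesis by (simp add: span_zero)
    next
      case False
      have "u \<noteq> 0"
      proof
        assume "u = 0"
        then have "\<rho> (root_elem n a b s) u = 0" for s using lin_0[OF rho_lin[OF root_elem_in_Sp[OF ab]]] by simp
        moreover obtain N where "\<And>q. q > N \<Longrightarrow> root_coeff a b u q = 0"
          "\<And>s. \<rho> (root_elem n a b s) u = (\<Sum>q\<le>N. scale (s ^ q) (root_coeff a b u q))"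
          using root_coeff(1)[OF ab, of u] by blast
        ultimately have "root_coeff a b u q = 0"
          using coeffs_eqI[OF infinite_UNIV_alg_closed, where N = N and c = "root_coeff a b u" and d = "\<lambda>_. 0" and k = q]
          by (cases "q \<le> N") auto
        then show False using False by simp
      qed
      then have "CHAR('k) = 0 \<or> q < CHAR('k)"
        using root_string_short[OF \<nu>' _ weight_root_coeff[OF \<nu>' ab] False ab] by blast
      then have nz: "of_nat (fact q) \<noteq> (0::'k)" by (rule of_nat_fact_nonzero)
      have "(T a b ^^ q') u \<in> ?U" for q'
        by (induction q') (use T_span_lowered[OF w killed] ab u in \<open>auto intro: span_base\<close>)
      then have "scale (inverse (of_nat (fact q))) (scale (of_nat (fact q)) (root_coeff a b u q)) \<in> ?U"
        unfolding funpow_T_root_coeff[OF ab, symmetric] by (rule span_scale)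
      then show ?thesis using nz by simp
    qed
    then show ?thesis unfolding N by (intro span_sum span_scale)
  qed
  have stable: "\<forall>u\<in>?U. \<rho> g u \<in> ?U" if "g \<in> carrier (Sp n)" for g
    using two_nonzero that
  proof (induction rule: Sp_root_elem_induct)
    case one
    then show ?case by (simp add: rho_one)
  next
    case (root a b s h)
    have lin: "lin (\<rho> (root_elem n a b s))" by (rule rho_lin[OF root_elem_in_Sp[OF root(1-3)]])
    have "\<rho> (root_elem n a b s) u \<in> ?U" if "u \<in> ?U" for u
      using that
    proof (induction rule: span_induct_alt)
      case base then show ?case by (simp add: lin_0[OF lin] span_zero)
    next
      case (step c x y)
      then show ?case using \<open>a \<in> I\<close> \<open>b \<in> I\<close> \<open>a \<noteq> b\<close> root_step[OF \<open>a \<in> I\<close> \<open>b \<in> I\<close> \<open>a \<noteq> b\<close> step(1)]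
        by (simp add: lin_add[OF lin] lin_scale[OF lin] span_add span_scale)
    qed
    then show ?case using root by (simp add: rho_mult[OF root_elem_in_Sp[OF root(1-3)] root(4)])
  qed
  then show ?thesis by (simp add: Sp_submodule_def subspace_span)
qed

text \<open>On a vector of weight \<open>\<nu>\<close> the one-parameter torus
  \<open>t_i = s^(- i)\<close> acts by \<open>s\<close> to the power \<open>height n \<nu>\<close>,
  so comparing exponents of \<open>s\<close> detects heights without separating all weights.\<close>

lemma weight_in_span_height:
  assumes v: "weight \<mu> v" "v \<noteq> 0" "v \<in> span S" and S: "\<And>u. u \<in> S \<Longrightarrow> \<exists>\<nu>. weight \<nu> u \<and> height n \<nu> \<le> h"
  shows "height n \<mu> \<le> h"
proof (rule ccontr)
  assume gt: "\<not> height n \<mu> \<le> h"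
  obtain B r where B: "finite B" "B \<subseteq> S" "v = (\<Sum>u\<in>B. scale (r u) u)" using v(3) by (auto simp: span_explicit)
  obtain \<nu> where \<nu>: "\<And>u. u \<in> S \<Longrightarrow> weight (\<nu> u) u" "\<And>u. u \<in> S \<Longrightarrow> height n (\<nu> u) \<le> h" using S by metis
  let ?t = "\<lambda>s :: 'k. \<lambda>i. s powi (- int i)"
  have act: "\<rho> (torus_elem n (?t s)) u = scale (s powi height n \<nu>') u" if "s \<noteq> 0" "weight \<nu>' u" for s \<nu>' u
  proof -
    have "(\<Prod>i=1..n. ?t s i powi \<nu>' i) = (\<Prod>i=1..n. s powi (- int i * \<nu>' i))"
      by (rule prod.cong) (simp_all only: power_int_mult)
    also have "\<dots> = s powi (\<Sum>i=1..n. - int i * \<nu>' i)"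
    proof -
      have "(\<Prod>i\<in>A. s powi f i) = s powi (\<Sum>i\<in>A. f i)" for A :: "nat set" and f
        by (induction A rule: infinite_finite_induct) (use \<open>s \<noteq> 0\<close> in \<open>auto simp: power_int_add\<close>)
      then show ?thesis .
    qed
    finally show ?thesis using that by (simp add: weight_vector_def height_def)
  qed
  let ?H = "\<lambda>u. height n (\<nu> u)"
  let ?F = "insert (height n \<mu>) (?H ` B)"
  let ?w = "\<lambda>j. (\<Sum>u\<in>{u\<in>B. ?H u = j}. scale (r u) u) - (if j = height n \<mu> then v else 0)"
  have "?w (height n \<mu>) = 0"
  proof (rule powi_independent[of ?F ?w "height n \<mu>"])
    fix s :: 'k assume s: "s \<noteq> 0"
    have ts: "torus_elem n (?t s) \<in> carrier (Sp n)" by (rule nonvanishing_torus) (use s in auto)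
    have "(\<Sum>j\<in>?F. scale (s powi j) (\<Sum>u\<in>{u\<in>B. ?H u = j}. scale (r u) u))
      = (\<Sum>j\<in>?F. \<Sum>u\<in>{u\<in>B. ?H u = j}. scale (s powi ?H u) (scale (r u) u))"
      unfolding scale_sum_right by (intro sum.cong) auto
    also have "\<dots> = (\<Sum>u\<in>B. scale (s powi ?H u) (scale (r u) u))"
      by (rule sum.group) (use B in auto)
    also have "\<dots> = (\<Sum>u\<in>B. scale (r u) (\<rho> (torus_elem n (?t s)) u))"
    proof (rule sum.cong)
      fix u assume "u \<in> B"
      then have "\<rho> (torus_elem n (?t s)) u = scale (s powi ?H u) u" using B(2) \<nu>(1) by (intro act[OF s]) auto
      then show "scale (s powi ?H u) (scale (r u) u) = scale (r u) (\<rho> (torus_elem n (?t s)) u)" by (simp add: mult.commute)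
    qed simp
    also have "\<dots> = \<rho> (torus_elem n (?t s)) v"
      unfolding B(3) by (simp add: lin_sum[OF rho_lin[OF ts]] lin_scale[OF rho_lin[OF ts]])
    also have "\<dots> = scale (s powi height n \<mu>) v" by (rule act[OF s v(1)])
    finally have 1: "(\<Sum>j\<in>?F. scale (s powi j) (\<Sum>u\<in>{u\<in>B. ?H u = j}. scale (r u) u)) = scale (s powi height n \<mu>) v" .
    have "(\<Sum>j\<in>?F. scale (s powi j) (if j = height n \<mu> then v else 0)) = (\<Sum>j\<in>?F. if j = height n \<mu> then scale (s powi j) v else 0)"
      by (rule sum.cong) auto
    also have "\<dots> = scale (s powi height n \<mu>) v" using B by (subst sum.delta) auto
    finally show "(\<Sum>j\<in>?F. scale (s powi j) (?w j)) = 0"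
      using 1 by (simp only: scale_right_diff_distrib sum_subtractf) simp
  qed (use B in auto)
  moreover have "{u\<in>B. ?H u = height n \<mu>} = {}" using \<nu>(2) B(2) gt by fastforce
  ultimately show False using v(2) by simp
qed

text \<open>By simplicity the vectors lowered from \<open>w\<close> span \<open>W j\<close>. They
  include one of weight \<open>\<kappa> j\<close>, which is therefore no higher than
  \<open>\<nu>\<close>; but \<open>\<nu>\<close> lies below \<open>\<kappa> j\<close>.\<close>

lemma singular_weight:
  assumes j: "j \<in> {1..k}" and w: "w \<in> W j" "w \<noteq> 0" "weight \<nu> w"
    and killed: "\<And>a b. a \<in> I \<Longrightarrow> b \<in> I \<Longrightarrow> a < b \<Longrightarrow> T a b w = 0" and i: "i \<in> {1..n}"
  shows "\<nu> i = \<kappa> j i"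
proof -
  have "lowered w \<subseteq> W j"
  proof
    fix u assume "u \<in> lowered w"
    then show "u \<in> W j" by induction (use w T_in_submodule[OF W_submodule[OF j]] in auto)
  qed
  then have "span (lowered w) \<subseteq> W j" using W_subspace[OF j] by (simp add: span_minimal)
  moreover have "span (lowered w) \<noteq> {0}" using w(2) span_base[OF lowered.base, of w] by blast
  ultimately have U: "span (lowered w) = W j"
    using simple[OF j] span_lowered_submodule[OF w(3) killed]
    by (auto simp: is_simple_hw_module_def Sp_simple_submodule_def)
  obtain v where v: "v \<in> W j" "v \<noteq> 0" "weight (\<kappa> j) v" using W_weight[OF j] by (auto simp: is_weight_def)
  have "height n (\<kappa> j) \<le> height n \<nu>"
    using weight_in_span_height[OF v(3,2), of "lowered w"] v(1) U lowered_weight[OF w(3)] by blast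
  moreover have "weight_le n \<nu> (\<kappa> j)" using W_weight_le[OF j] w by (auto simp: is_weight_def)
  ultimately show ?thesis using weight_le_height_eq i by blast
qed

text \<open>All raising operators arise from the simple ones by brackets; passing from
  \<open>T (- 1) 1\<close> to \<open>T (- 1) b\<close> costs a factor 2.\<close>

lemma raising_from_simple:
  assumes 0: "T (- 1) 1 y = 0" and pos: "\<And>i. 1 \<le> i \<Longrightarrow> i < int n \<Longrightarrow> T i (i + 1) y = 0"
    and ab: "a \<in> I" "b \<in> I" "a < b"
  shows "T a b y = 0"
proof -
  have T0: "T c d 0 = 0" if "c \<in> I" "d \<in> I" for c d by (rule lin_0[OF T_lin[OF that]])
  have one: "1 \<in> I" "- 1 \<in> I" using n_pos by (auto simp: index_set_iff)
  have P: "T a (a + 1 + int q) y = 0" if "1 \<le> a" "a + 1 + int q \<le> int n" for a q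
    using that
  proof (induction q)
    case 0 then show ?case using pos by simp
  next
    case (Suc q)
    let ?b = "a + 1 + int q"
    have I: "a \<in> I" "?b \<in> I" "?b + 1 \<in> I" using Suc.prems by (auto simp: index_set_iff)
    have "T a ?b (T ?b (?b + 1) y) - T ?b (?b + 1) (T a ?b y) = T a (?b + 1) y"
      unfolding T_bracket[OF I(1,2,2,3)] using Suc.prems by simp
    moreover have "T ?b (?b + 1) y = 0" using pos[of ?b] Suc.prems by simp
    moreover have "T a ?b y = 0" using Suc by simp
    ultimately show ?case using T0 I by (simp add: add.assoc algebra_simps)
  qed
  have PP: "T a b y = 0" if "1 \<le> a" "a < b" "b \<le> int n" for a b
    using P[of a "nat (b - a - 1)"] that by simp
  have M1: "T (- 1) b y = 0" if b: "1 \<le> b" "b \<le> int n" for b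
  proof (cases "b = 1")
    case False
    have bI: "b \<in> I" using b by (auto simp: index_set_iff)
    have "T (- 1) 1 (T 1 b y) - T 1 b (T (- 1) 1 y) = scale 2 (T (- 1) b y)"
      unfolding T_bracket[OF one(2,1,1) bI] using b False scale_left_distrib[of 1 1 "T (- 1) b y"]
      by (simp add: theta_eq)
    moreover have "T 1 b y = 0" using PP[of 1 b] b False by simp
    ultimately have "scale 2 (T (- 1) b y) = 0" using 0 T0 one bI by simp
    then show ?thesis using two_nonzero by simp
  qed (use 0 in simp)
  have MP: "T (- a) b y = 0" if ab: "1 \<le> a" "a \<le> int n" "1 \<le> b" "b \<le> int n" for a b
  proof -
    have I: "a \<in> I" "b \<in> I" "- a \<in> I" using ab by (auto simp: index_set_iff)
    have A1: "T (- a) 1 y = 0" using M1[OF ab(1,2)] T_sym[OF I(3) one(1), of y] by simp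
    consider "a = 1" | "b = 1" | "a > 1" "b > 1" using ab by linarith
    then show ?thesis
    proof cases
      case 3
      have "T (- a) 1 (T 1 b y) - T 1 b (T (- a) 1 y) = T (- a) b y"
        unfolding T_bracket[OF I(3) one(1,1) I(2)] using 3 by simp
      then show ?thesis using A1 PP[of 1 b] 3 ab T0 one I by simp
    qed (use A1 M1 ab in auto)
  qed
  consider "1 \<le> a" | "a < 0" "0 < b" | "b < 0" using ab unfolding index_set_iff by linarith
  then show ?thesis
  proof cases
    case 1 then show ?thesis using PP[of a b] ab by (auto simp: index_set_iff)
  next
    case 2 then show ?thesis using MP[of "- a" b] ab by (auto simp: index_set_iff)
  next
    case 3 then show ?thesis using PP[of "- b" "- a"] T_sym[OF ab(1,2), of y] ab by (auto simp: index_set_iff)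
  qed
qed

section \<open>From Lie algebra weights to torus weights\<close>

lemma torus_T:
  assumes t: "nonvanishing t" and ab: "a \<in> I" "b \<in> I"
  shows "\<rho> (torus_elem n t) (T a b v) = scale (torus_entry t a / torus_entry t b) (T a b (\<rho> (torus_elem n t) v))"
proof -
  have ts: "lin (\<rho> (torus_elem n t))" by (rule rho_lin[OF nonvanishing_torus[OF t]])
  have Tl: "lin (T a b)" by (rule T_lin[OF ab])
  have "v \<in> span {v \<in> UNIV. \<exists>\<nu>. weight \<nu> v}"
    using torus_stable_span[of UNIV] by (auto simp: torus_stable_def)
  then show ?thesis
  proof (induction rule: span_induct_alt)
    case base then show ?case by (simp add: lin_0[OF ts] lin_0[OF Tl])
  next
    case (step c x y)
    then obtain \<nu> where x: "weight \<nu> x" by blast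
    have "\<rho> (torus_elem n t) (T a b x) = scale (torus_entry t a / torus_entry t b) (T a b (\<rho> (torus_elem n t) x))"
    proof (cases "a = b")
      case True
      then obtain c where "T a b x = scale c x" using weight_T_diag[OF x] ab by blast
      moreover have "torus_entry t a \<noteq> 0" using torus_entry_nonzero[of n t a] t ab by blast
      ultimately show ?thesis using x t True by (simp add: weight_vector_def lin_scale[OF ts] lin_scale[OF T_lin[OF ab(2,2)]] mult.commute)
    next
      case False
      have "\<rho> (torus_elem n t) (T a b x) = scale (\<Prod>i=1..n. t i powi (\<nu> i + root_weight a b i)) (T a b x)"
        using weight_T_root[OF x ab False] t unfolding weight_vector_def by blast
      also have "\<dots> = scale (torus_entry t a / torus_entry t b) (T a b (\<rho> (torus_elem n t) x))"
        using prod_powi_root_weight[OF t ab, of \<nu> 1] x t by (simp add: weight_vector_def lin_scale[OF Tl])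
      finally show ?thesis .
    qed
    then show ?case using step.IH
      by (simp add: lin_add[OF ts] lin_scale[OF ts] lin_add[OF Tl] lin_scale[OF Tl] scale_right_distrib mult.commute)
  qed
qed

lemma torus_funpow_T:
  assumes t: "nonvanishing t" and ab: "a \<in> I" "b \<in> I"
  shows "\<rho> (torus_elem n t) ((T a b ^^ q) v) = scale ((torus_entry t a / torus_entry t b) ^ q) ((T a b ^^ q) (\<rho> (torus_elem n t) v))"
  by (induction q arbitrary: v)
     (simp_all add: torus_T[OF assms] lin_scale[OF T_lin[OF ab]] mult.commute)

text \<open>The index pairs of the simple root vectors; \<open>(- 1, 1)\<close> belongs to the long
  simple root \<open>- 2 \<epsilon>_1\<close>.\<close>

definition simple_pairs :: "(int \<times> int) set" where
  "simple_pairs = insert (- 1, 1) {(i, i + 1) | i. 1 \<le> i \<and> i < int n}"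

lemma simple_pairs_in: "(a, b) \<in> simple_pairs \<Longrightarrow> a \<in> I \<and> b \<in> I \<and> a < b"
  using n_pos by (auto simp: simple_pairs_def index_set_iff)

text \<open>The weights of the Lie algebra only see integers modulo the characteristic, those of the torus
  do not; the conclusion provides a torus weight.\<close>

lemma root_string_weight:
  assumes ab: "(a, b) \<in> simple_pairs" and v0: "v \<noteq> 0"
    and diag: "\<And>i. i \<in> {1..n} \<Longrightarrow> T (int i) (int i) v = scale (of_int (\<eta> i)) v"
    and killed: "\<And>c d q. (c, d) \<in> simple_pairs \<Longrightarrow> (c, d) \<noteq> (a, b) \<Longrightarrow> T c d ((T a b ^^ q) v) = 0"
    and nil: "(T a b ^^ Suc N) v = 0"
  shows "\<exists>j\<in>{1..k}. \<exists>q\<le>N. is_weight n scale \<rho> (W j) (\<lambda>i. \<kappa> j i - int q * root_weight a b i) \<and>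
    (\<forall>i\<in>{1..n}. of_int (\<kappa> j i - int q * root_weight a b i) = (of_int (\<eta> i) :: 'k))"
proof -
  have abI: "a \<in> I" "b \<in> I" "a \<noteq> b" using simple_pairs_in[OF ab] by auto
  have E: "lin (T a b ^^ q)" for q by (rule lin_funpow[OF T_lin[OF abI(1,2)]])
  have diagI: "int i \<in> I" if "i \<in> {1..n}" for i using that by (auto simp: index_set_iff)
  \<comment> \<open>All vectors that satisfy the hypotheses on \<open>v\<close>. The conditions are
    homogeneous under the torus, so this space contains a torus weight vector, and that vector
    replaces \<open>v\<close>.\<close>
  define V' where "V' = {v. (\<forall>i\<in>{1..n}. T (int i) (int i) v = scale (of_int (\<eta> i)) v) \<and>
    (\<forall>c d q. (c, d) \<in> simple_pairs \<longrightarrow> (c, d) \<noteq> (a, b) \<longrightarrow> T c d ((T a b ^^ q) v) = 0) \<and> (T a b ^^ Suc N) v = 0}"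
  have "subspace V'"
  proof (rule subspaceI)
    show "0 \<in> V'" unfolding V'_def using simple_pairs_in lin_0[OF E] lin_0[OF T_lin] diagI by (auto simp del: funpow.simps)
    fix x y assume "x \<in> V'" "y \<in> V'"
    then show "x + y \<in> V'" unfolding V'_def using simple_pairs_in lin_add[OF E] lin_add[OF T_lin] diagI
      by (auto simp del: funpow.simps simp: scale_right_distrib)
  next
    fix c x assume "x \<in> V'"
    then show "scale c x \<in> V'" unfolding V'_def using simple_pairs_in lin_scale[OF E] lin_scale[OF T_lin] diagI
      by (auto simp del: funpow.simps simp: mult.commute)
  qed
  moreover have "\<rho> (torus_elem n t) x \<in> V'" if t: "nonvanishing t" and x: "x \<in> V'" for t x
  proof -
    let ?r = "\<rho> (torus_elem n t)"
    have ts: "lin ?r" by (rule rho_lin[OF nonvanishing_torus[OF t]])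
    have ne: "torus_entry t c \<noteq> 0" if "c \<in> I" for c using torus_entry_nonzero[of n t c] t that by blast
    have "T (int i) (int i) (?r x) = scale (of_int (\<eta> i)) (?r x)" if i: "i \<in> {1..n}" for i
    proof -
      have "T (int i) (int i) (?r x) = ?r (T (int i) (int i) x)"
        using torus_T[OF t diagI[OF i] diagI[OF i], of x] ne[OF diagI[OF i]] by simp
      also have "\<dots> = scale (of_int (\<eta> i)) (?r x)" using x i by (simp add: V'_def lin_scale[OF ts])
      finally show ?thesis .
    qed
    moreover have "T c d ((T a b ^^ q) (?r x)) = 0" if cd: "(c, d) \<in> simple_pairs" "(c, d) \<noteq> (a, b)" for c d q
    proof -
      have cdI: "c \<in> I" "d \<in> I" using simple_pairs_in[OF cd(1)] by auto
      have "?r (T c d ((T a b ^^ q) x)) = scale (torus_entry t c / torus_entry t d * (torus_entry t a / torus_entry t b) ^ q) (T c d ((T a b ^^ q) (?r x)))"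
        by (simp add: torus_T[OF t cdI] torus_funpow_T[OF t abI(1,2)] lin_scale[OF T_lin[OF cdI]])
      moreover have "?r (T c d ((T a b ^^ q) x)) = 0" using x cd by (simp add: V'_def lin_0[OF ts])
      ultimately show ?thesis using ne cdI abI by simp
    qed
    moreover have "(T a b ^^ Suc N) (?r x) = 0"
    proof -
      have "?r ((T a b ^^ Suc N) x) = 0" using x by (simp add: V'_def lin_0[OF ts] del: funpow.simps)
      then show ?thesis unfolding torus_funpow_T[OF t abI(1,2)] using ne abI by simp
    qed
    ultimately show ?thesis unfolding V'_def by blast
  qed
  ultimately have "torus_stable V'" by (simp add: torus_stable_def)
  moreover have "v \<in> V'" using diag killed nil unfolding V'_def by blast
  ultimately obtain \<nu> v' where v': "v' \<in> V'" "v' \<noteq> 0" "weight \<nu> v'"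
    using torus_stable_weight_vector[of V'] v0 by blast
  obtain w j where w: "w \<in> (\<Pi>\<^sub>E j\<in>{1..k}. W j)" "v' = (\<Sum>j=1..k. w j)" and j: "j \<in> {1..k}" and wj: "w j \<noteq> 0" "w j \<in> W j"
    using nonzero_component[OF v'(2)] by metis
  have Tst: "T c d x \<in> W j'" if "c \<in> I" "d \<in> I" "j' \<in> {1..k}" "x \<in> W j'" for c d j' x
    using T_in_submodule[OF W_submodule] that by blast
  have Est: "(T a b ^^ q) x \<in> W j'" if "j' \<in> {1..k}" "x \<in> W j'" for j' x q
    by (induction q) (use Tst abI that in auto)
  have wt: "weight \<nu> (w j)" using weight_component[OF w(1) _ j] v'(3) w(2) by simp
  have wdiag: "T (int i) (int i) (w j) = scale (of_int (\<eta> i)) (w j)" if i: "i \<in> {1..n}" for i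
    by (rule component_eigen[OF T_lin[OF diagI[OF i] diagI[OF i]] _ w(1) _ j])
       (use Tst diagI[OF i] v'(1) w(2) i in \<open>auto simp: V'_def\<close>)
  have wkilled: "T c d ((T a b ^^ q) (w j)) = 0" if cd: "(c, d) \<in> simple_pairs" "(c, d) \<noteq> (a, b)" for c d q
  proof -
    have cdI: "c \<in> I" "d \<in> I" using simple_pairs_in[OF cd(1)] by auto
    have "(\<lambda>x. T c d ((T a b ^^ q) x)) (w j) = scale 0 (w j)"
    proof (rule component_eigen[OF _ _ w(1) _ j])
      show "lin (\<lambda>x. T c d ((T a b ^^ q) x))"
        using E[of q] T_lin[OF cdI] by (auto simp: lin_iff)
    qed (use Tst Est cdI v'(1) w(2) cd in \<open>auto simp: V'_def\<close>)
    then show ?thesis by simp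
  qed
  have wnil: "(T a b ^^ Suc N) (w j) = 0"
  proof -
    have "(T a b ^^ Suc N) (w j) = scale 0 (w j)"
      by (rule component_eigen[OF E _ w(1) _ j]) (use Est v'(1) w(2) in \<open>auto simp: V'_def simp del: funpow.simps\<close>)
    then show ?thesis by simp
  qed
  \<comment> \<open>The last nonzero power of the simple root vector is killed by all simple root
    vectors, so it is singular and its weight must be \<open>\<kappa> j\<close>.\<close>
  define q where "q = (LEAST q. (T a b ^^ Suc q) (w j) = 0)"
  have q: "(T a b ^^ Suc q) (w j) = 0" "q \<le> N" 
    unfolding q_def using LeastI[of "\<lambda>q. (T a b ^^ Suc q) (w j) = 0" N] Least_le[of "\<lambda>q. (T a b ^^ Suc q) (w j) = 0" N] wnil
    by blast+
  have qn: "(T a b ^^ q) (w j) \<noteq> 0"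
  proof (cases q)
    case (Suc q')
    then have "q' < (LEAST q. (T a b ^^ Suc q) (w j) = 0)" by (simp add: q_def)
    from not_less_Least[OF this] show ?thesis unfolding Suc .
  qed (use wj in simp)
  let ?y = "(T a b ^^ q) (w j)"
  have ysimple: "T c d ?y = 0" if "(c, d) \<in> simple_pairs" for c d
    using wkilled[OF that] q(1) by (cases "(c, d) = (a, b)") auto
  have yk: "T c d ?y = 0" if "c \<in> I" "d \<in> I" "c < d" for c d
    by (rule raising_from_simple[OF _ _ that]) (auto intro!: ysimple simp: simple_pairs_def)
  have yw: "weight (\<lambda>i. \<nu> i + int q' * root_weight a b i) ((T a b ^^ q') (w j))" for q'
  proof (induction q')
    case (Suc q')
    have "weight (\<lambda>i. (\<nu> i + int q' * root_weight a b i) + root_weight a b i) ((T a b ^^ Suc q') (w j))"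
      using weight_T_root[OF Suc abI] by simp
    moreover have "(\<lambda>i. (\<nu> i + int q' * root_weight a b i) + root_weight a b i) = (\<lambda>i. \<nu> i + int (Suc q') * root_weight a b i)"
      by (auto simp: algebra_simps)
    ultimately show ?case by (simp only:)
  qed (use wt in simp)
  have \<nu>: "\<nu> i = \<kappa> j i - int q * root_weight a b i" if "i \<in> {1..n}" for i
    using singular_weight[OF j Est[OF j wj(2)] qn yw yk that] by simp
  have "weight (\<lambda>i. \<kappa> j i - int q * root_weight a b i) (w j)"
    using wt \<nu> unfolding weight_vector_def by simp
  then have "is_weight n scale \<rho> (W j) (\<lambda>i. \<kappa> j i - int q * root_weight a b i)"
    using wj unfolding is_weight_def by blast
  moreover have "of_int (\<kappa> j i - int q * root_weight a b i) = (of_int (\<eta> i) :: 'k)" if i: "i \<in> {1..n}" for i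
  proof -
    have "scale (of_int (\<nu> i)) (w j) = scale (of_int (\<eta> i)) (w j)" using weight_T_diag_pos[OF wt i] wdiag[OF i] by metis
    then have "of_int (\<nu> i) = (of_int (\<eta> i) :: 'k)" using wj(1) by (metis scale_cancel_right)
    then show ?thesis using \<nu>[OF i] by simp
  qed
  ultimately show ?thesis using j q(2) by blast
qed

end

section \<open>The relations of the twisted Yangian in coefficients\<close>

lemma free_algebra_simps [simp]:
  "monoid.mult (free_algebra n) = (*)" "one (free_algebra n) = 1" "ring.zero (free_algebra n) = 0" "add (free_algebra n) = (+)"
  by (simp_all add: free_algebra_def)

lemma carrier_free_algebra:
  "a \<in> carrier (free_algebra n) \<longleftrightarrow> (\<forall>w\<in>Poly_Mapping.keys a. set (letters w) \<subseteq> index_set n \<times> index_set n \<times> {1..})"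
  by (simp add: free_algebra_def)

lemma carrier_free_algebra_add:
  "a \<in> carrier (free_algebra n) \<Longrightarrow> b \<in> carrier (free_algebra n) \<Longrightarrow> a + b \<in> carrier (free_algebra n)"
  unfolding carrier_free_algebra using keys_add[of a b] by blast

lemma carrier_free_algebra_uminus:
  "a \<in> carrier (free_algebra n) \<Longrightarrow> - a \<in> carrier (free_algebra n)"
  unfolding carrier_free_algebra by simp

lemma carrier_free_algebra_diff:
  "a \<in> carrier (free_algebra n) \<Longrightarrow> b \<in> carrier (free_algebra n) \<Longrightarrow> a - b \<in> carrier (free_algebra n)"
  using carrier_free_algebra_add[of a n "- b"] carrier_free_algebra_uminus[of b n] by simp

lemma carrier_free_algebra_mult:
  assumes "a \<in> carrier (free_algebra n)" "b \<in> carrier (free_algebra n)"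
  shows "a * b \<in> carrier (free_algebra n)"
  unfolding carrier_free_algebra
proof
  fix w assume "w \<in> Poly_Mapping.keys (a * b)"
  then obtain w1 w2 where "w = w1 + w2" "w1 \<in> Poly_Mapping.keys a" "w2 \<in> Poly_Mapping.keys b"
    using keys_mult[of a b] by blast
  then show "set (letters w) \<subseteq> index_set n \<times> index_set n \<times> {1..}"
    using assms by (auto simp: carrier_free_algebra plus_free_monoid_def)
qed

lemma scalar_in_carrier: "scalar c \<in> carrier (free_algebra n)"
  by (auto simp: scalar_def carrier_free_algebra zero_free_monoid_def split: if_splits)

lemma of_int_eq_scalar: "(of_int z :: 'k::field free_alg) = scalar (of_int z)"
proof -
  have nat: "(of_nat m :: 'k free_alg) = scalar (of_nat m)" for m
    by (induction m) (auto simp: scalar_def single_add simp flip: single_one)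
  show ?thesis
    by (cases z rule: int_cases2) (simp_all add: nat, simp add: scalar_def single_uminus)
qed

lemma free_algebra_0: "0 \<in> carrier (free_algebra n)"
  and free_algebra_1: "1 \<in> carrier (free_algebra n)"
  using scalar_in_carrier[of 0 n] scalar_in_carrier[of 1 n] by (simp_all add: scalar_def)

lemma s_gen_in_carrier: "i \<in> index_set n \<Longrightarrow> j \<in> index_set n \<Longrightarrow> s_gen i j r \<in> carrier (free_algebra n)"
  using free_algebra_0[of n] free_algebra_1[of n]
  by (auto simp: s_gen_def carrier_free_algebra)

lemma ring_free_algebra: "ring (free_algebra n)"
proof (rule ringI)
  show "abelian_group (free_algebra n)"
    by (rule abelian_groupI)
       (auto simp: carrier_free_algebra_add free_algebra_0 add_ac intro: bexI[of _ "- x" for x] carrier_free_algebra_uminus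
         dest: carrier_free_algebra_uminus intro!: exI)
  show "Group.monoid (free_algebra n)"
    by (rule monoidI) (auto simp: carrier_free_algebra_mult free_algebra_1 mult.assoc)
qed (auto simp: algebra_simps)

text \<open>With integer indices and zero below 0 the boundary cases of the relations, among them
  the Lie algebra action, become instances of one formula.\<close>

definition s_coeff :: "int \<Rightarrow> int \<Rightarrow> int \<Rightarrow> 'k::field free_alg" where
  "s_coeff i j r = (if r < 0 then 0 else s_gen i j (nat r))"

lemma s_coeff_in_carrier: "i \<in> index_set n \<Longrightarrow> j \<in> index_set n \<Longrightarrow> s_coeff i j r \<in> carrier (free_algebra n)"
  by (simp add: s_coeff_def free_algebra_0 s_gen_in_carrier)

text \<open>Coefficient of \<open>u\<^sup>-\<^sup>pv\<^sup>-\<^sup>q\<close>, extended by zero to all integers so that multiplication by \<open>x\<close> and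
  \<open>y\<close> is a plain index shift.\<close>

definition coeff2 :: "int \<Rightarrow> int \<Rightarrow> 'a::zero fps fps \<Rightarrow> 'a" where
  "coeff2 p q F = (if p < 0 \<or> q < 0 then 0 else fps_nth (fps_nth F (nat q)) (nat p))"

lemma coeff2_add: "coeff2 p q (F + G) = coeff2 p q F + coeff2 p q (G :: 'a::ring_1 fps fps)"
  and coeff2_diff: "coeff2 p q (F - G) = coeff2 p q F - coeff2 p q (G :: 'a::ring_1 fps fps)"
  by (simp_all add: coeff2_def)

lemma coeff2_x: "coeff2 p q (x_ser * F) = coeff2 (p - 1) q (F :: 'a::ring_1 fps fps)"
  by (auto simp: coeff2_def x_ser_def nat_diff_distrib fps_X_mult_nth)

lemma coeff2_y: "coeff2 p q (y_ser * F) = coeff2 p (q - 1) (F :: 'a::ring_1 fps fps)"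
  by (auto simp: coeff2_def y_ser_def nat_diff_distrib fps_X_mult_nth)

lemma of_int_fps: "(of_int z :: 'a::ring_1 fps) = fps_const (of_int z)"
  by (rule fps_of_int[symmetric])

lemma coeff2_const: "coeff2 p q (fps_const (fps_const c) * F) = c * coeff2 p q (F :: 'a::ring_1 fps fps)"
  by (simp add: coeff2_def)

lemma coeff2_theta: "coeff2 p q (theta i j * F) = theta i j * coeff2 p q (F :: 'a::ring_1 fps fps)"
  unfolding theta_def of_int_fps by (rule coeff2_const)

lemma coeff2_uv: "coeff2 p q (S_u i j * S_v k l) = s_coeff i j p * s_coeff k l q"
  by (auto simp: coeff2_def S_u_def S_v_def S_mat_def s_coeff_def)

lemma coeff2_vu: "coeff2 p q (S_v k l * S_u i j) = s_coeff k l q * s_coeff i j p"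
  by (auto simp: coeff2_def S_u_def S_v_def S_mat_def s_coeff_def)

lemma x_ser_commute: "F * x_ser = x_ser * (F :: 'a::ring_1 fps fps)"
  by (rule fps_ext) (simp add: x_ser_def, rule fps_mult_fps_X_commute[symmetric])

lemma y_ser_commute: "F * y_ser = y_ser * (F :: 'a::ring_1 fps fps)"
  unfolding y_ser_def by (rule fps_mult_fps_X_commute[symmetric])

lemma theta_commute: "(F :: 'a::ring_1) * theta i j = theta i j * F"
  unfolding theta_def by (rule mult_of_int_commute[symmetric])

section \<open>Entries of the quaternary relation\<close>

lemma sum_delta_pair:
  assumes "finite I" "a0 \<in> I" "b0 \<in> I"
  shows "(\<Sum>a\<in>I. \<Sum>b\<in>I. if a = a0 \<and> b = b0 then f a b else 0) = (f a0 b0 :: 'a::comm_monoid_add)"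
proof -
  have "(\<Sum>a\<in>I. \<Sum>b\<in>I. if a = a0 \<and> b = b0 then f a b else 0) =
    (\<Sum>a\<in>I. if a = a0 then (\<Sum>b\<in>I. if b = b0 then f a b else 0) else 0)"
    by (intro sum.cong refl) auto
  then show ?thesis using assms by simp
qed

lemma if_zero_mult: "(if c then u else 0) * v = (if c then u * v else (0::'a::mult_zero))"
  and mult_if_zero: "v * (if c then u else 0) = (if c then v * u else (0::'a::mult_zero))"
  and if_if_zero: "(if (if c then d else False) then u else 0) = (if c then if d then u else 0 else (0::'a::mult_zero))"
  by simp_all

lemma x_ser_left_commute: "F * (x_ser * G) = x_ser * (F * (G :: 'a::ring_1 fps fps))"
  and y_ser_left_commute: "F * (y_ser * G) = y_ser * (F * (G :: 'a::ring_1 fps fps))"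
  and theta_left_commute: "H * (theta i j * K) = theta i j * (H * (K :: 'a::ring_1))"
  by (metis mult.assoc x_ser_commute) (metis mult.assoc y_ser_commute, metis mult.assoc theta_commute)

lemma P_mat_entry:
  assumes "i \<in> index_set n" "k \<in> index_set n"
  shows "P_mat n (i, k) (j, l) = (if j = k \<and> l = i then 1 else 0)"
proof -
  have *: "kron (mat_unit i' j') (mat_unit j' i') (i, k) (j, l) =
    (if i' = i \<and> j' = k then (if j = k \<and> l = i then 1 else 0) else 0)" for i' j'
    by (auto simp: kron_def mat_unit_def)
  show ?thesis unfolding P_mat_def * by (rule sum_delta_pair) (use assms in auto)
qed

lemma P'_mat_entry:
  assumes "k \<in> index_set n" "l \<in> index_set n"
  shows "P'_mat n (i, k) (j, l) = (if k = - i \<and> l = - j then theta i j else 0)"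
proof -
  have *: "kron (mat_prime (mat_unit i' j')) (mat_unit j' i') (i, k) (j, l) =
    (if i' = l \<and> j' = k then (if k = - i \<and> l = - j then theta i j else 0) else 0)" for i' j'
    by (auto simp: kron_def mat_unit_def mat_prime_def)
  show ?thesis unfolding P'_mat_def * by (rule sum_delta_pair) (use assms in auto)
qed

lemma mat_mult_pairs:
  "mat_mult (I \<times> I) A B z (j, l) = (\<Sum>a\<in>I. \<Sum>b\<in>I. A z (a, b) * B (a, b) (j, l))"
  by (simp add: mat_mult_def sum.cartesian_product)

lemma R_cleared_entry:
  assumes "i \<in> index_set n" "k \<in> index_set n"
  shows "R_cleared n (i, k) (j, l) =
    (if j = i \<and> l = k then y_ser - x_ser else 0) - (if j = k \<and> l = i then x_ser * y_ser else 0)"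
proof -
  have e: "((i, k) \<in> index_set n \<times> index_set n \<and> (i, k) = (j, l)) = (j = i \<and> l = k)" using assms by auto
  show ?thesis unfolding R_cleared_def mat_one_def P_mat_entry[OF assms] e mult_if_zero mult_1_right by (rule refl)
qed

lemma R_cleared_mult:
  assumes "i \<in> index_set n" "k \<in> index_set n"
  shows "mat_mult (index_set n \<times> index_set n) (R_cleared n) B (i, k) (j, l) =
    (y_ser - x_ser) * B (i, k) (j, l) - x_ser * y_ser * B (k, i) (j, l)"
  unfolding mat_mult_pairs R_cleared_entry[OF assms] left_diff_distrib[of "if _ then _ else _"] if_zero_mult sum_subtractf
  by (simp only: sum_delta_pair finite_index_set assms)

lemma mult_R_cleared:
  assumes "j \<in> index_set n" "l \<in> index_set n"
  shows "mat_mult (index_set n \<times> index_set n) A (R_cleared n) z (j, l) =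
    A z (j, l) * (y_ser - x_ser) - A z (l, j) * (x_ser * y_ser)"
proof -
  have "A z (a, b) * R_cleared n (a, b) (j, l) =
    (if a = j \<and> b = l then A z (a, b) * (y_ser - x_ser) else 0) - (if a = l \<and> b = j then A z (a, b) * (x_ser * y_ser) else 0)"
    if "a \<in> index_set n" "b \<in> index_set n" for a b
    unfolding R_cleared_entry[OF that] right_diff_distrib[of _ "if _ then _ else _"] mult_if_zero by (simp only: conj_commute eq_commute)
  then have "mat_mult (index_set n \<times> index_set n) A (R_cleared n) z (j, l) =
    (\<Sum>a\<in>index_set n. \<Sum>b\<in>index_set n. (if a = j \<and> b = l then A z (a, b) * (y_ser - x_ser) else 0) -
      (if a = l \<and> b = j then A z (a, b) * (x_ser * y_ser) else 0))"
    unfolding mat_mult_pairs by (intro sum.cong refl)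
  then show ?thesis unfolding sum_subtractf by (simp only: sum_delta_pair finite_index_set assms)
qed

lemma mult_R'_cleared:
  assumes "j \<in> index_set n" "l \<in> index_set n"
  shows "mat_mult (index_set n \<times> index_set n) A (R'_cleared n) z (j, l) =
    A z (j, l) * (x_ser + y_ser) +
    (if l = - j then \<Sum>a\<in>index_set n. A z (a, - a) * (x_ser * y_ser * theta a j) else 0)"
proof -
  have "A z (a, b) * R'_cleared n (a, b) (j, l) =
    (if a = j \<and> b = l then A z (a, b) * (x_ser + y_ser) else 0) +
    (if b = - a then if l = - j then A z (a, b) * (x_ser * y_ser * theta a j) else 0 else 0)"
    if "a \<in> index_set n" "b \<in> index_set n" for a b
  proof -
    have e: "((a, b) \<in> index_set n \<times> index_set n \<and> (a, b) = (j, l)) = (a = j \<and> b = l)"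
      "(b = - a \<and> l = - j) = (if b = - a then l = - j else False)" using that by auto
    show ?thesis unfolding R'_cleared_def mat_one_def P'_mat_entry[OF that(2) assms(2)] e mult_if_zero mult_1_right
        distrib_left[of _ "if _ then _ else _"] if_if_zero
      by (rule refl)
  qed
  then have "mat_mult (index_set n \<times> index_set n) A (R'_cleared n) z (j, l) =
    (\<Sum>a\<in>index_set n. \<Sum>b\<in>index_set n. (if a = j \<and> b = l then A z (a, b) * (x_ser + y_ser) else 0) +
    (if b = - a then if l = - j then A z (a, b) * (x_ser * y_ser * theta a j) else 0 else 0))"
    unfolding mat_mult_pairs by (intro sum.cong refl)
  then show ?thesis unfolding sum.distrib using assms by (simp add: sum_delta_pair)
qed

lemma mult_S1:
  assumes "j \<in> index_set n" "l \<in> index_set n"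
  shows "mat_mult (index_set n \<times> index_set n) A (S1_mat n) z (j, l) = (\<Sum>a\<in>index_set n. A z (a, l) * S_u a j)"
proof -
  have "A z (a, b) * S1_mat n (a, b) (j, l) = (if b = l then A z (a, b) * S_u a j else 0)" if "b \<in> index_set n" for a b
    using that by (simp only: S1_mat_def kron_def mat_one_def case_prod_conv mult_if_zero mult_1_right simp_thms)
  then show ?thesis unfolding mat_mult_pairs using assms by simp
qed

lemma mult_S2:
  assumes "j \<in> index_set n" "l \<in> index_set n"
  shows "mat_mult (index_set n \<times> index_set n) A (S2_mat n) z (j, l) = (\<Sum>b\<in>index_set n. A z (j, b) * S_v b l)"
proof -
  have "A z (a, b) * S2_mat n (a, b) (j, l) = (if a = j then A z (a, b) * S_v b l else 0)" if "a \<in> index_set n" for a b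
    using that by (simp only: S2_mat_def kron_def mat_one_def case_prod_conv mult_if_zero if_zero_mult mult_1_left simp_thms)
  then have "mat_mult (index_set n \<times> index_set n) A (S2_mat n) z (j, l) =
    (\<Sum>b\<in>index_set n. \<Sum>a\<in>index_set n. if a = j then A z (a, b) * S_v b l else 0)"
    unfolding mat_mult_pairs by (subst sum.swap) simp
  then show ?thesis using assms by simp
qed

text \<open>The coefficients do not commute. These rules move the central factors to the left and
  leave the order of \<open>S_u\<close> and \<open>S_v\<close> intact.\<close>

lemma central_rules:
  fixes F G :: "'k::field free_alg fps fps"
  shows "S_u i j * x_ser = x_ser * (S_u i j :: 'k free_alg fps fps)" "S_u i j * (x_ser * F) = x_ser * (S_u i j * F)"
    "S_u i j * y_ser = y_ser * (S_u i j :: 'k free_alg fps fps)" "S_u i j * (y_ser * F) = y_ser * (S_u i j * F)"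
    "S_v i j * x_ser = x_ser * (S_v i j :: 'k free_alg fps fps)" "S_v i j * (x_ser * F) = x_ser * (S_v i j * F)"
    "S_v i j * y_ser = y_ser * (S_v i j :: 'k free_alg fps fps)" "S_v i j * (y_ser * F) = y_ser * (S_v i j * F)"
    "theta a b * x_ser = x_ser * (theta a b :: 'k free_alg fps fps)" "theta a b * (x_ser * F) = x_ser * (theta a b * F)"
    "theta a b * y_ser = y_ser * (theta a b :: 'k free_alg fps fps)" "theta a b * (y_ser * F) = y_ser * (theta a b * F)"
    "y_ser * x_ser = x_ser * (y_ser :: 'k free_alg fps fps)" "y_ser * (x_ser * F) = x_ser * (y_ser * F)"
    "S_u i j * theta a b = theta a b * (S_u i j :: 'k free_alg fps fps)" "S_u i j * (theta a b * F) = theta a b * (S_u i j * F)"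
    "S_v i j * theta a b = theta a b * (S_v i j :: 'k free_alg fps fps)" "S_v i j * (theta a b * F) = theta a b * (S_v i j * F)"
  by (rule x_ser_commute x_ser_left_commute y_ser_commute y_ser_left_commute theta_commute theta_left_commute)+

lemma quaternary_lhs_entry:
  assumes ik: "i \<in> index_set n" "k \<in> index_set n" and jl: "j \<in> index_set n" "l \<in> index_set n"
  shows "quaternary_lhs n (i, k) (j, l) =
    (y_ser - x_ser) * S_u i j * (x_ser + y_ser) * S_v k l - x_ser * y_ser * S_u k j * (x_ser + y_ser) * S_v i l +
    ((y_ser - x_ser) * S_u i (- k) * (x_ser * y_ser * theta (- k) j) - x_ser * y_ser * S_u k (- i) * (x_ser * y_ser * theta (- i) j))
      * S_v (- j) (l :: int)"
proof -
  let ?I = "index_set n"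
  let ?M = "mat_mult (?I \<times> ?I)"
  let ?A = "?M (R_cleared n) (S1_mat n) (i, k)"
  have A: "?A (a, b) = (if b = k then (y_ser - x_ser) * S_u i a else 0) - (if b = i then x_ser * y_ser * S_u k a else 0)" for a b
    unfolding R_cleared_mult[OF ik] using ik by (auto simp: S1_mat_def kron_def mat_one_def)
  have 1: "(\<Sum>d\<in>?I. ?A (j, d) * (x_ser + y_ser) * S_v d l) =
    (y_ser - x_ser) * S_u i j * (x_ser + y_ser) * S_v k l - x_ser * y_ser * S_u k j * (x_ser + y_ser) * S_v i l"
  proof -
    have "?A (j, d) * (x_ser + y_ser) * S_v d l =
      (if d = k then (y_ser - x_ser) * S_u i j * (x_ser + y_ser) * S_v d l else 0) -
      (if d = i then x_ser * y_ser * S_u k j * (x_ser + y_ser) * S_v d l else 0)" for d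
      unfolding A left_diff_distrib[of "if _ then _ else _"] left_diff_distrib[of "(if _ then _ else _) * _"] if_zero_mult by (rule refl)
    then have "(\<Sum>d\<in>?I. ?A (j, d) * (x_ser + y_ser) * S_v d l) = (\<Sum>d\<in>?I.
      (if d = k then (y_ser - x_ser) * S_u i j * (x_ser + y_ser) * S_v d l else 0) -
      (if d = i then x_ser * y_ser * S_u k j * (x_ser + y_ser) * S_v d l else 0))" by (intro sum.cong refl)
    then show ?thesis unfolding sum_subtractf using ik by simp
  qed
  have 2: "(\<Sum>a\<in>?I. ?A (a, - a) * (x_ser * y_ser * theta a j)) =
    (y_ser - x_ser) * S_u i (- k) * (x_ser * y_ser * theta (- k) j) - x_ser * y_ser * S_u k (- i) * (x_ser * y_ser * theta (- i) j)"
  proof -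
    have e: "- a = b \<longleftrightarrow> a = - b" for a b :: int by auto
    have "?A (a, - a) * (x_ser * y_ser * theta a j) =
      (if a = - k then (y_ser - x_ser) * S_u i a * (x_ser * y_ser * theta a j) else 0) -
      (if a = - i then x_ser * y_ser * S_u k a * (x_ser * y_ser * theta a j) else 0)" for a
      unfolding A left_diff_distrib[of "if _ then _ else _"] if_zero_mult e by (rule refl)
    then have "(\<Sum>a\<in>?I. ?A (a, - a) * (x_ser * y_ser * theta a j)) = (\<Sum>a\<in>?I.
      (if a = - k then (y_ser - x_ser) * S_u i a * (x_ser * y_ser * theta a j) else 0) -
      (if a = - i then x_ser * y_ser * S_u k a * (x_ser * y_ser * theta a j) else 0))" by (intro sum.cong refl)
    then show ?thesis unfolding sum_subtractf using ik by simp
  qed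
  have "quaternary_lhs n (i, k) (j, l) = (\<Sum>d\<in>?I. (?A (j, d) * (x_ser + y_ser) +
    (if d = - j then \<Sum>a\<in>?I. ?A (a, - a) * (x_ser * y_ser * theta a j) else 0)) * S_v d l)"
    unfolding quaternary_lhs_def Let_def mult_S2[OF jl]
    by (intro sum.cong refl) (simp only: mult_R'_cleared[OF jl(1)])
  also have "\<dots> = (\<Sum>d\<in>?I. ?A (j, d) * (x_ser + y_ser) * S_v d l) +
    (\<Sum>d\<in>?I. if d = - j then (\<Sum>a\<in>?I. ?A (a, - a) * (x_ser * y_ser * theta a j)) * S_v d l else 0)"
    unfolding sum.distrib[symmetric] by (intro sum.cong refl) (simp add: distrib_right)
  also have "(\<Sum>d\<in>?I. if d = - j then (\<Sum>a\<in>?I. ?A (a, - a) * (x_ser * y_ser * theta a j)) * S_v d l else 0) =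
    (\<Sum>a\<in>?I. ?A (a, - a) * (x_ser * y_ser * theta a j)) * S_v (- j) l" using jl by simp
  finally show ?thesis unfolding 1 2 .
qed

lemma quaternary_rhs_entry:
  assumes ik: "i \<in> index_set n" "k \<in> index_set n" and jl: "j \<in> index_set n" "l \<in> index_set n"
  shows "quaternary_rhs n (i, k) (j, l) =
    (S_v k l * (x_ser + y_ser) * S_u i j + S_v k (- i) * (x_ser * y_ser * theta i (- l)) * S_u (- l) j) * (y_ser - x_ser) -
    (S_v k j * (x_ser + y_ser) * S_u i l + S_v k (- i) * (x_ser * y_ser * theta i (- j)) * S_u (- j) l) * (x_ser * (y_ser :: 'k::field free_alg fps fps))"
proof -
  let ?I = "index_set n"
  let ?M = "mat_mult (?I \<times> ?I)"
  let ?A = "?M (S2_mat n) (R'_cleared n) (i, k) :: _ \<Rightarrow> 'k free_alg fps fps"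
  have A: "?A (c, d) = (if c = i then S_v k d * (x_ser + y_ser) else 0) +
      (if c = - d then S_v k (- i) * (x_ser * y_ser * theta i c) else 0)"
    if cd: "c \<in> ?I" "d \<in> ?I" for c d
  proof -
    have "S2_mat n (i, k) (a, b) = (if a = i then S_v k b else (0 :: 'k free_alg fps fps))" for a b
      using ik by (cases "a = i") (simp_all add: S2_mat_def kron_def mat_one_def)
    note S2 = this
    have sum: "(\<Sum>a\<in>?I. S2_mat n (i, k) (a, - a) * (x_ser * y_ser * theta a c)) =
      S_v k (- i) * (x_ser * y_ser * (theta i c :: 'k free_alg fps fps))"
      unfolding S2 if_zero_mult using ik by simp
    have e: "d = - c \<longleftrightarrow> c = - d" by auto
    show ?thesis unfolding mult_R'_cleared[OF cd] unfolding sum unfolding S2 if_zero_mult e by (rule refl)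
  qed
  have B: "?M (?M (S2_mat n) (R'_cleared n)) (S1_mat n) (i, k) (j, l) =
      S_v k l * (x_ser + y_ser) * S_u i j + S_v k (- i) * (x_ser * y_ser * theta i (- l)) * (S_u (- l) j :: 'k free_alg fps fps)"
    if jl: "j \<in> ?I" "l \<in> ?I" for j l
  proof -
    have "?A (c, l) * S_u c j = (if c = i then S_v k l * (x_ser + y_ser) * S_u c j else 0) +
      (if c = - l then S_v k (- i) * (x_ser * y_ser * theta i c) * S_u c j else 0)" if "c \<in> ?I" for c
      unfolding A[OF that jl(2)] distrib_right[of "if _ then _ else _"] if_zero_mult by (rule refl)
    then have "(\<Sum>c\<in>?I. ?A (c, l) * S_u c j) = (\<Sum>c\<in>?I. (if c = i then S_v k l * (x_ser + y_ser) * S_u c j else 0) +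
      (if c = - l then S_v k (- i) * (x_ser * y_ser * theta i c) * S_u c j else 0))" by (intro sum.cong refl)
    then show ?thesis unfolding mult_S1[OF jl] sum.distrib using ik jl by simp
  qed
  show ?thesis unfolding quaternary_rhs_def Let_def mult_R_cleared[OF jl] B[OF jl] B[OF jl(2,1)] by (rule refl)
qed

text \<open>Clearing denominators multiplies the relation by \<open>(y - x)(x + y)\<close>, of
  degree 2. Reading coefficients at \<open>p + 2\<close> and \<open>q + 2\<close> absorbs this
  shift.\<close>

lemma coeff2_lhs_terms:
  "coeff2 (p + 2) (q + 2) ((y_ser - x_ser) * S_u i j * (x_ser + y_ser) * S_v k l) =
     s_coeff i j (p + 2) * s_coeff k l q - s_coeff i j p * s_coeff k l (q + 2)"
  "coeff2 (p + 2) (q + 2) (x_ser * y_ser * S_u i j * (x_ser + y_ser) * S_v k l) =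
     s_coeff i j p * s_coeff k l (q + 1) + s_coeff i j (p + 1) * s_coeff k l q"
  "coeff2 (p + 2) (q + 2) ((y_ser - x_ser) * S_u i j * (x_ser * y_ser * theta a b) * S_v k l) =
     theta a b * (s_coeff i j (p + 1) * s_coeff k l q) - theta a b * (s_coeff i j p * s_coeff k l (q + 1))"
  "coeff2 (p + 2) (q + 2) (x_ser * y_ser * S_u i j * (x_ser * y_ser * theta a b) * S_v k l) =
     theta a b * (s_coeff i j p * s_coeff k l q)"
  by (simp_all add: distrib_left distrib_right left_diff_distrib right_diff_distrib mult.assoc central_rules
      coeff2_add coeff2_diff coeff2_x coeff2_y coeff2_theta coeff2_uv coeff2_vu add.commute)

lemma coeff2_rhs_terms:
  "coeff2 (p + 2) (q + 2) (S_v k l * (x_ser + y_ser) * S_u i j * (y_ser - x_ser)) =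
     s_coeff k l q * s_coeff i j (p + 2) - s_coeff k l (q + 2) * s_coeff i j p"
  "coeff2 (p + 2) (q + 2) (S_v k l * (x_ser + y_ser) * S_u i j * (x_ser * y_ser)) =
     s_coeff k l (q + 1) * s_coeff i j p + s_coeff k l q * s_coeff i j (p + 1)"
  "coeff2 (p + 2) (q + 2) (S_v k l * (x_ser * y_ser * theta a b) * S_u i j * (y_ser - x_ser)) =
     theta a b * (s_coeff k l q * s_coeff i j (p + 1)) - theta a b * (s_coeff k l (q + 1) * s_coeff i j p)"
  "coeff2 (p + 2) (q + 2) (S_v k l * (x_ser * y_ser * theta a b) * S_u i j * (x_ser * y_ser)) =
     theta a b * (s_coeff k l q * s_coeff i j p)"
  by (simp_all add: distrib_left distrib_right left_diff_distrib right_diff_distrib mult.assoc central_rules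
      coeff2_add coeff2_diff coeff2_x coeff2_y coeff2_theta coeff2_uv coeff2_vu add.commute)

lemma quaternary_coeff:
  assumes ik: "i \<in> index_set n" "k \<in> index_set n" and jl: "j \<in> index_set n" "l \<in> index_set n"
  shows "coeff2 (p + 2) (q + 2) (quaternary_lhs n (i, k) (j, l) - quaternary_rhs n (i, k) (j, l)) =
    s_coeff i j (p + 2) * s_coeff k l q - s_coeff i j p * s_coeff k l (q + 2)
    - (s_coeff k j p * s_coeff i l (q + 1) + s_coeff k j (p + 1) * s_coeff i l q)
    + (theta (- k) j * (s_coeff i (- k) (p + 1) * s_coeff (- j) l q) - theta (- k) j * (s_coeff i (- k) p * s_coeff (- j) l (q + 1))
       - theta (- i) j * (s_coeff k (- i) p * s_coeff (- j) l q))
    - (s_coeff k l q * s_coeff i j (p + 2) - s_coeff k l (q + 2) * s_coeff i j p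
       + (theta i (- l) * (s_coeff k (- i) q * s_coeff (- l) j (p + 1)) - theta i (- l) * (s_coeff k (- i) (q + 1) * s_coeff (- l) j p))
       - (s_coeff k j (q + 1) * s_coeff i l p + s_coeff k j q * s_coeff i l (p + 1)
         + theta i (- j) * (s_coeff k (- i) q * (s_coeff (- j) l p :: 'k::field free_alg))))"
  unfolding quaternary_lhs_entry[OF assms] quaternary_rhs_entry[OF assms]
    distrib_right[of "S_v _ _ * (x_ser + y_ser) * S_u _ _"] left_diff_distrib[of "(y_ser - x_ser) * S_u _ _ * _"]
    coeff2_diff coeff2_add coeff2_lhs_terms coeff2_rhs_terms by (rule refl)

section \<open>The generators as operators\<close>

lemma symmetry_coeff:
  "fps_nth (2 * mat_prime S_neg_mat i j - (2 * S_mat i j - fps_X * (S_mat i j - S_neg_mat i j))) r =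
    2 * (theta i j * ((- 1) ^ r * s_gen (- j) (- i) r)) -
      (2 * s_gen i j r - (if r = 0 then 0 else s_gen i j (r - 1) - (- 1) ^ (r - 1) * s_gen i j (r - 1) :: 'k::field free_alg))"
proof -
  have two: "fps_nth (2 * F) r = 2 * fps_nth F r" for F :: "'k free_alg fps"
    by (simp add: numeral_fps_const)
  have th: "fps_nth (theta i j * F) r = theta i j * fps_nth F r" for F :: "'k free_alg fps"
    unfolding theta_def of_int_fps by simp
  show ?thesis
    by (simp add: two th mat_prime_def S_neg_mat_def S_mat_def fps_X_mult_nth)
qed

lemma theta_in_carrier: "theta i j \<in> carrier (free_algebra n)"
  unfolding theta_def of_int_eq_scalar by (rule scalar_in_carrier)

lemma minus_one_power_mult_in_carrier:
  "a \<in> carrier (free_algebra n) \<Longrightarrow> (- 1) ^ r * a \<in> carrier (free_algebra n)"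
  by (cases "even r") (simp_all add: carrier_free_algebra_uminus)

lemmas free_algebra_closed = carrier_free_algebra_add carrier_free_algebra_diff carrier_free_algebra_mult
  carrier_free_algebra_uminus theta_in_carrier s_coeff_in_carrier s_gen_in_carrier free_algebra_0 free_algebra_1

lemma two_mult_in_carrier: "a \<in> carrier (free_algebra n) \<Longrightarrow> 2 * a \<in> carrier (free_algebra n)"
  by (simp add: mult_2 carrier_free_algebra_add)

text \<open>Required for the generated set to be an ideal that contains the relators. The
  coefficient formula is used at indices \<open>p - 2\<close> and \<open>q - 2\<close>, which may be
  negative.\<close>

lemma relators_in_carrier:
  "quaternary_relators n \<union> symmetry_relators n \<subseteq> carrier (free_algebra n :: 'k::field free_alg ring)"
proof
  fix r :: "'k free_alg" assume "r \<in> quaternary_relators n \<union> symmetry_relators n"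
  then show "r \<in> carrier (free_algebra n)"
  proof
    assume "r \<in> quaternary_relators n"
    then obtain i k j l p q where r: "r = fps_nth (fps_nth (quaternary_lhs n (i, k) (j, l) - quaternary_rhs n (i, k) (j, l)) q) p"
      and I: "i \<in> index_set n" "k \<in> index_set n" "j \<in> index_set n" "l \<in> index_set n"
      unfolding quaternary_relators_def by fastforce
    have "r = coeff2 ((int p - 2) + 2) ((int q - 2) + 2) (quaternary_lhs n (i, k) (j, l) - quaternary_rhs n (i, k) (j, l))"
      unfolding r by (simp add: coeff2_def)
    also have "\<dots> \<in> carrier (free_algebra n)"
      unfolding quaternary_coeff[OF I] by (intro free_algebra_closed) (use I in simp_all)
    finally show ?thesis .
  next
    assume "r \<in> symmetry_relators n"
    then obtain i j m where r: "r = fps_nth (2 * mat_prime S_neg_mat i j - (2 * S_mat i j - fps_X * (S_mat i j - S_neg_mat i j))) m"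
      and I: "i \<in> index_set n" "j \<in> index_set n"
      unfolding symmetry_relators_def by blast
    show ?thesis unfolding r symmetry_coeff
      by (cases "m = 0") (use I in \<open>auto intro!: free_algebra_closed minus_one_power_mult_in_carrier two_mult_in_carrier\<close>)
  qed
qed

lemma Y_ideal_ideal: "ideal (Y_ideal n) (free_algebra n)"
  unfolding Y_ideal_def by (rule ring.genideal_ideal[OF ring_free_algebra relators_in_carrier])

lemma zero_in_Y_ideal: "0 \<in> Y_ideal n"
  using additive_subgroup.zero_closed[OF ideal.axioms(1)[OF Y_ideal_ideal], of n] by simp

lemma relator_in_Y_ideal: "r \<in> quaternary_relators n \<union> symmetry_relators n \<Longrightarrow> r \<in> Y_ideal n"
  using ring.genideal_self[OF ring_free_algebra relators_in_carrier] unfolding Y_ideal_def by blast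

locale yangian_module = fin_vector_space scale
  for scale :: "'k::alg_closed_field \<Rightarrow> 'v::ab_group_add \<Rightarrow> 'v" +
  fixes n :: nat and \<pi> :: "'k free_alg set \<Rightarrow> 'v \<Rightarrow> 'v"
  assumes module: "Y_module n scale \<pi>" and two_nonzero: "(2::'k) \<noteq> 0"
begin

text \<open>The action pulled back to the free algebra, where relators act by zero and so turn into
  identities between operators.\<close>

definition op :: "'k free_alg \<Rightarrow> 'v \<Rightarrow> 'v" where "op a = \<pi> (Y_class n a)"

lemma Y_class_hom: "Y_class n \<in> ring_hom (free_algebra n) (Y_sp n)"
  using ideal.rcos_ring_hom[OF Y_ideal_ideal, of n] unfolding Y_sp_def Y_class_def .

lemma op_hom: "op \<in> ring_hom (free_algebra n) (End_ring scale)"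
proof -
  have "\<pi> \<in> ring_hom (Y_sp n) (End_ring scale)" using module by (simp add: Y_module_def)
  then have "\<pi> \<circ> Y_class n \<in> ring_hom (free_algebra n) (End_ring scale)" using Y_class_hom by (rule ring_hom_trans[rotated])
  moreover have "op = \<pi> \<circ> Y_class n" by (simp add: fun_eq_iff op_def)
  ultimately show ?thesis by simp
qed

lemma op_lin: "a \<in> carrier (free_algebra n) \<Longrightarrow> lin (op a)"
  using ring_hom_closed[OF op_hom] by (simp add: End_ring_def)

context
  fixes a b :: "'k free_alg"
  assumes ab: "a \<in> carrier (free_algebra n)" "b \<in> carrier (free_algebra n)"
begin

lemma op_add: "op (a + b) v = op a v + op b v"
  using ring_hom_add[OF op_hom ab] by (simp add: End_ring_def)

lemma op_mult: "op (a * b) v = op a (op b v)"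
  using ring_hom_mult[OF op_hom ab] by (simp add: End_ring_def)

end

lemma op_one: "op 1 v = v"
  using ring_hom_one[OF op_hom] by (simp add: End_ring_def)

lemma op_zero: "op 0 v = 0"
  using op_add[OF free_algebra_0 free_algebra_0, of v] by simp

lemma op_uminus: "a \<in> carrier (free_algebra n) \<Longrightarrow> op (- a) v = - op a v"
  using op_add[of a "- a" v] op_zero[of v] by (simp add: carrier_free_algebra_uminus eq_neg_iff_add_eq_0 add.commute)

lemma op_diff: "a \<in> carrier (free_algebra n) \<Longrightarrow> b \<in> carrier (free_algebra n) \<Longrightarrow> op (a - b) v = op a v - op b v"
  using op_add[of a "- b" v] op_uminus[of b v] by (simp add: carrier_free_algebra_uminus)

lemma op_theta: "op (theta i j) v = scale (theta i j) v"
  using module unfolding op_def theta_def of_int_eq_scalar by (simp add: Y_module_def)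

lemma op_Y_ideal: "a \<in> Y_ideal n \<Longrightarrow> op a v = 0"
proof -
  assume a: "a \<in> Y_ideal n"
  interpret ideal "Y_ideal n :: 'k free_alg set" "free_algebra n" by (rule Y_ideal_ideal)
  have "Y_class n a = Y_class n 0"
    using a_rcos_const[OF a] a_rcos_const[OF zero_in_Y_ideal] by (metis Y_class_def)
  then show ?thesis using op_zero[of v] by (simp add: op_def)
qed

definition S :: "int \<Rightarrow> int \<Rightarrow> int \<Rightarrow> 'v \<Rightarrow> 'v" where "S i j r = op (s_coeff i j r)"

lemma S_eq: "r \<ge> 0 \<Longrightarrow> S i j r = \<pi> (s_Y n i j (nat r))"
  by (simp add: S_def op_def s_Y_def s_coeff_def)

lemma S_neg: "r < 0 \<Longrightarrow> S i j r v = 0"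
  by (simp add: S_def s_coeff_def op_zero)

lemma S_0: "S i j 0 v = (if i = j then v else 0)"
  by (simp add: S_def s_coeff_def s_gen_def op_zero op_one)

context
  fixes i j assumes ij: "i \<in> index_set n" "j \<in> index_set n"
begin

lemma S_lin: "lin (S i j r)"
  unfolding S_def by (rule op_lin) (use ij s_coeff_in_carrier in auto)

lemma quaternary:
  assumes kl: "k \<in> index_set n" "l \<in> index_set n"
  shows "S i j (p + 2) (S k l q v) - S i j p (S k l (q + 2) v)
    - (S k j p (S i l (q + 1) v) + S k j (p + 1) (S i l q v))
    + (scale (theta (- k) j) (S i (- k) (p + 1) (S (- j) l q v)) - scale (theta (- k) j) (S i (- k) p (S (- j) l (q + 1) v))
       - scale (theta (- i) j) (S k (- i) p (S (- j) l q v)))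
    - (S k l q (S i j (p + 2) v) - S k l (q + 2) (S i j p v)
       + (scale (theta i (- l)) (S k (- i) q (S (- l) j (p + 1) v)) - scale (theta i (- l)) (S k (- i) (q + 1) (S (- l) j p v)))
       - (S k j (q + 1) (S i l p v) + S k j q (S i l (p + 1) v)
         + scale (theta i (- j)) (S k (- i) q (S (- j) l p v)))) = 0"
proof -
  let ?F = "quaternary_lhs n (i, k) (j, l) - quaternary_rhs n (i, k) (j, l) :: 'k free_alg fps fps"
  have "coeff2 (p + 2) (q + 2) ?F \<in> Y_ideal n"
  proof (cases "p + 2 < 0 \<or> q + 2 < 0")
    case True
    show ?thesis using True zero_in_Y_ideal by (simp add: coeff2_def)
  next
    case False
    then have "coeff2 (p + 2) (q + 2) ?F \<in> quaternary_relators n"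
      unfolding quaternary_relators_def coeff2_def using ij kl by fastforce
    then show ?thesis using relator_in_Y_ideal by blast
  qed
  from op_Y_ideal[OF this, of v] show ?thesis
    unfolding quaternary_coeff[OF ij(1) kl(1) ij(2) kl(2)] S_def
    using ij kl by (simp add: op_add op_diff op_mult op_theta free_algebra_closed)
qed

text \<open>The factor \<open>1 + (- 1)^r\<close> is \<open>1 - (- 1)^(r - 1)\<close>, from the
  difference of the series at \<open>u\<close> and \<open>- u\<close>; it vanishes for odd
  \<open>r\<close>.\<close>

lemma symmetry:
  "scale (2 * theta i j * (- 1) ^ nat r) (S (- j) (- i) r v) = scale 2 (S i j r v) - scale (1 + (- 1) ^ nat r) (S i j (r - 1) v)"
proof (cases "r < 0")
  case True
  then show ?thesis by (simp add: S_neg)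
next
  case False
  define m where "m = nat r"
  have r: "r = int m" using False by (simp add: m_def)
  have c: "s_coeff a b (int m) = (s_gen a b m :: 'k free_alg)" for a b by (simp add: s_coeff_def)
  let ?x = "2 * (theta i j * ((- 1) ^ m * s_gen (- j) (- i) m)) -
      (2 * s_gen i j m - (if m = 0 then 0 else s_gen i j (m - 1) - (- 1) ^ (m - 1) * s_gen i j (m - 1))) :: 'k free_alg"
  have "?x \<in> symmetry_relators n"
    unfolding symmetry_relators_def symmetry_coeff[symmetric] using ij by blast
  then have 0: "op ?x v = 0" using relator_in_Y_ideal op_Y_ideal by blast
  have two: "op (2 * a) v = scale 2 (op a v)" if "a \<in> carrier (free_algebra n)" for a v
    using op_add[OF that that, of v] scale_left_distrib[of 1 1 "op a v"] by (simp add: mult_2)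
  have sgn: "op ((- 1) ^ k * a) v = scale ((- 1) ^ k) (op a v)" if "a \<in> carrier (free_algebra n)" for a v k
    by (cases "even k") (simp_all add: op_uminus that)
  have inC: "s_gen a b k \<in> carrier (free_algebra n)" "(- 1) ^ k * s_gen a b k \<in> carrier (free_algebra n)"
    if "a \<in> index_set n" "b \<in> index_set n" for a b k
    using that by (auto intro: minus_one_power_mult_in_carrier s_gen_in_carrier)
  have prev: "op (if m = 0 then 0 else s_gen i j (m - 1) - (- 1) ^ (m - 1) * s_gen i j (m - 1)) v = scale (1 + (- 1) ^ m) (S i j (r - 1) v)"
  proof (cases m)
    case 0
    then show ?thesis using S_neg[of "r - 1" i j v] r by (simp add: op_zero)
  next
    case (Suc m')
    have "S i j (r - 1) = op (s_gen i j m')" using Suc r by (simp add: S_def s_coeff_def)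
    then show ?thesis using Suc ij
      by (simp add: op_diff inC sgn scale_left_diff_distrib)
  qed
  have "op ?x v = scale 2 (scale (theta i j) (scale ((- 1) ^ m) (op (s_gen (- j) (- i) m) v))) -
      (scale 2 (op (s_gen i j m) v) - op (if m = 0 then 0 else s_gen i j (m - 1) - (- 1) ^ (m - 1) * s_gen i j (m - 1)) v)"
    using ij by (subst op_diff, simp_all add: two op_diff op_mult op_theta sgn inC free_algebra_closed two_mult_in_carrier)
  then show ?thesis
    unfolding prev 0 using r by (simp add: S_def c eq_diff_eq mult.assoc)
qed

end

end

context yangian_module begin

lemma S_1_sym:
  assumes "a \<in> index_set n" "b \<in> index_set n"
  shows "S a b 1 v = - scale (theta a b) (S (- b) (- a) 1 v)"
proof -
  have "scale 2 (S a b 1 v) = scale 2 (- scale (theta a b) (S (- b) (- a) 1 v))"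
    using symmetry[OF assms, of 1 v] by simp
  then show ?thesis using two_nonzero by (metis scale_left_imp_eq)
qed

text \<open>The case \<open>p = - 1\<close> of \<open>quaternary\<close>: coefficients of index - 1
  vanish and those of index 0 are Kronecker deltas, which leaves the adjoint action of the Lie
  algebra on the generators.\<close>

lemma lie_action:
  assumes "a \<in> index_set n" "b \<in> index_set n" "c \<in> index_set n" "d \<in> index_set n"
  shows "S a b 1 (S c d q v) - S c d q (S a b 1 v) =
        (if b = c then S a d q v else 0) - (if a = d then S c b q v else 0)
        - (if a = - c then scale (theta (- c) b) (S (- b) d q v) else 0)
        + (if b = - d then scale (theta a (- d)) (S c (- a) q v) else 0)"
proof -
  have z: "S i j r 0 = 0" if "i \<in> index_set n" "j \<in> index_set n" for i j r
    by (rule lin_0[OF S_lin[OF that]])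
  have e1: "S c b 0 w = (if b = c then w else 0)" for w by (auto simp: S_0)
  have e2: "S a d 0 w = (if a = d then w else 0)" for w by (simp add: S_0)
  have e3: "S a (- c) 0 w = (if a = - c then w else 0)" for w by (simp add: S_0)
  have e4: "S (- d) b 0 w = (if b = - d then w else 0)" for w by (auto simp: S_0)
  have "S a b 1 (S c d q v) - (if b = c then S a d q v else 0)
     + (if a = - c then scale (theta (- c) b) (S (- b) d q v) else 0)
     - (S c d q (S a b 1 v) + (if b = - d then scale (theta a (- d)) (S c (- a) q v) else 0) - (if a = d then S c b q v else 0)) = 0"
    using quaternary[OF assms(1,2) assms(3,4), of "- 1" q v] assms
    by (simp add: S_neg z e1 e2 e3 e4 if_distrib[of "S _ _ _"] if_distrib[of "scale _"] cong: if_cong)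
  then show ?thesis by (simp add: algebra_simps)
qed

end

section \<open>The highest weight vector\<close>

lemma of_int_eq_imp_eq:
  assumes "of_int x = (of_int y :: 'k::ring_1)" and "CHAR('k) > 0 \<Longrightarrow> \<bar>x - y\<bar> < int CHAR('k)"
  shows "x = y"
proof -
  have "of_int (x - y) = (0 :: 'k)" using assms(1) by simp
  then have dvd: "int CHAR('k) dvd x - y" by (simp only: of_int_eq_0_iff_char_dvd)
  show ?thesis
  proof (cases "CHAR('k) > 0")
    case True
    then have "x - y = 0" using dvd assms(2) by (metis abs_0_eq abs_of_nat dvd_imp_le_int linorder_not_less)
    then show ?thesis by simp
  next
    case False
    then show ?thesis using dvd by simp
  qed
qed

text \<open>The arguments from here on concern operators and the relations between them; the
  quotient algebra returns only for the highest weight representation.\<close>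

locale yangian_alcove = alcove_module scale n \<rho> T k \<kappa> W
  for scale :: "'k::alg_closed_field \<Rightarrow> 'v::ab_group_add \<Rightarrow> 'v" and n \<rho> T k \<kappa> W +
  fixes S :: "int \<Rightarrow> int \<Rightarrow> int \<Rightarrow> 'v \<Rightarrow> 'v"
  assumes T_eq: "T a b = S a b 1"
    and S_lin: "a \<in> index_set n \<Longrightarrow> b \<in> index_set n \<Longrightarrow> lin (S a b r)"
    and S_neg: "r < 0 \<Longrightarrow> S a b r v = 0"
    and S_0: "S a b 0 v = (if a = b then v else 0)"
    and lie_action: "a \<in> index_set n \<Longrightarrow> b \<in> index_set n \<Longrightarrow> c \<in> index_set n \<Longrightarrow> d \<in> index_set n \<Longrightarrow>
      T a b (S c d q v) - S c d q (T a b v) =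
        (if b = c then S a d q v else 0) - (if a = d then S c b q v else 0)
        - (if a = - c then scale (theta (- c) b) (S (- b) d q v) else 0)
        + (if b = - d then scale (theta a (- d)) (S c (- a) q v) else 0)"
    and quaternary: "a \<in> index_set n \<Longrightarrow> b \<in> index_set n \<Longrightarrow> c \<in> index_set n \<Longrightarrow> d \<in> index_set n \<Longrightarrow>
      S a b (p + 2) (S c d q v) - S a b p (S c d (q + 2) v)
      - (S c b p (S a d (q + 1) v) + S c b (p + 1) (S a d q v))
      + (scale (theta (- c) b) (S a (- c) (p + 1) (S (- b) d q v)) - scale (theta (- c) b) (S a (- c) p (S (- b) d (q + 1) v))
         - scale (theta (- a) b) (S c (- a) p (S (- b) d q v)))
      - (S c d q (S a b (p + 2) v) - S c d (q + 2) (S a b p v)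
         + (scale (theta a (- d)) (S c (- a) q (S (- d) b (p + 1) v)) - scale (theta a (- d)) (S c (- a) (q + 1) (S (- d) b p v)))
         - (S c b (q + 1) (S a d p v) + S c b q (S a d (p + 1) v)
           + scale (theta a (- b)) (S c (- a) q (S (- b) d p v)))) = 0"
    and symmetry: "a \<in> index_set n \<Longrightarrow> b \<in> index_set n \<Longrightarrow>
      scale (2 * theta a b * (- 1) ^ nat r) (S (- b) (- a) r v) = scale 2 (S a b r v) - scale (1 + (- 1) ^ nat r) (S a b (r - 1) v)"
    and nontrivial: "\<exists>v :: 'v. v \<noteq> 0"
begin

lemma S_zero: "a \<in> I \<Longrightarrow> b \<in> I \<Longrightarrow> S a b r 0 = 0"
  by (rule lin_0[OF S_lin])

lemma T_zero: "a \<in> I \<Longrightarrow> b \<in> I \<Longrightarrow> T a b 0 = 0"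
  by (rule lin_0[OF T_lin])

definition top_index :: nat where
  "top_index = (SOME j. j \<in> {1..k} \<and> (\<forall>j'\<in>{1..k}. height n (\<kappa> j') \<le> height n (\<kappa> j)))"

abbreviation top :: "nat \<Rightarrow> int" where "top \<equiv> \<kappa> top_index"

lemma top_index: "top_index \<in> {1..k}" "j \<in> {1..k} \<Longrightarrow> height n (\<kappa> j) \<le> height n top"
proof -
  obtain v :: 'v where "v \<noteq> 0" using nontrivial by blast
  then have ne: "{1..k} \<noteq> {}" using nonzero_component by (metis empty_iff)
  have "\<exists>j. j \<in> {1..k} \<and> (\<forall>j'\<in>{1..k}. height n (\<kappa> j') \<le> height n (\<kappa> j))"
  proof -
    have "Max ((\<lambda>j. height n (\<kappa> j)) ` {1..k}) \<in> (\<lambda>j. height n (\<kappa> j)) ` {1..k}" using ne by (intro Max_in) auto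
    then obtain j where j: "j \<in> {1..k}" "height n (\<kappa> j) = Max ((\<lambda>j. height n (\<kappa> j)) ` {1..k})" by auto
    have "height n (\<kappa> j') \<le> height n (\<kappa> j)" if "j' \<in> {1..k}" for j'
      unfolding j(2) using that by (intro Max_ge) auto
    then show ?thesis using j(1) by blast
  qed
  from someI_ex[OF this] show "top_index \<in> {1..k}" "j \<in> {1..k} \<Longrightarrow> height n (\<kappa> j) \<le> height n top"
    unfolding top_index_def[symmetric] by blast+
qed

lemma kappa_bound: "j \<in> {1..k} \<Longrightarrow> i \<in> {1..n} \<Longrightarrow> CHAR('k) > 0 \<Longrightarrow> 0 \<le> - \<kappa> j i \<and> - \<kappa> j i \<le> int CHAR('k) - 3"
  using weight_bound[of j "\<kappa> j" i] W_weight[of j] kappa_nonpos[of j i] by force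

text \<open>The coordinates lie in an interval of length \<open>CHAR('k) - 3\<close>. A shift by at
  most 2, the size of a root coordinate, keeps congruent values less than \<open>CHAR('k)\<close>
  apart.\<close>

lemma kappa_window:
  assumes "j \<in> {1..k}" "j' \<in> {1..k}" "i \<in> {1..n}" "i' \<in> {1..n}" "\<bar>d\<bar> \<le> 2"
    and "of_int (\<kappa> j i) = (of_int (\<kappa> j' i' + d) :: 'k)"
  shows "\<kappa> j i = \<kappa> j' i' + d"
  by (rule of_int_eq_imp_eq[OF assms(6)]) (use kappa_bound[OF assms(1,3)] kappa_bound[OF assms(2,4)] assms(5) in linarith)

text \<open>The labels are integers but the condition only sees them modulo the characteristic: that
  is all that commutation with \<open>T\<close> tells about \<open>S a b r v\<close>.\<close>

definition lie_weight :: "(nat \<Rightarrow> int) \<Rightarrow> 'v \<Rightarrow> bool" where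
  "lie_weight \<eta> v \<longleftrightarrow> (\<forall>i\<in>{1..n}. T (int i) (int i) v = scale (of_int (\<eta> i)) v)"

lemma lie_weight_S:
  assumes v: "lie_weight \<eta> v" and ab: "a \<in> I" "b \<in> I"
  shows "lie_weight (\<lambda>i. \<eta> i + root_weight a b i) (S a b r v)"
  unfolding lie_weight_def
proof
  fix i assume i: "i \<in> {1..n}"
  have iI: "int i \<in> I" using i by (auto simp: index_set_iff)
  have "T (int i) (int i) (S a b r v) = S a b r (T (int i) (int i) v) + scale (of_int (root_weight a b i)) (S a b r v)"
  proof -
    have "T (int i) (int i) (S a b r v) - S a b r (T (int i) (int i) v) = scale (of_int (root_weight a b i)) (S a b r v)"
      unfolding lie_action[OF iI iI ab]
      using i ab by (auto simp: root_weight_def index_weight_def theta_eq index_set_iff scale_left_diff_distrib scale_left_distrib)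
    then show ?thesis by (simp add: algebra_simps)
  qed
  then show "T (int i) (int i) (S a b r v) = scale (of_int (\<eta> i + root_weight a b i)) (S a b r v)"
    using v i by (simp add: lie_weight_def lin_scale[OF S_lin[OF ab]] scale_left_distrib)
qed

definition singular :: "'v \<Rightarrow> bool" where
  "singular v \<longleftrightarrow> (\<forall>a\<in>I. \<forall>b\<in>I. a < b \<longrightarrow> T a b v = 0)"

lemma singular_weight_congruent:
  assumes "v \<noteq> 0" "lie_weight \<eta> v" "singular v"
  shows "\<exists>j\<in>{1..k}. \<forall>i\<in>{1..n}. of_int (\<kappa> j i) = (of_int (\<eta> i) :: 'k)"
proof -
  have p: "(- 1, 1) \<in> simple_pairs" by (simp add: simple_pairs_def)
  have s: "T c d v = 0" if "(c, d) \<in> simple_pairs" for c d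
    using simple_pairs_in[OF that] assms(3) by (auto simp: singular_def)
  have e: "(T (- 1) 1 ^^ q) v = (if q = 0 then v else 0)" for q
    by (induction q) (use s[OF p] simple_pairs_in[OF p] T_zero in auto)
  have "\<exists>j\<in>{1..k}. \<exists>q\<le>0. is_weight n scale \<rho> (W j) (\<lambda>i. \<kappa> j i - int q * root_weight (- 1) 1 i) \<and>
    (\<forall>i\<in>{1..n}. of_int (\<kappa> j i - int q * root_weight (- 1) 1 i) = (of_int (\<eta> i) :: 'k))"
  proof (rule root_string_weight[OF p assms(1)])
    show "T (int i) (int i) v = scale (of_int (\<eta> i)) v" if "i \<in> {1..n}" for i
      using assms(2) that by (simp add: lie_weight_def)
    show "T c d ((T (- 1) 1 ^^ q) v) = 0" if "(c, d) \<in> simple_pairs" for c d q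
      unfolding e using s[OF that] simple_pairs_in[OF that] T_zero by simp
    show "(T (- 1) 1 ^^ Suc 0) v = 0" unfolding e by simp
  qed
  then show ?thesis by auto
qed

definition Xi :: "'v set" where "Xi = {v. lie_weight top v \<and> singular v}"

lemma Xi_subspace: "subspace Xi"
proof -
  have i: "int i \<in> I" if "i \<in> {1..n}" for i using that by (auto simp: index_set_iff)
  show ?thesis
    by (rule subspaceI)
       (auto simp: Xi_def lie_weight_def singular_def T_zero i lin_add[OF T_lin] lin_scale[OF T_lin] scale_right_distrib mult.commute)
qed

lemma Xi_nontrivial: "Xi \<noteq> {0}"
proof -
  obtain w where w: "w \<in> W top_index" "w \<noteq> 0" "weight top w" using W_weight[OF top_index(1)] by (auto simp: is_weight_def)
  have "T a b w = 0" if ab: "a \<in> I" "b \<in> I" "a < b" for a b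
  proof (rule ccontr)
    assume nz: "T a b w \<noteq> 0"
    let ?\<nu> = "\<lambda>i. top i + root_weight a b i"
    have "weight ?\<nu> (T a b w)" using weight_T_root[OF w(3)] ab by simp
    moreover have "T a b w \<in> W top_index" using T_in_submodule[OF W_submodule[OF top_index(1)] w(1)] ab by simp
    ultimately have "weight_le n ?\<nu> top" using W_weight_le[OF top_index(1)] nz by (auto simp: is_weight_def)
    then have "height n ?\<nu> \<le> height n top" by (rule weight_le_height)
    moreover have "height n ?\<nu> = height n top + (b - a)"
      using height_add_mult[of n top 1 "root_weight a b"] height_root_weight[OF ab(1,2)] by simp
    ultimately show False using ab by simp
  qed
  then have "w \<in> Xi" using weight_T_diag_pos[OF w(3)] by (auto simp: Xi_def lie_weight_def singular_def)
  then show ?thesis using w(2) by blast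
qed

lemma root_weight_abs: "a \<in> I \<Longrightarrow> b \<in> I \<Longrightarrow> \<bar>root_weight a b i\<bar> \<le> 2"
  by (auto simp: root_weight_def index_weight_def)

text \<open>Downward induction on \<open>b - a\<close>. Brackets of raising operators with
  \<open>S a b r\<close> involve generators of larger index difference, so \<open>S a b r v\<close>
  is singular. If it were nonzero, some summand would have a highest weight above the maximal
  one.\<close>

lemma S_raising_Xi:
  assumes v: "v \<in> Xi" and ab: "a \<in> I" "b \<in> I" "a < b"
  shows "S a b r v = 0"
  using ab
proof (induction "nat (2 * int n - (b - a))" arbitrary: a b rule: less_induct)
  case less
  have lt: "S c d r v = 0" if "c \<in> I" "d \<in> I" "d - c > b - a" for c d
  proof (rule less.hyps)
    have "d - c \<le> 2 * int n" using that by (auto simp: index_set_iff)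
    then show "nat (2 * int n - (d - c)) < nat (2 * int n - (b - a))" using that by auto
  qed (use that less.prems in auto)
  have sing: "singular v" and lw: "lie_weight top v" using v by (auto simp: Xi_def)
  show ?case
  proof (rule ccontr)
    assume nz: "S a b r v \<noteq> 0"
    have "singular (S a b r v)"
      unfolding singular_def
    proof (intro ballI impI)
      fix c d assume cd: "c \<in> I" "d \<in> I" "c < d"
      have "T c d (S a b r v) = T c d (S a b r v) - S a b r (T c d v)"
        using sing cd S_zero less.prems by (simp add: singular_def)
      also have "\<dots> = 0"
        unfolding lie_action[OF cd(1,2) less.prems(1,2)] using cd less.prems by (simp add: lt)
      finally show "T c d (S a b r v) = 0" .
    qed
    then obtain j where j: "j \<in> {1..k}" "\<And>i. i \<in> {1..n} \<Longrightarrow> of_int (\<kappa> j i) = (of_int (top i + root_weight a b i) :: 'k)"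
      using singular_weight_congruent[OF nz lie_weight_S[OF lw less.prems(1,2)]] by blast
    have "\<kappa> j i = top i + root_weight a b i" if i: "i \<in> {1..n}" for i
      by (rule kappa_window[OF j(1) top_index(1) i i root_weight_abs[OF less.prems(1,2)] j(2)[OF i]])
    then have "height n (\<kappa> j) = height n (\<lambda>i. top i + 1 * root_weight a b i)" unfolding height_def by simp
    also have "\<dots> = height n top + (b - a)" unfolding height_add_mult using less.prems by (simp add: height_root_weight)
    finally show False using top_index(2)[OF j(1)] less.prems by simp
  qed
qed

lemma S_diag_Xi:
  assumes v: "v \<in> Xi" and a: "a \<in> I"
  shows "S a a r v \<in> Xi"
proof -
  have sing: "singular v" and lw: "lie_weight top v" using v by (auto simp: Xi_def)
  have "lie_weight top (S a a r v)" using lie_weight_S[OF lw a a] by (simp add: root_weight_def)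
  moreover have "singular (S a a r v)"
    unfolding singular_def
  proof (intro ballI impI)
    fix c d assume cd: "c \<in> I" "d \<in> I" "c < d"
    have "T c d (S a a r v) = T c d (S a a r v) - S a a r (T c d v)"
      using sing cd S_zero a by (simp add: singular_def)
    also have "\<dots> = 0"
      unfolding lie_action[OF cd(1,2) a a] using cd a by (auto simp: S_raising_Xi[OF v] index_set_iff)
    finally show "T c d (S a a r v) = 0" .
  qed
  ultimately show ?thesis by (simp add: Xi_def)
qed

subsection \<open>The subspace on which the relations of the Yangian of \<open>gl\<^sub>n\<close> hold\<close>

text \<open>On this space the terms with \<open>P'\<close> drop out of the quaternary relation for
  positive indices, and what remains is the relation of the Yangian of gl_n multiplied by
  \<open>u + v\<close>.\<close>

definition VJ :: "'v set" where
  "VJ = {v. \<forall>a\<in>I. \<forall>b\<in>I. a < 0 \<longrightarrow> 0 < b \<longrightarrow> (\<forall>r. S a b r v = 0)}"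

lemma VJ_zero: "v \<in> VJ \<Longrightarrow> a \<in> I \<Longrightarrow> b \<in> I \<Longrightarrow> a < 0 \<Longrightarrow> 0 < b \<Longrightarrow> S a b r v = 0"
  by (auto simp: VJ_def)

lemma VJ_subspace: "subspace VJ"
  by (rule subspaceI) (auto simp: VJ_def S_zero lin_add[OF S_lin] lin_scale[OF S_lin])

lemma Xi_VJ: "v \<in> Xi \<Longrightarrow> v \<in> VJ"
  using S_raising_Xi by (auto simp: VJ_def)

text \<open>Modulo vanishing terms the relation moves two units of index from \<open>S a b\<close>
  to \<open>S c d\<close>. After finitely many moves \<open>S a b\<close> has index 0 or - 1 and is
  zero, as \<open>a \<noteq> b\<close>.\<close>

lemma S_VJ:
  assumes v: "v \<in> VJ" and cd: "c \<in> I" "d \<in> I" "0 < c" "0 < d"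
  shows "S c d q v \<in> VJ"
proof -
  have "S a b r (S c d q v) = 0" if ab: "a \<in> I" "b \<in> I" "a < 0" "0 < b" for a b r
  proof -
    have step: "S a b (p + 2) (S c d q v) = S a b p (S c d (q + 2) v)" for p q
      using quaternary[OF ab(1,2) cd(1,2), of p q v] ab cd by (simp add: VJ_zero[OF v] S_zero)
    have "S a b (int m - 2) (S c d q v) = 0" for m q
    proof (induction m arbitrary: q rule: less_induct)
      case (less m)
      consider "m < 2" | "m = 2" | m' where "m = Suc (Suc (Suc m'))"
        by (metis One_nat_def Suc_1 less_2_cases_iff nat.exhaust)
      then show ?case
      proof cases
        case 1 then show ?thesis by (simp add: S_neg)
      next
        case 2 then show ?thesis using ab by (simp add: S_0)
      next
        case 3
        have "S a b (int m - 2) (S c d q v) = S a b (int (m - 2) - 2 + 2) (S c d q v)" using 3 by (simp add: algebra_simps)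
        also have "\<dots> = S a b (int (m - 2) - 2) (S c d (q + 2) v)" by (rule step)
        also have "\<dots> = 0" by (rule less) (use 3 in simp)
        finally show ?thesis .
      qed
    qed
    from this[of "nat (r + 2)" q] show ?thesis by (cases "r < 0") (simp_all add: S_neg)
  qed
  then show ?thesis by (auto simp: VJ_def)
qed

text \<open>\<open>E p q\<close> is the defect of the relation. The quaternary relation says that
  multiplication by \<open>u + v\<close> kills it, i.e. \<open>E (p + 1) q = - E p (q + 1)\<close>,
  and it vanishes for negative \<open>p\<close>.\<close>

lemma gl_relation:
  assumes v: "v \<in> VJ" and I: "a \<in> I" "b \<in> I" "c \<in> I" "d \<in> I" and pos: "0 < a" "0 < b" "0 < c" "0 < d"
  shows "S a b (p + 1) (S c d q v) - S c d q (S a b (p + 1) v) - S a b p (S c d (q + 1) v) + S c d (q + 1) (S a b p v) =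
    S c b p (S a d q v) - S c b q (S a d p v)"
proof -
  define E where "E p q = S a b (p + 1) (S c d q v) - S c d q (S a b (p + 1) v) - S a b p (S c d (q + 1) v) + S c d (q + 1) (S a b p v)
    - (S c b p (S a d q v) - S c b q (S a d p v))" for p q
  have step: "E (p + 1) q + E p (q + 1) = 0" for p q
    using quaternary[OF I, of p q v] I pos
    by (simp add: VJ_zero[OF v] S_zero E_def) (simp add: algebra_simps)
  have "E (int m - 2) q = 0" for m q
  proof (induction m arbitrary: q)
    case 0
    then show ?case using I by (simp add: E_def S_neg S_zero)
  next
    case (Suc m)
    show ?case
    proof (cases m)
      case 0
      then show ?thesis using I by (simp add: E_def S_neg S_zero S_0)
    next
      case (Suc m')
      have "E (int m - 2 + 1) q = 0" using step[of "int m - 2" q] Suc.IH[of "q + 1"] by simp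
      moreover have "int m - 2 + 1 = int (Suc m) - 2" by simp
      ultimately show ?thesis by metis
    qed
  qed
  from this[of "nat (p + 2)" q] have "E p q = 0"
  proof (cases "p < - 1")
    case True
    then show ?thesis using I by (simp add: E_def S_neg S_zero)
  qed (simp)
  then show ?thesis by (simp add: E_def)
qed

text \<open>The commutator at \<open>p + 1\<close> is reduced to commutators at \<open>p\<close>,
  down to index 0 where the operator is the identity. For \<open>a < c\<close> the extra terms
  contain the raising \<open>S a c\<close> and vanish; for \<open>a = c\<close> they are a
  commutator again.\<close>

lemma S_diag_commute:
  assumes v: "v \<in> Xi" and I: "a \<in> I" "c \<in> I" "0 < a" "0 < c"
  shows "S a a p (S c c q v) = S c c q (S a a p v)"
proof -
  have lt: "S a a p (S c c q v) = S c c q (S a a p v)" if I: "a \<in> I" "c \<in> I" "0 < a" "0 < c" "a \<le> c" for a c p q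
  proof -
    define X where "X p q = S a a p (S c c q v) - S c c q (S a a p v)" for p q
    have step: "X (p + 1) q = X p (q + 1) + (if a = c then X p q else 0)" for p q
    proof -
      have "X (p + 1) q - X p (q + 1) = S c a p (S a c q v) - S c a q (S a c p v)"
        using gl_relation[OF Xi_VJ[OF v] I(1,1,2,2) I(3,3,4,4), of p q] by (simp add: X_def algebra_simps)
      also have "\<dots> = (if a = c then X p q else 0)"
        using S_raising_Xi[OF v I(1,2)] I by (auto simp: X_def S_zero)
      finally show ?thesis by (simp add: algebra_simps)
    qed
    have "X (int m) q = 0" for m q
    proof (induction m arbitrary: q)
      case 0 show ?case by (simp add: X_def S_0)
    next
      case (Suc m)
      show ?case using step[of "int m" q] Suc by (simp add: add.commute)
    qed
    from this[of "nat p" q] have "X p q = 0" by (cases "p < 0") (use I in \<open>simp_all add: X_def S_neg S_zero\<close>)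
    then show ?thesis by (simp add: X_def)
  qed
  show ?thesis using lt[of a c p q] lt[of c a q p] I by (cases "a \<le> c") auto
qed

lemma highest_vector_exists:
  "\<exists>\<xi>\<in>Xi. \<xi> \<noteq> 0 \<and> (\<forall>i\<in>{1..n}. \<forall>r. \<exists>c. S (int i) (int i) r \<xi> = scale c \<xi>)"
proof -
  let ?F = "{S (int i) (int i) r | i r. i \<in> {1..n}}"
  have I: "int i \<in> I" "0 < int i" if "i \<in> {1..n}" for i using that by (auto simp: index_set_iff)
  have "\<exists>v\<in>Xi. v \<noteq> 0 \<and> (\<forall>R\<in>?F. \<exists>c. R v = scale c v)"
    by (rule common_eigenvector[OF _ _ _ Xi_subspace Xi_nontrivial])
       (use I S_lin S_diag_Xi S_diag_commute in fastforce)+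
  then show ?thesis by blast
qed

end

section \<open>The long simple root and the first component\<close>

context yangian_alcove begin

lemma top_bound: "i \<in> {1..n} \<Longrightarrow> CHAR('k) > 0 \<Longrightarrow> 0 \<le> - top i \<and> - top i \<le> int CHAR('k) - 3"
  using kappa_bound[OF top_index(1)] .

text \<open>The weight \<open>\<lambda> + 2\<epsilon>\<^sub>1\<close> does not occur because its reflection \<open>\<lambda> - 2\<epsilon>\<^sub>1\<close> is higher than \<open>\<lambda>\<close>;
  this is where \<open>\<lambda>\<^sub>1 = 0\<close> enters.\<close>

lemma S_long_root_zero:
  assumes \<xi>: "\<xi> \<in> Xi"
    and eig: "\<exists>c. S 1 1 r \<xi> = scale c \<xi>" "\<exists>c. S (- 1) (- 1) r \<xi> = scale c \<xi>"
  shows "S 1 (- 1) r \<xi> = 0"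
proof (rule ccontr)
  have one: "1 \<in> I" "- 1 \<in> I" using n_pos by (auto simp: index_set_iff)
  have p: "(- 1, 1) \<in> simple_pairs" by (simp add: simple_pairs_def)
  let ?v = "S 1 (- 1) r \<xi>"
  let ?e = "T (- 1) 1"
  assume nz: "?v \<noteq> 0"
  have sing: "singular \<xi>" and lw: "lie_weight top \<xi>" using \<xi> by (auto simp: Xi_def)
  have sz: "T a b \<xi> = 0" if "(a, b) \<in> simple_pairs" for a b
    using simple_pairs_in[OF that] sing by (auto simp: singular_def)
  have "?e ?v = ?e ?v - S 1 (- 1) r (?e \<xi>)" using sz[OF p] S_zero one by simp
  also have "\<dots> = scale 2 (S (- 1) (- 1) r \<xi> - S 1 1 r \<xi>)"
    unfolding lie_action[OF one(2,1,1,2)] using scale_left_distrib[of 1 1 "S (- 1) (- 1) r \<xi> - S 1 1 r \<xi>"]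
    by (simp add: theta_eq algebra_simps)
  finally obtain c where c: "?e ?v = scale c \<xi>" using eig by (metis scale_left_diff_distrib scale_scale)
  \<comment> \<open>Since \<open>?e ?v\<close> is a multiple of \<open>\<xi>\<close>, the square of
    \<open>?e\<close> kills \<open>?v\<close>, and only strings with \<open>q \<le> 1\<close>
    occur.\<close>
  have e: "(?e ^^ q) ?v = (if q = 0 then ?v else if q = 1 then scale c \<xi> else 0)" for q
    by (induction q) (use c sz[OF p] in \<open>auto simp: lin_scale[OF T_lin[OF one(2,1)]] T_zero one\<close>)
  define \<eta> where "\<eta> i = top i + root_weight 1 (- 1) i" for i
  have "\<exists>j\<in>{1..k}. \<exists>q\<le>1. is_weight n scale \<rho> (W j) (\<lambda>i. \<kappa> j i - int q * root_weight (- 1) 1 i) \<and>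
    (\<forall>i\<in>{1..n}. of_int (\<kappa> j i - int q * root_weight (- 1) 1 i) = (of_int (\<eta> i) :: 'k))"
  proof (rule root_string_weight[OF p nz])
    show "T (int i) (int i) ?v = scale (of_int (\<eta> i)) ?v" if "i \<in> {1..n}" for i
      using lie_weight_S[OF lw one(1,2), of r] that by (simp add: lie_weight_def \<eta>_def)
    show "(?e ^^ Suc 1) ?v = 0" unfolding e by simp
    fix a b q assume ab: "(a, b) \<in> simple_pairs" "(a, b) \<noteq> (- 1, 1)"
    then have abI: "a \<in> I" "b \<in> I" "a \<ge> 1" "b = a + 1" using simple_pairs_in[OF ab(1)] by (auto simp: simple_pairs_def)
    have "T a b ?v = T a b ?v - S 1 (- 1) r (T a b \<xi>)" using sz[OF ab(1)] S_zero one by simp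
    also have "\<dots> = 0" unfolding lie_action[OF abI(1,2) one] using abI by simp
    finally show "T a b ((?e ^^ q) ?v) = 0"
      unfolding e using sz[OF ab(1)] abI by (simp add: lin_scale[OF T_lin] T_zero)
  qed
  then obtain j q where j: "j \<in> {1..k}" "q \<le> 1" "is_weight n scale \<rho> (W j) (\<lambda>i. \<kappa> j i - int q * root_weight (- 1) 1 i)"
    "\<And>i. i \<in> {1..n} \<Longrightarrow> of_int (\<kappa> j i - int q * root_weight (- 1) 1 i) = (of_int (\<eta> i) :: 'k)" by blast
  have rw: "root_weight (- 1) 1 i = (if i = 1 then - 2 else 0)" "root_weight 1 (- 1) i = (if i = 1 then 2 else 0)" for i
    by (auto simp: root_weight_def index_weight_def)
  have eq: "\<kappa> j i = top i + (if i = 1 then 2 - 2 * int q else 0)" if i: "i \<in> {1..n}" for i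
  proof (rule kappa_window[OF j(1) top_index(1) i i])
    show "of_int (\<kappa> j i) = (of_int (top i + (if i = 1 then 2 - 2 * int q else 0)) :: 'k)"
      using j(4)[OF i] by (auto simp: rw \<eta>_def algebra_simps)
  qed (use j(2) in auto)
  have one1: "1 \<in> {1..n}" using n_pos by simp
  \<comment> \<open>For \<open>q = 0\<close> the weight \<open>\<kappa> j\<close> would have first
    coordinate 2.\<close>
  have q: "q = 1" using eq[OF one1] first_zero[OF j(1)] first_zero[OF top_index(1)] by simp
  let ?\<nu> = "\<lambda>i. \<kappa> j i - int q * root_weight (- 1) 1 i"
  have "is_weight n scale \<rho> (W j) (?\<nu>(1 := - ?\<nu> 1))"
    by (rule is_weight_flip[OF W_submodule[OF j(1)] j(3) one1])
  then have "weight_le n (?\<nu>(1 := - ?\<nu> 1)) (\<kappa> j)" by (rule W_weight_le[OF j(1)])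
  then have "height n (?\<nu>(1 := - ?\<nu> 1)) \<le> height n (\<kappa> j)" by (rule weight_le_height)
  moreover have "height n (?\<nu>(1 := - ?\<nu> 1)) = height n (\<lambda>i. \<kappa> j i + 1 * root_weight (- 1) 1 i)"
    unfolding height_def by (rule sum.cong) (use q first_zero[OF j(1)] in \<open>auto simp: rw\<close>)
  moreover have "\<dots> = height n (\<kappa> j) + 2" unfolding height_add_mult by (simp add: height_root_weight one)
  ultimately show False by simp
qed

text \<open>For odd \<open>r\<close> the symmetry relation makes the coefficients of
  \<open>s_{-1,-1}\<close> and \<open>s_{11}\<close> opposite on \<open>\<xi>\<close>, while the
  bracket with the long simple root vector makes them equal.\<close>

lemma first_component_even:
  assumes \<xi>: "\<xi> \<in> Xi" "\<xi> \<noteq> 0" and eig: "\<And>r. S 1 1 r \<xi> = scale (m r) \<xi>" and r: "r \<ge> 0" "odd (nat r)"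
  shows "m r = 0"
proof -
  have one: "1 \<in> I" "- 1 \<in> I" using n_pos by (auto simp: index_set_iff)
  have sing: "T (- 1) 1 \<xi> = 0" using \<xi> one by (auto simp: Xi_def singular_def)
  have "\<exists>c. S (- 1) (- 1) r \<xi> = scale c \<xi>" 
  proof -
    have "scale (2 * (- 1) ^ nat r) (S (- 1) (- 1) r \<xi>) = scale (2 * m r - (1 + (- 1) ^ nat r) * m (r - 1)) \<xi>"
      using symmetry[OF one(1,1), of r \<xi>] by (simp add: eig theta_eq scale_left_diff_distrib)
    then have "scale (inverse (2 * (- 1) ^ nat r)) (scale (2 * (- 1) ^ nat r) (S (- 1) (- 1) r \<xi>)) =
      scale (inverse (2 * (- 1) ^ nat r)) (scale (2 * m r - (1 + (- 1) ^ nat r) * m (r - 1)) \<xi>)" by simp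
    moreover have nz: "2 * (- 1) ^ nat r \<noteq> (0::'k)" using two_nonzero by simp
    ultimately have "S (- 1) (- 1) r \<xi> = scale (inverse (2 * (- 1) ^ nat r) * (2 * m r - (1 + (- 1) ^ nat r) * m (r - 1))) \<xi>"
      by (simp only: scale_scale left_inverse[OF nz] scale_one)
    then show ?thesis by blast
  qed
  then have z: "S 1 (- 1) r \<xi> = 0" using S_long_root_zero[OF \<xi>(1)] eig by blast
  have "T (- 1) 1 (S 1 (- 1) r \<xi>) - S 1 (- 1) r (T (- 1) 1 \<xi>) = scale 2 (S (- 1) (- 1) r \<xi> - S 1 1 r \<xi>)"
    unfolding lie_action[OF one(2,1,1,2)] using scale_left_distrib[of 1 1 "S (- 1) (- 1) r \<xi> - S 1 1 r \<xi>"]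
    by (simp add: theta_eq algebra_simps)
  then have "S (- 1) (- 1) r \<xi> = S 1 1 r \<xi>" using z sing two_nonzero by (simp add: S_zero T_zero one)
  then have "scale (- 2 * m r) \<xi> = scale (2 * m r) \<xi>"
    using symmetry[OF one(1,1), of r \<xi>] r by (simp add: eig theta_eq)
  then have "- 2 * m r = 2 * m r" using \<xi>(2) by (metis scale_cancel_right)
  then have "2 * (2 * m r) = 0" by (simp add: algebra_simps)
  then show ?thesis using two_nonzero by (metis mult_eq_0_iff)
qed

end

section \<open>Twisting and the descent along covectors\<close>

locale gl2_vector = yangian_alcove scale n \<rho> T k \<kappa> W S
  for scale :: "'k::alg_closed_field \<Rightarrow> 'v::ab_group_add \<Rightarrow> 'v" and n \<rho> T k \<kappa> W S +
  fixes i i' :: nat and \<xi> :: 'v and \<mu>1 \<mu>2 :: "'k fps"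
  assumes i: "1 \<le> i" "i < n" "i' = Suc i" and \<xi>: "\<xi> \<in> Xi" "\<xi> \<noteq> 0"
    and eig1: "\<And>r. S (int i) (int i) (int r) \<xi> = scale (fps_nth \<mu>1 r) \<xi>"
    and eig2: "\<And>r. S (int i') (int i') (int r) \<xi> = scale (fps_nth \<mu>2 r) \<xi>"
begin

abbreviation "a \<equiv> int i"
abbreviation "b \<equiv> int i'"
abbreviation "A \<equiv> S a a"
abbreviation "B \<equiv> S b a"
abbreviation "D \<equiv> S b b"
abbreviation "e \<equiv> T a b"
abbreviation "f \<equiv> T b a"

section \<open>The chain of spaces below the highest vector\<close>

lemma ab: "a \<in> I" "b \<in> I" "0 < a" "0 < b" "a \<noteq> b" "b \<noteq> a" "a \<noteq> - a" "b \<noteq> - b" "a \<noteq> - b" "b \<noteq> - a"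
  using i by (auto simp: index_set_iff)

lemma simple_ab: "(a, b) \<in> simple_pairs"
  using i by (auto simp: simple_pairs_def)

lemma root_weight_ab:
  "root_weight a b x = (if x = i then 1 else 0) - (if x = i' then 1 else 0)"
  "root_weight b a x = (if x = i' then 1 else 0) - (if x = i then 1 else 0)"
  using i(1,3) by (auto simp: root_weight_def index_weight_def)

lemma i_in: "i \<in> {1..n}" "i' \<in> {1..n}" "i \<noteq> i'"
  using i by auto

text \<open>The graded pieces of what the Yangian of gl_2 generates from \<open>\<xi>\<close>. All
  coefficients of \<open>B\<close> are used, not only \<open>f\<close>, so the intermediate spaces
  need not be lines.\<close>

primrec M :: "nat \<Rightarrow> 'v set" where
  "M 0 = span {\<xi>}"
| "M (Suc m) = span {B q v | q v. v \<in> M m}"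

lemma M_subspace: "subspace (M m)"
  by (cases m) (simp_all add: subspace_span)

lemma B_M: "v \<in> M m \<Longrightarrow> B q v \<in> M (Suc m)"
  by (auto intro!: span_base)

lemma M_Suc_induct:
  assumes "y \<in> M (Suc m)" "subspace U" "\<And>q v. v \<in> M m \<Longrightarrow> B q v \<in> U"
  shows "y \<in> U"
  using assms(1) span_minimal[of "{B q v | q v. v \<in> M m}" U] assms(2,3) by auto

lemma M_0_induct:
  assumes "y \<in> M 0" "subspace U" "\<xi> \<in> U"
  shows "y \<in> U"
  using assms(1) span_minimal[of "{\<xi>}" U] assms(2,3) by auto

lemma lin_preimage: "lin R \<Longrightarrow> subspace U \<Longrightarrow> subspace {v. R v \<in> U}"
  by (rule subspaceI) (simp_all add: lin_0 lin_add lin_scale subspace_0 subspace_add subspace_scale)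

lemma M_VJ: "v \<in> M m \<Longrightarrow> v \<in> VJ"
proof (induction m arbitrary: v)
  case 0 then show ?case using M_0_induct[OF 0 VJ_subspace] Xi_VJ[OF \<xi>(1)] by blast
next
  case (Suc m) then show ?case using M_Suc_induct[OF Suc.prems VJ_subspace] S_VJ ab by blast
qed

lemma rel_DB: "v \<in> VJ \<Longrightarrow> D (p + 1) (B q v) - B q (D (p + 1) v) - D p (B (q + 1) v) + B (q + 1) (D p v) = D p (B q v) - D q (B p v)"
  using gl_relation[of v b b b a p q] ab by blast

lemma rel_BD: "v \<in> VJ \<Longrightarrow> B (p + 1) (D q v) - D q (B (p + 1) v) - B p (D (q + 1) v) + D (q + 1) (B p v) = B p (D q v) - B q (D p v)"
  using gl_relation[of v b a b b p q] ab by blast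

lemma rel_AB: "v \<in> VJ \<Longrightarrow> A (p + 1) (B q v) - B q (A (p + 1) v) - A p (B (q + 1) v) + B (q + 1) (A p v) = B p (A q v) - B q (A p v)"
  using gl_relation[of v a a b a p q] ab by blast

text \<open>Modulo \<open>M (Suc m)\<close> the relation trades a unit of index of \<open>D\<close>
  for one of \<open>B\<close>, until \<open>D\<close> has index 0 and is the identity.\<close>

lemma D_M: "v \<in> M m \<Longrightarrow> D r v \<in> M m"
proof (induction m arbitrary: v r)
  case 0
  have "D r \<xi> \<in> M 0"
    using eig2[of "nat r"] by (cases "r < 0") (simp_all add: S_neg span_zero span_scale span_base)
  then show ?case using M_0_induct[OF 0 lin_preimage[OF S_lin M_subspace]] ab by blast
next
  case (Suc m)
  show ?case
  proof (rule M_Suc_induct[OF Suc.prems lin_preimage[OF S_lin[OF ab(2,2)] M_subspace], unfolded mem_Collect_eq])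
    fix q v assume v: "v \<in> M m"
    note sub = M_subspace[of "Suc m"]
    have step: "D (r + 1) (B p v) - D r (B (p + 1) v) \<in> M (Suc m)" for r p
    proof -
      have "D (r + 1) (B p v) - D r (B (p + 1) v) = B p (D r v) - B r (D p v) - B (p + 1) (D r v) + B p (D (r + 1) v)"
        using rel_BD[OF M_VJ[OF v], of p r] by (simp add: algebra_simps)
      also have "\<dots> \<in> M (Suc m)"
        by (intro subspace_add[OF sub] subspace_diff[OF sub] B_M Suc.IH v)
      finally show ?thesis .
    qed
    have "D (int s) (B p v) \<in> M (Suc m)" for s p
    proof (induction s arbitrary: p)
      case 0 then show ?case using B_M[OF v] by (simp add: S_0)
    next
      case (Suc s)
      then have "D (int s + 1) (B p v) - D (int s) (B (p + 1) v) + D (int s) (B (p + 1) v) \<in> M (Suc m)"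
        by (intro subspace_add[OF sub] step)
      then show ?case by (simp add: add.commute)
    qed
    from this[of "nat r" q] show "D r (B q v) \<in> M (Suc m)"
      by (cases "r < 0") (simp_all add: S_neg subspace_0[OF sub] del: M.simps)
  qed
qed

lemma A_M: "v \<in> M m \<Longrightarrow> A r v \<in> M m"
proof (induction m arbitrary: v r)
  case 0
  have "A r \<xi> \<in> M 0"
    using eig1[of "nat r"] by (cases "r < 0") (simp_all add: S_neg span_zero span_scale span_base)
  then show ?case using M_0_induct[OF 0 lin_preimage[OF S_lin M_subspace]] ab by blast
next
  case (Suc m)
  show ?case
  proof (rule M_Suc_induct[OF Suc.prems lin_preimage[OF S_lin[OF ab(1,1)] M_subspace], unfolded mem_Collect_eq])
    fix q v assume v: "v \<in> M m"
    note sub = M_subspace[of "Suc m"]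
    have step: "A (r + 1) (B p v) - A r (B (p + 1) v) \<in> M (Suc m)" for r p
    proof -
      have "A (r + 1) (B p v) - A r (B (p + 1) v) = B r (A p v) - B p (A r v) - B (p + 1) (A r v) + B p (A (r + 1) v)"
        using rel_AB[OF M_VJ[OF v], of r p] by (simp add: algebra_simps)
      also have "\<dots> \<in> M (Suc m)"
        by (intro subspace_add[OF sub] subspace_diff[OF sub] B_M Suc.IH v)
      finally show ?thesis .
    qed
    have "A (int s) (B p v) \<in> M (Suc m)" for s p
    proof (induction s arbitrary: p)
      case 0 then show ?case using B_M[OF v] by (simp add: S_0)
    next
      case (Suc s)
      then have "A (int s + 1) (B p v) - A (int s) (B (p + 1) v) + A (int s) (B (p + 1) v) \<in> M (Suc m)"
        by (intro subspace_add[OF sub] step)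
      then show ?case by (simp add: add.commute)
    qed
    from this[of "nat r" q] show "A r (B q v) \<in> M (Suc m)"
      by (cases "r < 0") (simp_all add: S_neg subspace_0[OF sub] del: M.simps)
  qed
qed

lemma e_B: "e (B q v) = B q (e v) + A q v - D q v"
  using lie_action[OF ab(1,2,2,1), of q v] ab by (simp add: algebra_simps)

lemma f_B: "f (B q v) = B q (f v)"
  using lie_action[OF ab(2,1,2,1), of q v] ab by (simp add: algebra_simps)

lemma f_A: "A q (f v) = f (A q v) - B q v"
  using lie_action[OF ab(2,1,1,1), of q v] ab by (simp add: algebra_simps)

lemma f_eq: "f = B 1"
  by (rule T_eq)

lemma e_M_0: "v \<in> M 0 \<Longrightarrow> e v = 0"
proof -
  assume v: "v \<in> M 0"
  have "subspace {v. e v \<in> {0}}" by (rule lin_preimage[OF T_lin[OF ab(1,2)]]) (rule subspace_single_0)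
  moreover have "e \<xi> = 0" using \<xi> ab i by (auto simp: Xi_def singular_def)
  ultimately show "e v = 0" using M_0_induct[OF v, of "{v. e v \<in> {0}}"] by blast
qed

lemma e_M: "v \<in> M (Suc m) \<Longrightarrow> e v \<in> M m"
proof (induction m arbitrary: v)
  case 0
  show ?case
  proof (rule M_Suc_induct[OF 0 lin_preimage[OF T_lin[OF ab(1,2)] M_subspace], unfolded mem_Collect_eq])
    fix q v assume v: "v \<in> M 0"
    show "e (B q v) \<in> M 0" unfolding e_B e_M_0[OF v] S_zero[OF ab(2,1)]
      by (intro subspace_add[OF M_subspace] subspace_diff[OF M_subspace] A_M D_M v subspace_0[OF M_subspace])
  qed
next
  case (Suc m)
  show ?case
  proof (rule M_Suc_induct[OF Suc.prems lin_preimage[OF T_lin[OF ab(1,2)] M_subspace], unfolded mem_Collect_eq])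
    fix q v assume v: "v \<in> M (Suc m)"
    show "e (B q v) \<in> M (Suc m)" unfolding e_B
      by (intro subspace_add[OF M_subspace] subspace_diff[OF M_subspace] A_M D_M v B_M Suc.IH)
  qed
qed

lemma e_pow_M: "v \<in> M m \<Longrightarrow> q \<le> m \<Longrightarrow> (e ^^ q) v \<in> M (m - q)"
proof (induction q)
  case (Suc q)
  then have "(e ^^ q) v \<in> M (Suc (m - Suc q))" by (simp add: Suc_diff_Suc del: M.simps)
  then show ?case using e_M by simp
qed simp

lemma e_pow_M_0: "v \<in> M m \<Longrightarrow> q > m \<Longrightarrow> (e ^^ q) v = 0"
proof -
  assume v: "v \<in> M m" and q: "q > m"
  have "(e ^^ Suc m) v = 0" using e_M_0 e_pow_M[OF v, of m] by simp
  then have "(e ^^ (q - Suc m)) ((e ^^ Suc m) v) = 0" using lin_0[OF lin_funpow[OF T_lin[OF ab(1,2)]]] by simp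
  moreover have "q = (q - Suc m) + Suc m" using q by simp
  ultimately show "(e ^^ q) v = 0" by (metis comp_apply funpow_add)
qed

lemma lie_weight_M: "v \<in> M m \<Longrightarrow> lie_weight (\<lambda>x. top x + int m * root_weight b a x) v"
proof (induction m arbitrary: v)
  case 0
  have sub: "subspace {v. lie_weight top v}"
    by (rule subspaceI) (auto simp: lie_weight_def T_zero index_set_iff lin_add[OF T_lin] lin_scale[OF T_lin] scale_right_distrib mult.commute)
  then have "lie_weight top v" using M_0_induct[OF 0 sub] \<xi> by (auto simp: Xi_def)
  then show ?case by simp
next
  case (Suc m)
  let ?\<eta> = "\<lambda>x. top x + int (Suc m) * root_weight b a x"
  have sub: "subspace {v. lie_weight ?\<eta> v}"
    by (rule subspaceI) (auto simp: lie_weight_def T_zero index_set_iff lin_add[OF T_lin] lin_scale[OF T_lin] scale_right_distrib mult.commute)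
  show ?case
  proof (rule M_Suc_induct[OF Suc.prems sub, unfolded mem_Collect_eq])
    fix q v assume "v \<in> M m"
    then have "lie_weight (\<lambda>x. top x + int m * root_weight b a x + root_weight b a x) (B q v)"
      by (rule lie_weight_S[OF Suc.IH ab(2,1)])
    moreover have "(\<lambda>x. top x + int m * root_weight b a x + root_weight b a x) = ?\<eta>" by (auto simp: algebra_simps)
    ultimately show "lie_weight ?\<eta> (B q v)" by simp
  qed
qed

text \<open>Raising operators of the other simple roots commute with \<open>B\<close>. This supplies
  the hypothesis of \<open>root_string_weight\<close> about them.\<close>

lemma other_simple_M:
  assumes cd: "(c, d) \<in> simple_pairs" "(c, d) \<noteq> (a, b)"
  shows "v \<in> M m \<Longrightarrow> T c d v = 0"
proof -
  have cdI: "c \<in> I" "d \<in> I" "c < d" using simple_pairs_in[OF cd(1)] by auto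
  have sub: "subspace {v. T c d v \<in> {0}}" by (rule lin_preimage[OF T_lin[OF cdI(1,2)]]) (rule subspace_single_0)
  show "v \<in> M m \<Longrightarrow> T c d v = 0"
  proof (induction m arbitrary: v)
    case 0
    have "T c d \<xi> = 0" using \<xi> cdI by (auto simp: Xi_def singular_def)
    then show ?case using M_0_induct[OF 0 sub] by blast
  next
    case (Suc m)
    have "T c d (B q v) = 0" if v: "v \<in> M m" for q v
    proof -
      have "T c d (B q v) = T c d (B q v) - B q (T c d v)" using Suc.IH[OF v] S_zero ab by simp
      also have "\<dots> = 0" unfolding lie_action[OF cdI(1,2) ab(2,1)]
        using cd i by (auto simp: simple_pairs_def)
      finally show ?thesis .
    qed
    then show ?case using M_Suc_induct[OF Suc.prems sub] by blast
  qed
qed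

section \<open>The far end of the chain\<close>

definition deg :: nat where "deg = nat (top i - top i')"

lemma deg: "top i = top i' + int deg"
  using alcove[OF top_index(1)] i unfolding dominant_weights_def deg_def by auto

lemma deg_char: "CHAR('k) > 0 \<Longrightarrow> Suc deg < CHAR('k)"
  using top_bound[OF i_in(1)] top_bound[OF i_in(2)] deg by auto

text \<open>Let \<alpha> be \<open>root_weight a b\<close>. A nonzero \<open>v\<close> yields a
  summand with highest weight \<open>top + (q - m) \<alpha>\<close> that has the weight
  \<open>top - m \<alpha>\<close>. The reflected weight \<open>top + (m - deg) \<alpha>\<close> must
  not be higher, so \<open>q \<ge> 2 m - deg\<close>. The restriction on \<open>m\<close> keeps the
  congruent coordinates less than the characteristic apart.\<close>

lemma M_eq_0_if_e_pow:
  assumes v: "v \<in> M m" "m = deg \<or> m = Suc deg" and e: "(e ^^ Suc N) v = 0" and N: "N \<le> m" "int N < 2 * int m - int deg"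
  shows "v = 0"
proof (rule ccontr)
  assume nz: "v \<noteq> 0"
  let ?\<eta> = "\<lambda>x. top x + int m * root_weight b a x"
  note rw = root_weight_ab
  have "\<exists>j\<in>{1..k}. \<exists>q\<le>N. is_weight n scale \<rho> (W j) (\<lambda>x. \<kappa> j x - int q * root_weight a b x) \<and>
    (\<forall>x\<in>{1..n}. of_int (\<kappa> j x - int q * root_weight a b x) = (of_int (?\<eta> x) :: 'k))"
  proof (rule root_string_weight[OF simple_ab nz _ _ e])
    show "T (int x) (int x) v = scale (of_int (?\<eta> x)) v" if "x \<in> {1..n}" for x
      using lie_weight_M[OF v(1)] that by (simp add: lie_weight_def)
    show "T c d ((e ^^ q) v) = 0" if cd: "(c, d) \<in> simple_pairs" "(c, d) \<noteq> (a, b)" for c d q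
    proof (cases "q \<le> m")
      case True then show ?thesis using other_simple_M[OF cd e_pow_M[OF v(1)]] by simp
    next
      case False then show ?thesis using e_pow_M_0[OF v(1)] simple_pairs_in[OF cd(1)] T_zero by simp
    qed
  qed
  then obtain j q where j: "j \<in> {1..k}" "q \<le> N" "is_weight n scale \<rho> (W j) (\<lambda>x. \<kappa> j x - int q * root_weight a b x)"
    "\<And>x. x \<in> {1..n} \<Longrightarrow> of_int (\<kappa> j x - int q * root_weight a b x) = (of_int (?\<eta> x) :: 'k)" by blast
  have eq: "\<kappa> j x - int q * root_weight a b x = ?\<eta> x" if x: "x \<in> {1..n}" for x
  proof (rule of_int_eq_imp_eq[OF j(4)[OF x]])
    assume p: "CHAR('k) > 0"
    have "q \<le> m" using j(2) N by simp
    then show "\<bar>\<kappa> j x - int q * root_weight a b x - ?\<eta> x\<bar> < int CHAR('k)"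
      using kappa_bound[OF j(1) x p] top_bound[OF x p] v(2) deg
        top_bound[OF i_in(1) p] top_bound[OF i_in(2) p] i_in(3)
      unfolding rw by (auto simp: abs_less_iff)
  qed
  let ?\<nu> = "\<lambda>x. \<kappa> j x - int q * root_weight a b x"
  let ?\<nu>' = "\<lambda>x. ?\<nu> (if x = i then i' else if x = i' then i else x)"
  have "is_weight n scale \<rho> (W j) ?\<nu>'"
    by (rule is_weight_swap[OF W_submodule[OF j(1)] j(3) i_in(1,2)])
  then have "height n ?\<nu>' \<le> height n (\<kappa> j)" by (intro weight_le_height W_weight_le[OF j(1)])
  moreover have "height n ?\<nu>' = height n (\<lambda>x. top x + (int m - int deg) * root_weight a b x)"
    unfolding height_def
  proof (rule sum.cong)
    fix x assume x: "x \<in> {1..n}"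
    have "?\<nu>' x = ?\<eta> (if x = i then i' else if x = i' then i else x)"
      by (rule eq) (use x i_in in auto)
    also have "\<dots> = top x + (int m - int deg) * root_weight a b x" using deg i_in(3) by (auto simp: rw)
    finally show "- int x * ?\<nu>' x = - int x * (top x + (int m - int deg) * root_weight a b x)" by simp
  qed simp
  moreover have "height n (\<kappa> j) = height n (\<lambda>x. top x + (int q - int m) * root_weight a b x)"
    unfolding height_def
  proof (rule sum.cong)
    fix x assume x: "x \<in> {1..n}"
    have "\<kappa> j x = top x + (int q - int m) * root_weight a b x" using eq[OF x] i_in(3) by (auto simp: rw)
    then show "- int x * \<kappa> j x = - int x * (top x + (int q - int m) * root_weight a b x)" by simp
  qed simp
  moreover have "height n (root_weight a b) = 1" using height_root_weight[OF ab(1,2)] i(3) by simp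
  ultimately have "int m - int deg \<le> int q - int m" unfolding height_add_mult by simp
  then show False using j(2) N by simp
qed

text \<open>Here \<open>2 m - deg = deg + 2\<close> exceeds \<open>m = deg + 1\<close>, so
  nilpotency of \<open>e\<close> for degree reasons is enough.\<close>

lemma M_Suc_deg: "v \<in> M (Suc deg) \<Longrightarrow> v = 0"
proof -
  assume v: "v \<in> M (Suc deg)"
  show ?thesis by (rule M_eq_0_if_e_pow[OF v _ e_pow_M_0[OF v]]) auto
qed

text \<open>Here \<open>2 m - deg = deg\<close>. Thus \<open>e ^^ deg\<close> embeds
  \<open>M deg\<close> into \<open>M 0\<close>, which is a line.\<close>

lemma M_deg_e_pow: "v \<in> M deg \<Longrightarrow> (e ^^ deg) v = 0 \<Longrightarrow> v = 0"
proof (cases deg)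
  case (Suc d)
  assume "v \<in> M deg" "(e ^^ deg) v = 0"
  then show ?thesis using M_eq_0_if_e_pow[of v deg d] Suc by simp
qed simp

lemma f_pow_M: "(f ^^ m) \<xi> \<in> M m"
  by (induction m) (use B_M[of _ _ 1] in \<open>simp_all add: f_eq span_base del: M.simps(2)\<close>)

text \<open>The usual sl_2 computation. For \<open>m < deg\<close> both factors are positive and at
  most \<open>deg\<close>, hence nonzero in the field.\<close>

lemma e_f_pow: "e ((f ^^ Suc m) \<xi>) = scale (of_int (int (Suc m) * (int deg - int m))) ((f ^^ m) \<xi>)"
proof (induction m)
  case 0
  have "lie_weight top \<xi>" using \<xi> by (simp add: Xi_def)
  then have "T a a \<xi> - T b b \<xi> = scale (of_int (int deg)) \<xi>"
    using deg i_in by (simp add: lie_weight_def scale_left_distrib)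
  moreover have "e \<xi> = 0" using e_M_0[of \<xi>] by (simp add: span_base)
  ultimately show ?case using e_B[of 1 \<xi>] T_zero[OF ab(2,1)] by (simp add: T_eq[symmetric])
next
  case (Suc m)
  let ?y = "(f ^^ Suc m) \<xi>"
  have "lie_weight (\<lambda>x. top x + int (Suc m) * root_weight b a x) ?y" by (rule lie_weight_M[OF f_pow_M])
  moreover have "root_weight b a i = - 1" "root_weight b a i' = 1" using i_in(3) by (auto simp: root_weight_ab)
  ultimately have "T a a ?y = scale (of_int (top i - int (Suc m))) ?y" "T b b ?y = scale (of_int (top i' + int (Suc m))) ?y"
    using i_in by (auto simp: lie_weight_def simp del: funpow.simps)
  then have h: "T a a ?y - T b b ?y = scale (of_int (int deg - 2 * int (Suc m))) ?y"
    by (simp only: scale_left_diff_distrib[symmetric] of_int_diff[symmetric]) (simp add: deg del: funpow.simps)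
  have "e ((f ^^ Suc (Suc m)) \<xi>) = f (e ?y) + (T a a ?y - T b b ?y)"
    using e_B[of 1 ?y] by (simp add: T_eq[symmetric])
  also have "\<dots> = scale (of_int (int (Suc m) * (int deg - int m))) ?y + scale (of_int (int deg - 2 * int (Suc m))) ?y"
    unfolding h Suc.IH by (simp add: lin_scale[OF T_lin[OF ab(2,1)]])
  also have "\<dots> = scale (of_int (int (Suc (Suc m)) * (int deg - int (Suc m)))) ?y"
    unfolding scale_left_distrib[symmetric] of_int_add[symmetric] by (simp add: algebra_simps del: funpow.simps)
  finally show ?case .
qed

lemma of_int_small_nonzero: "0 < z \<Longrightarrow> z \<le> int deg \<Longrightarrow> of_int z \<noteq> (0::'k)"
  using of_int_eq_imp_eq[of z 0, where 'k = 'k] deg_char by force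

lemma e_pow_f_pow: "q \<le> deg \<Longrightarrow> \<exists>c. c \<noteq> 0 \<and> (e ^^ q) ((f ^^ deg) \<xi>) = scale c ((f ^^ (deg - q)) \<xi>)"
proof (induction q)
  case 0 then show ?case by (intro exI[of _ 1]) simp
next
  case (Suc q)
  then obtain c where c: "c \<noteq> 0" "(e ^^ q) ((f ^^ deg) \<xi>) = scale c ((f ^^ (deg - q)) \<xi>)" by auto
  obtain d where d: "deg - q = Suc d" using Suc.prems by (cases "deg - q") auto
  let ?c = "of_int (int (Suc d) * (int deg - int d)) :: 'k"
  have "(e ^^ Suc q) ((f ^^ deg) \<xi>) = scale (c * ?c) ((f ^^ d) \<xi>)"
  proof -
    have "(e ^^ Suc q) \<zeta>' = e ((e ^^ q) \<zeta>')" for \<zeta>' by simp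
    then have "(e ^^ Suc q) ((f ^^ deg) \<xi>) = e (scale c ((f ^^ Suc d) \<xi>))" unfolding c(2)[unfolded d, symmetric] .
    also have "\<dots> = scale (c * ?c) ((f ^^ d) \<xi>)" unfolding lin_scale[OF T_lin[OF ab(1,2)]] e_f_pow scale_scale by (rule refl)
    finally show ?thesis .
  qed
  moreover have "d = deg - Suc q" using d by simp
  moreover have "?c \<noteq> 0" unfolding of_int_mult
    using of_int_small_nonzero[of "int (Suc d)"] of_int_small_nonzero[of "int deg - int d"] d by simp
  ultimately show ?case using c(1) by (intro exI[of _ "c * ?c"]) auto
qed

abbreviation "\<zeta> \<equiv> (f ^^ deg) \<xi>"

lemma zeta_nonzero: "\<zeta> \<noteq> 0"
proof
  assume z: "\<zeta> = 0"
  obtain c where "c \<noteq> 0" "(e ^^ deg) \<zeta> = scale c \<xi>" using e_pow_f_pow[of deg] by auto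
  then show False using \<xi>(2) lin_0[OF lin_funpow[OF T_lin[OF ab(1,2)]]] unfolding z by simp
qed

lemma M_deg: "y \<in> M deg \<Longrightarrow> \<exists>c. y = scale c \<zeta>"
proof -
  assume y: "y \<in> M deg"
  obtain c where c: "c \<noteq> 0" "(e ^^ deg) \<zeta> = scale c \<xi>" using e_pow_f_pow[of deg] by auto
  have "(e ^^ deg) y \<in> span {\<xi>}" using e_pow_M[OF y, of deg] by simp
  then obtain c' where c': "(e ^^ deg) y = scale c' \<xi>" by (auto simp: span_singleton)
  note E = lin_funpow[OF T_lin[OF ab(1,2)], of deg]
  have "(e ^^ deg) (y - scale (c' / c) \<zeta>) = 0"
    using c c' by (simp add: lin_diff[OF E] lin_scale[OF E])
  moreover have "y - scale (c' / c) \<zeta> \<in> M deg"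
    by (intro subspace_diff[OF M_subspace] subspace_scale[OF M_subspace] y f_pow_M)
  ultimately have "y - scale (c' / c) \<zeta> = 0" by (rule M_deg_e_pow[rotated])
  then show ?thesis by auto
qed

lemma B_f_pow: "B q ((f ^^ m) v) = (f ^^ m) (B q v)"
  by (induction m) (simp_all add: f_B[symmetric])

text \<open>Each commutation of \<open>A q\<close> past \<open>f\<close> leaves one
  \<open>B q\<close>, which commutes with \<open>f\<close>. The truncated \<open>m - 1\<close> at
  \<open>m = 0\<close> is harmless since its coefficient is zero.\<close>

lemma A_f_pow: "A q ((f ^^ m) \<xi>) = scale (if q < 0 then 0 else fps_nth \<mu>1 (nat q)) ((f ^^ m) \<xi>) - scale (of_nat m) ((f ^^ (m - 1)) (B q \<xi>))"
proof (induction m)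
  case 0
  show ?case using eig1[of "nat q"] by (cases "q < 0") (simp_all add: S_neg)
next
  case (Suc m)
  let ?c = "if q < 0 then 0 else fps_nth \<mu>1 (nat q)"
  note F = T_lin[OF ab(2,1)]
  have "A q ((f ^^ Suc m) \<xi>) = f (A q ((f ^^ m) \<xi>)) - B q ((f ^^ m) \<xi>)" by (simp add: f_A)
  also have "\<dots> = scale ?c ((f ^^ Suc m) \<xi>) - (scale (of_nat m) (f ((f ^^ (m - 1)) (B q \<xi>))) + (f ^^ m) (B q \<xi>))"
    unfolding Suc.IH B_f_pow by (simp add: lin_diff[OF F] lin_scale[OF F])
  also have "scale (of_nat m) (f ((f ^^ (m - 1)) (B q \<xi>))) = scale (of_nat m) ((f ^^ m) (B q \<xi>))"
    by (cases m) simp_all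
  also have "\<dots> + (f ^^ m) (B q \<xi>) = scale (of_nat (Suc m)) ((f ^^ m) (B q \<xi>))"
    by (simp add: scale_left_distrib add.commute)
  finally show ?case by simp
qed

text \<open>Applying \<open>e\<close> to \<open>B q \<zeta> = 0\<close> expresses
  \<open>D q \<zeta>\<close> by \<open>A q \<zeta>\<close> and \<open>B q (e \<zeta>)\<close>. The
  latter is \<open>deg\<close> times a vector that also occurs, with opposite sign, in
  \<open>A_f_pow\<close>; only the eigenvalue from \<open>\<mu>1\<close> survives.\<close>

lemma D_zeta: "D (int q) \<zeta> = scale (fps_nth \<mu>1 q) \<zeta>"
proof -
  have "B (int q) \<zeta> = 0" by (rule M_Suc_deg[OF B_M[OF f_pow_M]])
  then have "0 = B (int q) (e \<zeta>) + A (int q) \<zeta> - D (int q) \<zeta>" using e_B[of "int q" \<zeta>] T_zero ab by simp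
  moreover have "B (int q) (e \<zeta>) = scale (of_nat deg) ((f ^^ (deg - 1)) (B (int q) \<xi>))"
  proof (cases deg)
    case 0 then show ?thesis using e_M_0[of \<xi>] S_zero ab by (simp add: span_base)
  next
    case (Suc d)
    then show ?thesis using e_f_pow[of d] by (simp add: lin_scale[OF S_lin[OF ab(2,1)]] B_f_pow del: funpow.simps)
  qed
  ultimately show ?thesis using A_f_pow[of "int q" deg] by simp
qed

end

section \<open>Linear factors and the relation \<open>arrow\<close>\<close>

lemma poly_at_mult: "poly_at (P * Q) z = poly_at P z * poly_at Q (z :: 'k::field fls)"
proof -
  have sum: "fls_const (sum f A) = (\<Sum>x\<in>A. fls_const (f x :: 'k))" for f :: "nat \<Rightarrow> 'k" and A
    by (induction A rule: infinite_finite_induct) (simp_all flip: fls_plus_const)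
  have "map_poly fls_const (P * Q) = map_poly fls_const P * map_poly (fls_const :: 'k \<Rightarrow> _) Q"
    by (rule poly_eqI) (simp add: coeff_map_poly coeff_mult sum)
  then show ?thesis by (simp add: poly_at_def)
qed

lemma poly_at_prod_linear:
  "poly_at (prod_list (map (\<lambda>c. [:- g c, 1:]) cs)) z = prod_list (map (\<lambda>c. z - fls_const (g c :: 'k::field)) cs)"
proof (induction cs)
  case Nil
  show ?case by (simp add: poly_at_def)
next
  case (Cons c cs)
  have "poly_at [:- g c, 1:] z = z - fls_const (g c)"
    by (simp add: poly_at_def map_poly_pCons algebra_simps)
  then show ?case by (simp only: list.map prod_list.Cons poly_at_mult Cons)
qed

lemma lead_coeff_prod_linear: "lead_coeff (prod_list (map (\<lambda>c. [:- g c, 1 :: 'k::field:]) cs)) = 1"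
proof (induction cs)
  case (Cons c cs)
  then show ?case by (simp only: list.map prod_list.Cons lead_coeff_mult) simp
qed simp

lemma fps_to_fls_prod_list: "fps_to_fls (prod_list (map h cs)) = prod_list (map (\<lambda>c. fps_to_fls (h c :: 'k::field fps)) cs)"
  by (induction cs) (simp_all add: fls_times_fps_to_fls)

text \<open>For \<open>P(u)\<close> the product of the \<open>u - (c + 1)\<close>, the ratio
  \<open>P(u + 1) / P(u)\<close> is the product of \<open>(u - c) / (u - c - 1)\<close>. Dividing
  numerator and denominator by \<open>u\<close> gives the power series of the hypothesis.\<close>

lemma arrowI:
  fixes \<nu> \<mu> :: "'k::field fps"
  assumes eq: "\<mu> * prod_list (map (\<lambda>c. 1 - fps_const c * fps_X) cs) = \<nu> * prod_list (map (\<lambda>c. 1 - fps_const (c + 1) * fps_X) cs)"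
    and nz: "\<mu> \<noteq> 0"
  shows "arrow \<nu> \<mu>"
proof -
  define P where "P = prod_list (map (\<lambda>c. [:- (c + 1), 1 :: 'k:]) cs)"
  let ?x = "fls_X :: 'k fls"
  have nf: "1 - fps_const c * fps_X \<noteq> (0 :: 'k fps)" for c
  proof
    assume "1 - fps_const c * fps_X = (0 :: 'k fps)"
    then have "fps_nth (1 - fps_const c * fps_X) 0 = (0::'k)" by simp
    then show False by simp
  qed
  have lin: "fls_X_inv - fls_const c = fls_X_inv * fps_to_fls (1 - fps_const c * fps_X)" for c :: 'k
  proof -
    have "fps_to_fls (1 - fps_const c * fps_X) = 1 - fls_const c * ?x"
      by (simp add: fls_times_fps_to_fls)
    moreover have "fls_X_inv * ?x = 1" by (simp add: fls_X_inv_times_conv_shift)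
    ultimately show ?thesis by (simp add: right_diff_distrib mult.left_commute[of fls_X_inv])
  qed
  have prods: "prod_list (map (\<lambda>c. fls_X_inv - fls_const (g c)) cs) = fls_X_inv ^ length cs * fps_to_fls (prod_list (map (\<lambda>c. 1 - fps_const (g c) * fps_X) cs))"
    for g :: "'k \<Rightarrow> 'k"
    unfolding lin fps_to_fls_prod_list by (induction cs) (simp_all add: mult_ac)
  have "poly_at P (fls_X_inv + 1) = prod_list (map (\<lambda>c. fls_X_inv - fls_const c) cs)"
  proof -
    have "fls_X_inv + 1 - fls_const (c + 1) = fls_X_inv - fls_const c" for c :: 'k
      by (simp flip: fls_plus_const)
    then show ?thesis unfolding P_def poly_at_prod_linear by (simp only:)
  qed
  moreover have "poly_at P fls_X_inv = prod_list (map (\<lambda>c. fls_X_inv - fls_const (c + 1)) cs)"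
    unfolding P_def poly_at_prod_linear by (rule refl)
  ultimately have "shift_ratio P = fps_to_fls (prod_list (map (\<lambda>c. 1 - fps_const c * fps_X) cs)) /
      fps_to_fls (prod_list (map (\<lambda>c. 1 - fps_const (c + 1) * fps_X) cs))"
    unfolding shift_ratio_def by (simp only: prods[of "\<lambda>c. c"] prods[of "\<lambda>c. c + 1"]) simp
  moreover have "fps_to_fls \<nu> / fps_to_fls \<mu> = \<dots>"
  proof -
    have "prod_list (map (\<lambda>c. 1 - fps_const (c + 1) * fps_X) cs) \<noteq> (0 :: 'k fps)"
      using nf by (auto simp: prod_list_zero_iff)
    then have "fps_to_fls (prod_list (map (\<lambda>c. 1 - fps_const (c + 1) * fps_X) cs)) \<noteq> (0 :: 'k fls)" by simp
    moreover have "fps_to_fls \<mu> \<noteq> 0" using nz by simp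
    moreover have "fps_to_fls \<mu> * fps_to_fls (prod_list (map (\<lambda>c. 1 - fps_const c * fps_X) cs)) =
      fps_to_fls \<nu> * fps_to_fls (prod_list (map (\<lambda>c. 1 - fps_const (c + 1) * fps_X) cs))"
      using arg_cong[OF eq, of fps_to_fls] by (simp only: fls_times_fps_to_fls)
    ultimately show ?thesis by (simp add: frac_eq_eq mult.commute)
  qed
  moreover have "lead_coeff P = 1" unfolding P_def by (rule lead_coeff_prod_linear)
  ultimately show ?thesis unfolding arrow_def by metis
qed

section \<open>Normalised series and the descent along covectors\<close>

context gl2_vector begin

text \<open>The coefficient of \<open>u^(- p)\<close> in the product
  \<open>g(u) R(u)\<close>.\<close>

definition twist :: "'k fps \<Rightarrow> (int \<Rightarrow> 'v \<Rightarrow> 'v) \<Rightarrow> int \<Rightarrow> 'v \<Rightarrow> 'v" where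
  "twist g R p v = (\<Sum>s\<le>nat p. scale (fps_nth g s) (R (p - int s) v))"

text \<open>A summation limit independent of the index allows the double sums below to be combined
  termwise.\<close>

lemma twist_bound:
  assumes "\<forall>r v. r < 0 \<longrightarrow> R r v = 0" "p \<le> int N"
  shows "twist g R p v = (\<Sum>s\<le>N. scale (fps_nth g s) (R (p - int s) v))"
  unfolding twist_def by (rule sum.mono_neutral_left) (use assms in \<open>auto simp: nat_le_iff\<close>)

lemma twist_lin: "\<forall>r. lin (R r) \<Longrightarrow> lin (twist g R p)"
  unfolding lin_iff twist_def
  by (simp add: scale_right_distrib sum.distrib scale_sum_right mult.commute)

lemma twist_M: "\<forall>r. R r v \<in> U \<Longrightarrow> subspace U \<Longrightarrow> twist g R p v \<in> U"
  unfolding twist_def by (auto intro!: subspace_sum subspace_scale)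

lemma twist_twist:
  assumes lin: "\<forall>r. lin (R r)" and neg: "\<forall>r v. r < 0 \<longrightarrow> R r v = 0" "\<forall>r v. r < 0 \<longrightarrow> Q r v = 0"
    and N: "p \<le> int N" "q \<le> int N"
  shows "twist g R p (twist g Q q v) = (\<Sum>s\<le>N. \<Sum>t\<le>N. scale (fps_nth g s * fps_nth g t) (R (p - int s) (Q (q - int t) v)))"
  unfolding twist_bound[OF neg(1) N(1)] twist_bound[OF neg(2) N(2)]
  by (simp add: lin_sum[OF lin[rule_format]] lin_scale[OF lin[rule_format]] scale_sum_right)

text \<open>The defining relation is bilinear and invariant under shifts of the index, hence survives
  multiplication of all series by a common scalar series.\<close>

lemma twist_rel:
  assumes v: "v \<in> VJ"
  shows "twist g D (p + 1) (twist g B q v) - twist g B q (twist g D (p + 1) v)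
    - twist g D p (twist g B (q + 1) v) + twist g B (q + 1) (twist g D p v) =
    twist g D p (twist g B q v) - twist g D q (twist g B p v)"
proof -
  define N where "N = nat (max (p + 1) (q + 1))"
  have N: "p \<le> int N" "q \<le> int N" "p + 1 \<le> int N" "q + 1 \<le> int N" by (auto simp: N_def)
  have lD: "\<forall>r. lin (D r)" and lB: "\<forall>r. lin (B r)" using S_lin ab by auto
  have nD: "\<forall>r v. r < 0 \<longrightarrow> D r v = 0" and nB: "\<forall>r v. r < 0 \<longrightarrow> B r v = 0" using S_neg by auto
  let ?g = "\<lambda>s t. fps_nth g s * fps_nth g t"
  note DB = twist_twist[of D B, OF lD nD nB]
  \<comment> \<open>The weights \<open>?g\<close> are symmetric, so products in the opposite order
    can be written with \<open>s\<close> attached to \<open>D\<close> and \<open>t\<close> to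
    \<open>B\<close> as well.\<close>
  have swap: "(\<Sum>s\<le>N. \<Sum>t\<le>N. scale (?g s t) (F s t)) = (\<Sum>s\<le>N. \<Sum>t\<le>N. scale (?g s t) (F t s))" for F :: "nat \<Rightarrow> nat \<Rightarrow> 'v"
  proof -
    have "(\<Sum>s\<le>N. \<Sum>t\<le>N. scale (?g s t) (F s t)) = (\<Sum>t\<le>N. \<Sum>s\<le>N. scale (?g s t) (F s t))" by (rule sum.swap)
    then show ?thesis by (simp only: mult.commute)
  qed
  have BD: "twist g B q (twist g D p v) = (\<Sum>s\<le>N. \<Sum>t\<le>N. scale (?g s t) (B (q - int t) (D (p - int s) v)))"
    if "p \<le> int N" "q \<le> int N" for p q
    unfolding twist_twist[of B D, OF lB nB nD that(2,1)] by (rule swap)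
  have DB': "twist g D q (twist g B p v) = (\<Sum>s\<le>N. \<Sum>t\<le>N. scale (?g s t) (D (q - int t) (B (p - int s) v)))"
    unfolding DB[OF N(2,1)] by (rule swap)
  have sh: "x + 1 - int s = x - int s + 1" for x s by simp
  have "twist g D (p + 1) (twist g B q v) - twist g B q (twist g D (p + 1) v)
    - twist g D p (twist g B (q + 1) v) + twist g B (q + 1) (twist g D p v) =
    (\<Sum>s\<le>N. \<Sum>t\<le>N. scale (?g s t) (D (p - int s + 1) (B (q - int t) v) - B (q - int t) (D (p - int s + 1) v)
       - D (p - int s) (B (q - int t + 1) v) + B (q - int t + 1) (D (p - int s) v)))"
    unfolding DB[OF N(3,2)] DB[OF N(1,4)] BD[OF N(3,2)] BD[OF N(1,4)] sh
    by (simp only: scale_right_diff_distrib scale_right_distrib sum_subtractf sum.distrib)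
  also have "\<dots> = (\<Sum>s\<le>N. \<Sum>t\<le>N. scale (?g s t) (D (p - int s) (B (q - int t) v) - D (q - int t) (B (p - int s) v)))"
    unfolding rel_DB[OF v] by (rule refl)
  also have "\<dots> = twist g D p (twist g B q v) - twist g D q (twist g B p v)"
    unfolding DB[OF N(1,2)] DB' by (simp only: scale_right_diff_distrib sum_subtractf)
  finally show ?thesis .
qed

lemma functional_comp_lin: "functional l \<Longrightarrow> lin R \<Longrightarrow> functional (\<lambda>v. l (R v))"
  by (auto simp: functional_iff lin_iff)

text \<open>An eigencovector \<open>\<omega>\<close> of \<open>D(u)\<close> on \<open>M\<^sub>m\<^sub>+\<^sub>1\<close> gives covectors \<open>\<omega> B\<^sub>q\<close> on \<open>M\<^sub>m\<close>; after
  normalising \<open>\<omega> D(u) = \<omega>\<close>, the operator \<open>D(u)\<close> acts on their span as \<open>1 - (u - Z)\<^sup>-\<^sup>1\<close> with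
  \<open>Z : \<omega> B\<^sub>q \<mapsto> \<omega> B\<^sub>q\<^sub>+\<^sub>1\<close>, so an eigencovector of \<open>Z\<close> with eigenvalue \<open>c\<close> multiplies the eigenvalue
  by \<open>(u - c - 1) / (u - c)\<close>.\<close>

lemma covector_step:
  assumes \<omega>: "functional \<omega>" and nz: "\<exists>v\<in>M (Suc m). \<omega> v \<noteq> 0" and d0: "fps_nth d 0 = 1"
    and eig: "\<And>v q. v \<in> M (Suc m) \<Longrightarrow> \<omega> (D (int q) v) = fps_nth d q * \<omega> v"
  shows "\<exists>\<omega>' c d'. functional \<omega>' \<and> (\<exists>v\<in>M m. \<omega>' v \<noteq> 0) \<and>
    (\<forall>v\<in>M m. \<forall>q. \<omega>' (D (int q) v) = fps_nth d' q * \<omega>' v) \<and> fps_nth d' 0 = 1 \<and>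
    d' * (1 - fps_const c * fps_X) = d * (1 - fps_const (c + 1) * fps_X)"
proof -
  \<comment> \<open>Multiplying by \<open>1/d\<close> normalises the eigenvalue of \<open>D\<close>
    on \<open>\<omega>\<close> to 1.\<close>
  define g where "g = inverse d"
  have gd: "g * d = 1" unfolding g_def using d0 by (simp add: inverse_mult_eq_1)
  have g0: "fps_nth g 0 = 1" using arg_cong[OF gd, of "\<lambda>f. fps_nth f 0"] d0 by simp
  have lD: "lin (D r)" and lB: "lin (B r)" for r using S_lin ab by auto
  let ?D = "twist g D" and ?B = "twist g B"
  have tD: "lin (?D p)" and tB: "lin (?B p)" for p using twist_lin lD lB by auto
  have DM: "?D p v \<in> M j" if "v \<in> M j" for p v j using D_M[OF that] by (intro twist_M M_subspace) blast
  have BM: "?B p v \<in> M (Suc j)" if "v \<in> M j" for p v j using B_M[OF that] by (intro twist_M M_subspace) blast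
  have \<omega>D: "\<omega> (?D p v) = (if p = 0 then \<omega> v else 0)" if v: "v \<in> M (Suc m)" for p v
  proof (cases "p < 0")
    case True
    then show ?thesis by (simp add: twist_def S_neg functional_0[OF \<omega>])
  next
    case False
    have "\<omega> (?D p v) = (\<Sum>s\<le>nat p. fps_nth g s * \<omega> (D (int (nat p - s)) v))"
      unfolding twist_def functional_sum[OF \<omega>] functional_scale[OF \<omega>]
    proof (rule sum.cong)
      fix s assume "s \<in> {..nat p}"
      then have "p - int s = int (nat p - s)" using False by auto
      then show "fps_nth g s * \<omega> (D (p - int s) v) = fps_nth g s * \<omega> (D (int (nat p - s)) v)" by (simp only:)
    qed simp
    also have "\<dots> = fps_nth (g * d) (nat p) * \<omega> v"
      by (simp only: eig[OF v] fps_mult_nth sum_distrib_right mult.assoc atMost_atLeast0)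
    finally show ?thesis using gd False by (simp add: fps_one_nth)
  qed
  define \<beta> where "\<beta> q v = \<omega> (?B q v)" for q v
  have f\<beta>: "functional (\<beta> q)" for q unfolding \<beta>_def by (rule functional_comp_lin[OF \<omega> tB])
  have \<beta>neg: "\<beta> q v = 0" if "q \<le> 0" for q v
    unfolding \<beta>_def twist_def using that ab functional_0[OF \<omega>] by (cases "q = 0") (simp_all add: S_neg S_0)
  \<comment> \<open>The twisted relation under \<open>\<omega>\<close>: by \<open>\<omega>D\<close>
    an outer \<open>?D\<close> survives only at index 0.\<close>
  have rel: "(if p + 1 = 0 then \<beta> q v else 0) - \<beta> q (?D (p + 1) v) - (if p = 0 then \<beta> (q + 1) v else 0) + \<beta> (q + 1) (?D p v)
      = (if p = 0 then \<beta> q v else 0) - (if q = 0 then \<beta> p v else 0)" if v: "v \<in> M m" for p q v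
    using arg_cong[OF twist_rel[OF M_VJ[OF v], of g p q], of \<omega>]
    unfolding functional_add[OF \<omega>] functional_diff[OF \<omega>] \<omega>D[OF BM[OF v]] \<beta>_def .
  have D0: "?D 0 v = v" for v by (simp add: twist_def g0 S_0)
  have \<beta>1: "\<beta> q (?D 1 v) = - \<beta> q v" if "v \<in> M m" "q \<ge> 1" for q v
    using rel[OF that(1), of 0 q] that(2) by (simp add: D0 eq_neg_iff_add_eq_0 add.commute neg_eq_iff_add_eq_0)
  have \<beta>Suc: "\<beta> q (?D (int p + 2) v) = \<beta> (q + 1) (?D (int p + 1) v)" if "v \<in> M m" "q \<ge> 1" for p q v
    using rel[OF that(1), of "int p + 1" q] that(2) by (simp add: add.assoc)
  have \<beta>D: "\<beta> q (?D (int p + 1) v) = - \<beta> (q + int p) v" if "v \<in> M m" "q \<ge> 1" for p q v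
    using that(2)
  proof (induction p arbitrary: q)
    case 0 then show ?case using \<beta>1[OF that(1)] by simp
  next
    case (Suc p)
    have "\<beta> q (?D (int (Suc p) + 1) v) = \<beta> (q + 1) (?D (int p + 1) v)" using \<beta>Suc[OF that(1) Suc.prems, of p] by (simp add: add.commute)
    also have "\<dots> = - \<beta> (q + int (Suc p)) v" using Suc.IH[of "q + 1"] Suc.prems by (simp add: algebra_simps)
    finally show ?case .
  qed
  \<comment> \<open>By \<open>\<beta>D\<close> with \<open>p = 1\<close> this operator raises the
    index of \<open>\<beta>\<close> by one.\<close>
  define Z where "Z v = - ?D 2 v" for v
  have lZ: "lin Z" using tD[of 2] unfolding Z_def by (auto simp: lin_iff)
  have ZM: "Z v \<in> M m" if "v \<in> M m" for v
    unfolding Z_def using subspace_neg[OF M_subspace DM[OF that]] .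
  have \<beta>Z: "\<beta> q (Z v) = \<beta> (q + 1) v" if "v \<in> M m" "q \<ge> 1" for q v
    using \<beta>D[OF that, of 1] by (simp add: Z_def functional_minus[OF f\<beta>])
  have \<beta>Zpow: "\<beta> 1 ((Z ^^ j) v) = \<beta> (1 + int j) v" if "v \<in> M m" for j v
  proof -
    have "\<beta> q ((Z ^^ j) v) = \<beta> (q + int j) v" if "q \<ge> 1" for q
      using \<open>v \<in> M m\<close> that
    proof (induction j arbitrary: v q)
      case (Suc j)
      then show ?case using \<beta>Z[of v "q + int j"] ZM by (simp add: funpow_swap1 algebra_simps)
    qed simp
    then show ?thesis by simp
  qed
  \<comment> \<open>If \<open>\<beta> 1\<close> vanished, so would all its shifts and, after undoing
    the twist, every \<open>\<omega>\<close> composed with a \<open>B q\<close>. These determine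
    \<open>\<omega>\<close> on \<open>M (Suc m)\<close>.\<close>
  have nz\<beta>: "\<exists>v\<in>M m. \<beta> 1 v \<noteq> 0"
  proof (rule ccontr)
    assume "\<not> ?thesis"
    then have z: "\<beta> 1 v = 0" if "v \<in> M m" for v using that by blast
    have "(Z ^^ j) v \<in> M m" if "v \<in> M m" for j v by (induction j) (use that ZM in auto)
    then have z': "\<beta> (1 + int j) v = 0" if "v \<in> M m" for j v using \<beta>Zpow[OF that, of j] z that by simp
    have all: "\<omega> (B (int q) v) = 0" if v: "v \<in> M m" for q v
    proof (induction q rule: less_induct)
      case (less q)
      have "\<beta> (int q) v = 0"
      proof (cases q)
        case 0 then show ?thesis by (simp add: \<beta>neg)
      next
        case (Suc q') then show ?thesis using z'[OF v, of q'] by simp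
      qed
      moreover have "\<beta> (int q) v = (\<Sum>s\<le>q. fps_nth g s * \<omega> (B (int q - int s) v))"
        unfolding \<beta>_def twist_def by (simp add: functional_sum[OF \<omega>] functional_scale[OF \<omega>])
      moreover have "(\<Sum>s\<le>q. fps_nth g s * \<omega> (B (int q - int s) v)) = (\<Sum>s\<in>{0}. fps_nth g s * \<omega> (B (int q - int s) v))"
      proof (rule sum.mono_neutral_right)
        show "\<forall>s\<in>{..q} - {0}. fps_nth g s * \<omega> (B (int q - int s) v) = 0"
        proof
          fix s assume "s \<in> {..q} - {0}"
          then have "int q - int s = int (q - s)" "q - s < q" by auto
          then have "\<omega> (B (int q - int s) v) = 0" using less[of "q - s"] by (simp only:)
          then show "fps_nth g s * \<omega> (B (int q - int s) v) = 0" by (simp only: mult_zero_right)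
        qed
      qed auto
      ultimately show ?case by (simp add: g0)
    qed
    have "B q v \<in> {w. \<omega> w = 0}" if "v \<in> M m" for q v
      using all[OF that, of "nat q"] by (cases "q < 0") (simp_all add: S_neg functional_0[OF \<omega>])
    moreover have "subspace {w. \<omega> w = 0}"
      by (rule subspaceI) (simp_all add: functional_0[OF \<omega>] functional_add[OF \<omega>] functional_scale[OF \<omega>])
    ultimately show False using nz M_Suc_induct[of _ m "{w. \<omega> w = 0}"] by blast
  qed
  obtain Q c where Q: "\<exists>v\<in>M m. \<beta> 1 (poly_op Z Q v) \<noteq> 0"
    "\<And>v. v \<in> M m \<Longrightarrow> \<beta> 1 (poly_op Z Q (Z v)) = c * \<beta> 1 (poly_op Z Q v)"
    using eigen_functional[OF lZ ZM M_subspace f\<beta> nz\<beta>] by blast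
  define \<omega>' where "\<omega>' v = \<beta> 1 (poly_op Z Q v)" for v
  have f': "functional \<omega>'" unfolding \<omega>'_def by (rule functional_comp_lin[OF f\<beta> lin_poly_op[OF lZ]])
  have \<omega>'exp: "\<omega>' v = (\<Sum>j\<le>degree Q. coeff Q j * \<beta> (1 + int j) v)" if "v \<in> M m" for v
    unfolding \<omega>'_def poly_op_def by (simp add: functional_sum[OF f\<beta>] functional_scale[OF f\<beta>] \<beta>Zpow[OF that])
  have \<omega>'Z: "\<omega>' ((Z ^^ p) v) = c ^ p * \<omega>' v" if "v \<in> M m" for p v
    using that
  proof (induction p arbitrary: v)
    case (Suc p)
    have "\<omega>' ((Z ^^ Suc p) v) = \<omega>' ((Z ^^ p) (Z v))" by (simp add: funpow_swap1)
    also have "\<dots> = c ^ p * \<omega>' (Z v)" by (rule Suc.IH[OF ZM[OF Suc.prems]])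
    also have "\<omega>' (Z v) = c * \<omega>' v" unfolding \<omega>'_def by (rule Q(2)[OF Suc.prems])
    finally show ?case by simp
  qed simp
  have \<omega>'D: "\<omega>' (?D (int p + 1) v) = - (c ^ p) * \<omega>' v" if v: "v \<in> M m" for p v
  proof -
    have ZpM: "(Z ^^ p) v \<in> M m" by (induction p) (use v ZM in auto)
    have Zp: "\<beta> q ((Z ^^ p) v) = \<beta> (q + int p) v" if "q \<ge> 1" for q
      using v that
    proof (induction p arbitrary: v q)
      case (Suc p)
      then show ?case using \<beta>Z[of v "q + int p"] ZM by (simp add: funpow_swap1 algebra_simps)
    qed simp
    have "\<omega>' (?D (int p + 1) v) = (\<Sum>j\<le>degree Q. coeff Q j * - \<beta> (1 + int j + int p) v)"
      unfolding \<omega>'exp[OF DM[OF v]] using \<beta>D[OF v, of "1 + int _"] by simp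
    also have "\<dots> = - (\<Sum>j\<le>degree Q. coeff Q j * \<beta> (1 + int j) ((Z ^^ p) v))"
      by (simp add: Zp sum_negf)
    also have "\<dots> = - \<omega>' ((Z ^^ p) v)" unfolding \<omega>'exp[OF ZpM] by (rule refl)
    finally show ?thesis using \<omega>'Z[OF v, of p] by simp
  qed
  \<comment> \<open>With \<open>x = u^(- 1)\<close> this is \<open>1 - x / (1 - c x)\<close>, i.e.
    \<open>(1 - (c + 1) x) / (1 - c x)\<close>.\<close>
  define h where "h = Abs_fps (\<lambda>p. if p = 0 then 1 else - (c ^ (p - 1)))"
  have h: "h * (1 - fps_const c * fps_X) = 1 - fps_const (c + 1) * fps_X"
  proof (rule fps_ext)
    fix p
    have "fps_nth (h * (1 - fps_const c * fps_X)) p = fps_nth h p - c * (if p = 0 then 0 else fps_nth h (p - 1))"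
    proof -
      have "h * (1 - fps_const c * fps_X) = h - fps_const c * (fps_X * h)" by (simp add: algebra_simps)
      then show ?thesis by (simp add: fps_X_mult_nth)
    qed
    also have "\<dots> = fps_nth (1 - fps_const (c + 1) * fps_X) p"
    proof (cases p)
      case (Suc p') then show ?thesis by (cases p') (simp_all add: h_def fps_X_nth)
    qed (simp add: h_def)
    finally show "fps_nth (h * (1 - fps_const c * fps_X)) p = fps_nth (1 - fps_const (c + 1) * fps_X) p" .
  qed
  have \<omega>'D': "\<omega>' (?D (int p) v) = fps_nth h p * \<omega>' v" if v: "v \<in> M m" for p v
  proof (cases p)
    case (Suc p') then show ?thesis using \<omega>'D[OF v, of p'] by (simp add: h_def add.commute)
  qed (simp add: h_def D0)
  \<comment> \<open>Undoing the twist multiplies the eigenvalue \<open>h\<close> by \<open>d\<close>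
    again.\<close>
  have main: "\<omega>' (D (int q) v) = fps_nth (d * h) q * \<omega>' v" if v: "v \<in> M m" for q v
  proof -
    define F where "F = Abs_fps (\<lambda>q. \<omega>' (D (int q) v))"
    have "g * F = h * fps_const (\<omega>' v)"
    proof (rule fps_ext)
      fix p
      have "fps_nth (g * F) p = \<omega>' (?D (int p) v)"
        unfolding twist_def functional_sum[OF f'] functional_scale[OF f'] fps_mult_nth F_def atMost_atLeast0
      proof (rule sum.cong)
        fix s assume "s \<in> {0..nat (int p)}"
        then have "int p - int s = int (p - s)" by auto
        then show "fps_nth g s * fps_nth (Abs_fps (\<lambda>q. \<omega>' (D (int q) v))) (p - s) = fps_nth g s * \<omega>' (D (int p - int s) v)"
          by (simp only: fps_nth_Abs_fps)
      qed simp
      then show "fps_nth (g * F) p = fps_nth (h * fps_const (\<omega>' v)) p" by (simp add: \<omega>'D'[OF v])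
    qed
    then have "g * d * F = d * h * fps_const (\<omega>' v)" by (simp add: mult_ac)
    then have "fps_nth F q = fps_nth (d * h * fps_const (\<omega>' v)) q" by (simp add: gd)
    then show ?thesis by (simp add: F_def)
  qed
  have "fps_nth (d * h) 0 = 1" using d0 by (simp add: h_def)
  moreover have "d * h * (1 - fps_const c * fps_X) = d * (1 - fps_const (c + 1) * fps_X)" by (simp add: h mult.assoc)
  moreover have "\<exists>v\<in>M m. \<omega>' v \<noteq> 0" using Q(1) by (simp add: \<omega>'_def)
  ultimately show ?thesis using f' main by blast
qed

lemma mu_0: "fps_nth \<mu>1 0 = 1" "fps_nth \<mu>2 0 = 1"
proof -
  have "scale (fps_nth \<mu>1 0) \<xi> = scale 1 \<xi>" "scale (fps_nth \<mu>2 0) \<xi> = scale 1 \<xi>"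
    using eig1[of 0] eig2[of 0] by (simp_all add: S_0)
  then show "fps_nth \<mu>1 0 = 1" "fps_nth \<mu>2 0 = 1" using \<xi>(2) by (simp_all only: scale_cancel_right) auto
qed

lemma arrow_mu: "arrow \<mu>1 \<mu>2"
proof -
  obtain \<omega>0 where \<omega>0: "functional \<omega>0" "\<omega>0 \<zeta> = 1" using separating_functional_0[OF zeta_nonzero] by blast
  have "m \<le> deg \<Longrightarrow> \<exists>\<omega> d cs. functional \<omega> \<and> (\<exists>v\<in>M (deg - m). \<omega> v \<noteq> 0) \<and>
    (\<forall>v\<in>M (deg - m). \<forall>q. \<omega> (D (int q) v) = fps_nth d q * \<omega> v) \<and> fps_nth d 0 = 1 \<and>
    d * prod_list (map (\<lambda>c. 1 - fps_const c * fps_X) cs) = \<mu>1 * prod_list (map (\<lambda>c. 1 - fps_const (c + 1) * fps_X) cs)" for m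
  proof (induction m)
    case 0
    have "\<omega>0 (D (int q) v) = fps_nth \<mu>1 q * \<omega>0 v" if "v \<in> M deg" for v q
    proof -
      obtain c where "v = scale c \<zeta>" using M_deg[OF \<open>v \<in> M deg\<close>] by blast
      then show ?thesis using D_zeta[of q] by (simp add: lin_scale[OF S_lin[OF ab(2,2)]] functional_scale[OF \<omega>0(1)] mult.commute)
    qed
    moreover have "\<exists>v\<in>M deg. \<omega>0 v \<noteq> 0" using f_pow_M[of deg] \<omega>0(2) by (intro bexI[of _ \<zeta>]) auto
    ultimately show ?case using \<omega>0(1) mu_0(1) by (intro exI[of _ \<omega>0] exI[of _ \<mu>1] exI[of _ "[]"]) auto
  next
    case (Suc m)
    then obtain \<omega> d cs where IH: "functional \<omega>" "\<exists>v\<in>M (deg - m). \<omega> v \<noteq> 0"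
      "\<forall>v\<in>M (deg - m). \<forall>q. \<omega> (D (int q) v) = fps_nth d q * \<omega> v" "fps_nth d 0 = 1"
      "d * prod_list (map (\<lambda>c. 1 - fps_const c * fps_X) cs) = \<mu>1 * prod_list (map (\<lambda>c. 1 - fps_const (c + 1) * fps_X) cs)"
      by (simp del: M.simps, blast)
    have dm: "deg - m = Suc (deg - Suc m)" using Suc.prems by simp
    obtain \<omega>' c d' where s: "functional \<omega>'" "\<exists>v\<in>M (deg - Suc m). \<omega>' v \<noteq> 0"
      "\<forall>v\<in>M (deg - Suc m). \<forall>q. \<omega>' (D (int q) v) = fps_nth d' q * \<omega>' v" "fps_nth d' 0 = 1"
      "d' * (1 - fps_const c * fps_X) = d * (1 - fps_const (c + 1) * fps_X)"
      using covector_step[OF IH(1) IH(2)[unfolded dm] IH(4)] IH(3)[unfolded dm] by blast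
    have "d' * prod_list (map (\<lambda>c. 1 - fps_const c * fps_X) (c # cs)) =
      d' * (1 - fps_const c * fps_X) * prod_list (map (\<lambda>c. 1 - fps_const c * fps_X) cs)" by (simp add: mult.assoc)
    also have "\<dots> = d * prod_list (map (\<lambda>c. 1 - fps_const c * fps_X) cs) * (1 - fps_const (c + 1) * fps_X)"
      unfolding s(5) by (simp only: mult_ac)
    also have "\<dots> = \<mu>1 * prod_list (map (\<lambda>c. 1 - fps_const (c + 1) * fps_X) (c # cs))"
      unfolding IH(5) by (simp only: mult_ac list.map prod_list.Cons)
    finally show ?case using s by (intro exI[of _ \<omega>'] exI[of _ d'] exI[of _ "c # cs"]) auto
  qed
  from this[of deg] obtain \<omega> d cs where w: "functional \<omega>" "\<exists>v\<in>M 0. \<omega> v \<noteq> 0"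
    "\<And>v q. v \<in> M 0 \<Longrightarrow> \<omega> (D (int q) v) = fps_nth d q * \<omega> v"
    "d * prod_list (map (\<lambda>c. 1 - fps_const c * fps_X) cs) = \<mu>1 * prod_list (map (\<lambda>c. 1 - fps_const (c + 1) * fps_X) cs)"
    by (simp del: M.simps, blast)
  have \<xi>M: "\<xi> \<in> M 0" by (simp add: span_base)
  \<comment> \<open>\<open>M 0\<close> is spanned by \<open>\<xi>\<close>, so a covector that is
    nonzero there reads off the eigenvalue of \<open>D\<close> on \<open>\<xi>\<close>.\<close>
  have "\<omega> \<xi> \<noteq> 0"
  proof
    assume z: "\<omega> \<xi> = 0"
    have "subspace {w. \<omega> w = 0}"
      by (rule subspaceI) (simp_all add: functional_0[OF w(1)] functional_add[OF w(1)] functional_scale[OF w(1)])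
    then show False using M_0_induct[of _ "{w. \<omega> w = 0}"] z w(2) by blast
  qed
  moreover have "fps_nth d q * \<omega> \<xi> = fps_nth \<mu>2 q * \<omega> \<xi>" for q
    using w(3)[OF \<xi>M, of q] unfolding eig2 functional_scale[OF w(1)] by (rule sym)
  ultimately have "d = \<mu>2" by (intro fps_ext) auto
  moreover have "\<mu>2 \<noteq> 0" using mu_0(2) by auto
  ultimately show ?thesis using arrowI w(4) by blast
qed

end

section \<open>Highest weight representations\<close>

context yangian_module begin

lemma carrier_Y_sp: "carrier (Y_sp n :: 'k free_alg set ring) = Y_class n ` carrier (free_algebra n)"
  by (auto simp: Y_sp_def FactRing_def A_RCOSETS_def' Y_class_def)

text \<open>The orbit of \<open>\<xi>\<close> is a subspace because the algebra contains the
  scalars, it is invariant, and it contains \<open>\<xi>\<close> through the unit.\<close>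

lemma cyclic_if_simple:
  assumes simple: "Y_simple n scale \<pi>" and nz: "\<xi> \<noteq> 0"
  shows "(\<lambda>a. \<pi> a \<xi>) ` carrier (Y_sp n) = UNIV"
proof -
  let ?C = "carrier (free_algebra n) :: 'k free_alg set"
  let ?U = "(\<lambda>a. op a \<xi>) ` ?C"
  have U: "(\<lambda>a. \<pi> a \<xi>) ` carrier (Y_sp n) = ?U" by (simp add: carrier_Y_sp image_image op_def)
  have "subspace ?U"
  proof (rule subspaceI)
    show "0 \<in> ?U" using free_algebra_0[of n] op_zero[of \<xi>] by force
    fix x y assume "x \<in> ?U" "y \<in> ?U"
    then obtain a b where ab: "a \<in> ?C" "b \<in> ?C" "x = op a \<xi>" "y = op b \<xi>" by blast
    then have "x + y = op (a + b) \<xi>" by (simp add: op_add)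
    then show "x + y \<in> ?U" using carrier_free_algebra_add[OF ab(1,2)] by blast
  next
    fix c x assume "x \<in> ?U"
    then obtain a where a: "a \<in> ?C" "x = op a \<xi>" by blast
    have "op (scalar c * a) \<xi> = scale c x"
      using module op_mult[OF scalar_in_carrier a(1), of c \<xi>] a(2) by (simp add: Y_module_def op_def)
    then show "scale c x \<in> ?U" using carrier_free_algebra_mult[OF scalar_in_carrier a(1)] by (metis image_eqI)
  qed
  moreover have "\<pi> y w \<in> ?U" if y: "y \<in> carrier (Y_sp n)" and w: "w \<in> ?U" for y w
  proof -
    obtain b where b: "b \<in> ?C" "y = Y_class n b" using y by (auto simp: carrier_Y_sp)
    obtain a where a: "a \<in> ?C" "w = op a \<xi>" using w by blast
    have "\<pi> y w = op (b * a) \<xi>" using op_mult[OF b(1) a(1)] a(2) b(2) by (simp add: op_def)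
    then show ?thesis using carrier_free_algebra_mult[OF b(1) a(1)] by blast
  qed
  ultimately have "?U = {0} \<or> ?U = UNIV" using simple unfolding Y_simple_def by blast
  moreover have "\<xi> \<in> ?U" using free_algebra_1[of n] op_one[of \<xi>] by force
  ultimately show ?thesis unfolding U using nz by blast
qed

end

lemma double_arrow_if_even:
  fixes \<mu> :: "'k::field fps"
  assumes "\<And>r. odd r \<Longrightarrow> fps_nth \<mu> r = 0" "\<mu> \<noteq> 0"
  shows "double_arrow \<mu>"
proof -
  have "neg_arg \<mu> = \<mu>"
  proof (rule fps_ext)
    fix r
    show "fps_nth (neg_arg \<mu>) r = fps_nth \<mu> r"
      using assms(1)[of r] unfolding neg_arg_def fps_compose_uminus' by (cases "even r") simp_all
  qed
  then have "fps_to_fls (neg_arg \<mu>) / fps_to_fls \<mu> = shift_ratio 1"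
    using assms(2) by (simp add: shift_ratio_def poly_at_def)
  then show ?thesis unfolding double_arrow_def by (intro exI[of _ 1]) (simp add: pcompose_1)
qed

theorem theorem3p22:
  fixes scale :: "'k::alg_closed_field \<Rightarrow> 'v::ab_group_add \<Rightarrow> 'v"
    and \<rho> :: "'k matrix \<Rightarrow> 'v \<Rightarrow> 'v"
    and \<pi> :: "'k free_alg set \<Rightarrow> 'v \<Rightarrow> 'v"
    and n k :: nat
    and \<kappa> :: "nat \<Rightarrow> nat \<Rightarrow> int"
  assumes "CHAR('k) \<noteq> 2"
    and "1 \<le> n"
    and "Rep_Sp_Y n scale \<rho> \<pi>"
    and "Y_simple n scale \<pi>"
    and "Sp_decomposition n scale \<rho> k \<kappa>"
    and "\<forall>j\<in>{1..k}. \<kappa> j \<in> dominant_weights n \<inter> closed_alcove n CHAR('k)"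
    and "\<forall>j\<in>{1..k}. \<kappa> j 1 = 0"
  shows "\<exists>\<mu> :: nat \<Rightarrow> 'k fps.
           is_V_mu n scale \<pi> \<mu> \<and>
           double_arrow (\<mu> 1) \<and>
           (\<forall>i\<in>{1..<n}. arrow (\<mu> i) (\<mu> (Suc i)))"
proof -
  have two: "(2::'k) \<noteq> 0"
  proof
    assume "(2::'k) = 0"
    then have "of_nat 2 = (0::'k)" by simp
    then have "CHAR('k) dvd 2" by (simp only: of_nat_eq_0_iff_char_dvd)
    then have "CHAR('k) \<le> 2" "CHAR('k) \<noteq> 0" using dvd_imp_le[of "CHAR('k)" 2] by (auto intro!: gr0I)
    then show False using assms(1) CHAR_not_1[where 'a = 'k] by (cases "CHAR('k) = 1") auto
  qed
  obtain W where W: "\<forall>j\<in>{1..k}. is_simple_hw_module n scale \<rho> (\<kappa> j) (W j)"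
    "\<forall>v. \<exists>!w. w \<in> (\<Pi>\<^sub>E j\<in>{1..k}. W j) \<and> v = (\<Sum>j=1..k. w j)"
    using assms(5) unfolding Sp_decomposition_def by blast
  have rep: "vector_space scale" "\<exists>B. finite B \<and> module.span scale B = UNIV" "Sp_module n scale \<rho>" "Y_module n scale \<pi>"
    "\<forall>i\<in>index_set n. \<forall>j\<in>index_set n. is_differential n scale \<rho> (F_mat i j) (\<pi> (s_Y n i j 1))"
    using assms(3) unfolding Rep_Sp_Y_def by blast+
  interpret Y: yangian_module scale n \<pi>
    by (intro yangian_module.intro fin_vector_space.intro yangian_module_axioms.intro fin_vector_space_axioms.intro rep two)
  \<comment> \<open>The generators of order one act as the Lie algebra; compatibility of the two
    actions makes them the differentials of the group action.\<close>
  define T where "T a b = Y.S a b 1" for a b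
  interpret yangian_alcove scale n \<rho> T k \<kappa> W Y.S
  proof (intro yangian_alcove.intro alcove_module.intro sp_module.intro Y.fin_vector_space_axioms
      sp_module_axioms.intro alcove_module_axioms.intro yangian_alcove_axioms.intro)
    show "is_differential n scale \<rho> (F_mat a b) (T a b)" if "a \<in> index_set n" "b \<in> index_set n" for a b
      using rep(5) that by (simp add: T_def Y.S_eq)
    show "\<exists>v :: 'v. v \<noteq> 0" using assms(4) by (simp add: Y_simple_def)
    show "\<exists>!w. w \<in> (\<Pi>\<^sub>E j\<in>{1..k}. W j) \<and> v = (\<Sum>j=1..k. w j)" for v using W(2) by blast
  qed (use assms(6,7) W(1) in \<open>simp_all only: simp_thms T_def two assms(2) rep(3) Y.S_lin Y.S_neg Y.S_0 Y.lie_action Y.quaternary Y.symmetry Y.S_1_sym[symmetric]\<close>)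
  obtain \<xi> where \<xi>: "\<xi> \<in> Xi" "\<xi> \<noteq> 0" "\<forall>i\<in>{1..n}. \<forall>r. \<exists>c. Y.S (int i) (int i) r \<xi> = scale c \<xi>"
    using highest_vector_exists by blast
  then obtain m where m: "Y.S (int i) (int i) r \<xi> = scale (m i r) \<xi>" if "i \<in> {1..n}" for i r by metis
  define \<mu> where "\<mu> i = Abs_fps (\<lambda>r. m i (int r))" for i
  have \<mu>: "Y.S (int i) (int i) (int r) \<xi> = scale (fps_nth (\<mu> i) r) \<xi>" if "i \<in> {1..n}" for i r
    using m[OF that] by (simp add: \<mu>_def)
  have \<mu>0: "fps_nth (\<mu> i) 0 = 1" if "i \<in> {1..n}" for i
  proof -
    have "scale (fps_nth (\<mu> i) 0) \<xi> = scale 1 \<xi>" using \<mu>[OF that, of 0] by (simp add: Y.S_0)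
    then show ?thesis using \<xi>(2) by (simp only: Y.scale_cancel_right) auto
  qed
  have "highest_weight_rep n scale \<pi> \<mu>"
    unfolding highest_weight_rep_def
  proof (intro conjI exI[of _ \<xi>] ballI impI allI)
    show "(\<lambda>a. \<pi> a \<xi>) ` carrier (Y_sp n) = UNIV" by (rule Y.cyclic_if_simple[OF assms(4) \<xi>(2)])
    show "\<pi> (s_Y n i j r) \<xi> = 0" if "i \<in> index_set n" "j \<in> index_set n" "i < j" for i j r
      using S_raising_Xi[OF \<xi>(1) that(1,2,3), of "int r"] by (simp add: Y.S_eq)
    show "\<pi> (s_Y n (int i) (int i) r) \<xi> = scale (fps_nth (\<mu> i) r) \<xi>" if "i \<in> {1..n}" for i r
      using \<mu>[OF that, of r] by (simp add: Y.S_eq)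
  qed (use \<mu>0 \<xi>(2) in auto)
  then have "is_V_mu n scale \<pi> \<mu>" using assms(4) by (simp add: is_V_mu_def)
  moreover have "double_arrow (\<mu> 1)"
  proof (rule double_arrow_if_even)
    have one: "1 \<in> {1..n}" using assms(2) by simp
    show "\<mu> 1 \<noteq> 0" using \<mu>0[OF one] by auto
    show "fps_nth (\<mu> 1) r = 0" if "odd r" for r
      using first_component_even[OF \<xi>(1,2), of "m 1" "int r"] m[OF one] that by (simp add: \<mu>_def)
  qed
  moreover have "arrow (\<mu> i) (\<mu> (Suc i))" if i: "i \<in> {1..<n}" for i
  proof -
    have "i \<in> {1..n}" "Suc i \<in> {1..n}" using i by auto
    note eig = this[THEN \<mu>]
    interpret gl2_vector scale n \<rho> T k \<kappa> W Y.S i "Suc i" \<xi> "\<mu> i" "\<mu> (Suc i)"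
      by (intro gl2_vector.intro gl2_vector_axioms.intro yangian_alcove_axioms) (use i \<xi> eig in \<open>simp_all only: atLeastLessThan_iff simp_thms\<close>)
    show ?thesis by (rule arrow_mu)
  qed
  ultimately show ?thesis by blast
qed

end
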